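(* Let $X$ be a second countable compact Hausdorff space, $\mu$ a Borel probability measure on $X$, $A$ a second countable compact Hausdorff space, $H$ a separable Hilbert space, and $\phi:C(A)\to L^\infty(X,\mu,\mathcal{B}(H))$ a unital completely positive map. Then there exist a separable Hilbert space $K$, an isometry $V:H\to K$ and a $\mu$-measurable family $(\pi_x)_{x\in X}$ of unital $*$-representations of $C(A)$ on $K$, such that for every $u\in C(A)$, $$\phi(u)(x)=V^*\pi_x(u)V\qquad\text{for }\mu\text{-almost every }x\in X.$$
   Context: $L^\infty(X,\mu,\mathcal{B}(H))$ is the C*-algebra (with pointwise operations and essential supremum norm) of all $\mu$-a.e. equivalence classes of essentially norm-bounded functions $F:X\to\mathcal{B}(H)$ such that $x\mapsto\langle F(x)\xi,\eta\rangle$ is $\mu$-measurable for all $\xi,\eta\in H$, where $\mu$-measurable means measurable with respect to the $\mu$-completion of the Borel $\sigma$-algebra of $X$. A family $(\pi_x)_{x\in X}$ of $*$-representations of $C(A)$ on $K$ is $\mu$-measurable if for all $u\in C(A)$ and $\xi,\eta\in K$ the function $x\mapsto\langle\pi_x(u)\xi,\eta\rangle$ is $\mu$-measurable. *)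

theory Defs
  imports "HOL-Probability.Probability" "HOL-Algebra.Algebraic_Closure_Type"
begin

text \<open>
  Hilbert spaces, operators and algebras are carrier-based, on top of the module records and
  locales of HOL-Algebra (whose multiplicative fields stay unused for Hilbert spaces), since the
  existence of a Hilbert space cannot be stated by quantifying over types.
\<close>

section \<open>Complex Hilbert spaces\<close>

record 'h inner_prod_space = "(complex, 'h) module" +
  ip :: "'h \<Rightarrow> 'h \<Rightarrow> complex"

definition ip_norm :: "('h, 'm) inner_prod_space_scheme \<Rightarrow> 'h \<Rightarrow> real" where
  "ip_norm H \<xi> = sqrt (Re (ip H \<xi> \<xi>))"

text \<open>The value off the carrier is immaterial; it is chosen so that the locale
  \<^locale>\<open>Metric_space\<close>, which demands symmetry and nonnegativity everywhere, applies.\<close>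
definition ip_dist :: "('h, 'm) inner_prod_space_scheme \<Rightarrow> 'h \<Rightarrow> 'h \<Rightarrow> real" where
  "ip_dist H \<xi> \<eta> =
     (if \<xi> \<in> carrier H \<and> \<eta> \<in> carrier H then ip_norm H (\<xi> \<ominus>\<^bsub>H\<^esub> \<eta>) else 0)"

text \<open>The inner product is linear in its first argument.\<close>
locale hilbert_space =
  Module.module "ring_of_type_algebra :: complex ring" H
  for H :: "('h, 'm) inner_prod_space_scheme" (structure) +
  assumes ip_add: "\<lbrakk>\<xi> \<in> carrier H; \<eta> \<in> carrier H; \<zeta> \<in> carrier H\<rbrakk>
      \<Longrightarrow> ip H (\<xi> \<oplus> \<eta>) \<zeta> = ip H \<xi> \<zeta> + ip H \<eta> \<zeta>"
    and ip_smult: "\<lbrakk>\<xi> \<in> carrier H; \<zeta> \<in> carrier H\<rbrakk> \<Longrightarrow> ip H (c \<odot> \<xi>) \<zeta> = c * ip H \<xi> \<zeta>"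
    and ip_cnj: "\<lbrakk>\<xi> \<in> carrier H; \<eta> \<in> carrier H\<rbrakk> \<Longrightarrow> ip H \<eta> \<xi> = cnj (ip H \<xi> \<eta>)"
    and ip_nonneg: "\<xi> \<in> carrier H \<Longrightarrow> 0 \<le> Re (ip H \<xi> \<xi>)"
    and ip_definite: "\<lbrakk>\<xi> \<in> carrier H; ip H \<xi> \<xi> = 0\<rbrakk> \<Longrightarrow> \<xi> = \<zero>"
    and complete: "Metric_space.mcomplete (carrier H) (ip_dist H)"

locale separable_hilbert_space = hilbert_space +
  assumes separable: "separable_space (Metric_space.mtopology (carrier H) (ip_dist H))"

section \<open>Bounded operators\<close>

text \<open>Operators are extensional on the carrier, so that equality of operators is equality of
  functions.\<close>
definition bounded_ops ::
    "('h, 'm) inner_prod_space_scheme \<Rightarrow> ('k, 'n) inner_prod_space_scheme \<Rightarrow> ('h \<Rightarrow> 'k) set" where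
  "bounded_ops H K = {T \<in> carrier H \<rightarrow>\<^sub>E carrier K.
     (\<forall>\<xi>\<in>carrier H. \<forall>\<eta>\<in>carrier H. T (\<xi> \<oplus>\<^bsub>H\<^esub> \<eta>) = T \<xi> \<oplus>\<^bsub>K\<^esub> T \<eta>) \<and>
     (\<forall>c. \<forall>\<xi>\<in>carrier H. T (c \<odot>\<^bsub>H\<^esub> \<xi>) = c \<odot>\<^bsub>K\<^esub> T \<xi>) \<and>
     (\<exists>C. \<forall>\<xi>\<in>carrier H. ip_norm K (T \<xi>) \<le> C * ip_norm H \<xi>)}"

definition isometries ::
    "('h, 'm) inner_prod_space_scheme \<Rightarrow> ('k, 'n) inner_prod_space_scheme \<Rightarrow> ('h \<Rightarrow> 'k) set" where
  "isometries H K = {V \<in> bounded_ops H K. \<forall>\<xi>\<in>carrier H. ip_norm K (V \<xi>) = ip_norm H \<xi>}"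

definition adjoint_op ::
    "('h, 'm) inner_prod_space_scheme \<Rightarrow> ('k, 'n) inner_prod_space_scheme
      \<Rightarrow> ('h \<Rightarrow> 'k) \<Rightarrow> 'k \<Rightarrow> 'h" where
  "adjoint_op H K T = (\<lambda>\<eta>\<in>carrier K.
     THE \<zeta>. \<zeta> \<in> carrier H \<and> (\<forall>\<xi>\<in>carrier H. ip K (T \<xi>) \<eta> = ip H \<xi> \<zeta>))"

section \<open>Unital star-algebras\<close>

record 'b star_algebra = "(complex, 'b) module" +
  star :: "'b \<Rightarrow> 'b"

definition unital_star_hom ::
    "('a, 'm) star_algebra_scheme \<Rightarrow> ('b, 'n) star_algebra_scheme \<Rightarrow> ('a \<Rightarrow> 'b) set" where
  "unital_star_hom A B = {h \<in> ring_hom A B.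
     (\<forall>c. \<forall>a\<in>carrier A. h (c \<odot>\<^bsub>A\<^esub> a) = c \<odot>\<^bsub>B\<^esub> h a) \<and>
     (\<forall>a\<in>carrier A. h (star A a) = star B (h a))}"

text \<open>In a C*-algebra these are exactly the positive elements.\<close>
definition positive_elems :: "('b, 'm) star_algebra_scheme \<Rightarrow> 'b set" where
  "positive_elems A = {star A b \<otimes>\<^bsub>A\<^esub> b | b. b \<in> carrier A}"

definition matrix_alg ::
    "nat \<Rightarrow> ('b, 'm) star_algebra_scheme \<Rightarrow> (nat \<times> nat \<Rightarrow> 'b) star_algebra" where
  "matrix_alg n A =
     \<lparr>carrier = {..<n} \<times> {..<n} \<rightarrow>\<^sub>E carrier A,
      mult = (\<lambda>P Q. \<lambda>(i, j)\<in>{..<n} \<times> {..<n}. \<Oplus>\<^bsub>A\<^esub>k\<in>{..<n}. P (i, k) \<otimes>\<^bsub>A\<^esub> Q (k, j)),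
      one = (\<lambda>(i, j)\<in>{..<n} \<times> {..<n}. if i = j then \<one>\<^bsub>A\<^esub> else \<zero>\<^bsub>A\<^esub>),
      zero = (\<lambda>_\<in>{..<n} \<times> {..<n}. \<zero>\<^bsub>A\<^esub>),
      add = (\<lambda>P Q. \<lambda>p\<in>{..<n} \<times> {..<n}. P p \<oplus>\<^bsub>A\<^esub> Q p),
      smult = (\<lambda>c P. \<lambda>p\<in>{..<n} \<times> {..<n}. c \<odot>\<^bsub>A\<^esub> P p),
      star = (\<lambda>P. \<lambda>(i, j)\<in>{..<n} \<times> {..<n}. star A (P (j, i)))\<rparr>"

definition completely_positive ::
    "('a, 'm) star_algebra_scheme \<Rightarrow> ('b, 'n) star_algebra_scheme \<Rightarrow> ('a \<Rightarrow> 'b) \<Rightarrow> bool" where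
  "completely_positive A B \<phi> \<longleftrightarrow>
     \<phi> \<in> carrier A \<rightarrow> carrier B \<and>
     (\<forall>a\<in>carrier A. \<forall>b\<in>carrier A. \<phi> (a \<oplus>\<^bsub>A\<^esub> b) = \<phi> a \<oplus>\<^bsub>B\<^esub> \<phi> b) \<and>
     (\<forall>c. \<forall>a\<in>carrier A. \<phi> (c \<odot>\<^bsub>A\<^esub> a) = c \<odot>\<^bsub>B\<^esub> \<phi> a) \<and>
     (\<forall>n. \<forall>P\<in>positive_elems (matrix_alg n A).
        (\<lambda>p\<in>{..<n} \<times> {..<n}. \<phi> (P p)) \<in> positive_elems (matrix_alg n B))"

definition unital_completely_positive ::
    "('a, 'm) star_algebra_scheme \<Rightarrow> ('b, 'n) star_algebra_scheme \<Rightarrow> ('a \<Rightarrow> 'b) \<Rightarrow> bool" where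
  "unital_completely_positive A B \<phi> \<longleftrightarrow> completely_positive A B \<phi> \<and> \<phi> \<one>\<^bsub>A\<^esub> = \<one>\<^bsub>B\<^esub>"

section \<open>The algebras $B(H)$, $C(A)$ and $L^\infty(X, \mu, B(H))$\<close>

definition bounded_op_alg ::
    "('h, 'm) inner_prod_space_scheme \<Rightarrow> ('h \<Rightarrow> 'h) star_algebra" where
  "bounded_op_alg H =
     \<lparr>carrier = bounded_ops H H,
      mult = (\<lambda>S T. compose (carrier H) S T),
      one = (\<lambda>\<xi>\<in>carrier H. \<xi>),
      zero = (\<lambda>_\<in>carrier H. \<zero>\<^bsub>H\<^esub>),
      add = (\<lambda>S T. \<lambda>\<xi>\<in>carrier H. S \<xi> \<oplus>\<^bsub>H\<^esub> T \<xi>),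
      smult = (\<lambda>c T. \<lambda>\<xi>\<in>carrier H. c \<odot>\<^bsub>H\<^esub> T \<xi>),
      star = adjoint_op H H\<rparr>"

definition continuous_fun_alg :: "('a :: topological_space \<Rightarrow> complex) star_algebra" where
  "continuous_fun_alg =
     \<lparr>carrier = {u. continuous_on UNIV u},
      mult = (\<lambda>u v x. u x * v x),
      one = (\<lambda>_. 1),
      zero = (\<lambda>_. 0),
      add = (\<lambda>u v x. u x + v x),
      smult = (\<lambda>c u x. c * u x),
      star = (\<lambda>u x. cnj (u x))\<rparr>"

definition ess_bounded_op_funs ::
    "'x measure \<Rightarrow> ('h, 'm) inner_prod_space_scheme \<Rightarrow> ('x \<Rightarrow> 'h \<Rightarrow> 'h) set" where
  "ess_bounded_op_funs M H = {F.
     (\<forall>x\<in>space M. F x \<in> bounded_ops H H) \<and>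
     (\<forall>\<xi>\<in>carrier H. \<forall>\<eta>\<in>carrier H.
        (\<lambda>x. ip H (F x \<xi>) \<eta>) \<in> borel_measurable (completion M)) \<and>
     (\<exists>C. AE x in M. \<forall>\<xi>\<in>carrier H. ip_norm H (F x \<xi>) \<le> C * ip_norm H \<xi>)}"

definition Linf_class ::
    "'x measure \<Rightarrow> ('h, 'm) inner_prod_space_scheme \<Rightarrow> ('x \<Rightarrow> 'h \<Rightarrow> 'h)
      \<Rightarrow> ('x \<Rightarrow> 'h \<Rightarrow> 'h) set" where
  "Linf_class M H F = {G \<in> ess_bounded_op_funs M H. AE x in M. G x = F x}"

text \<open>The elements are the a.e. equivalence classes themselves; each union below is over all
  representatives of the arguments, and its members all coincide.\<close>
definition Linf_alg ::
    "'x measure \<Rightarrow> ('h, 'm) inner_prod_space_scheme \<Rightarrow> ('x \<Rightarrow> 'h \<Rightarrow> 'h) set star_algebra" where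
  "Linf_alg M H =
     \<lparr>carrier = Linf_class M H ` ess_bounded_op_funs M H,
      mult = (\<lambda>a b. \<Union>F\<in>a. \<Union>G\<in>b. Linf_class M H (\<lambda>x. F x \<otimes>\<^bsub>bounded_op_alg H\<^esub> G x)),
      one = Linf_class M H (\<lambda>_. \<one>\<^bsub>bounded_op_alg H\<^esub>),
      zero = Linf_class M H (\<lambda>_. \<zero>\<^bsub>bounded_op_alg H\<^esub>),
      add = (\<lambda>a b. \<Union>F\<in>a. \<Union>G\<in>b. Linf_class M H (\<lambda>x. F x \<oplus>\<^bsub>bounded_op_alg H\<^esub> G x)),
      smult = (\<lambda>c a. \<Union>F\<in>a. Linf_class M H (\<lambda>x. c \<odot>\<^bsub>bounded_op_alg H\<^esub> F x)),
      star = (\<lambda>a. \<Union>F\<in>a. Linf_class M H (\<lambda>x. star (bounded_op_alg H) (F x)))\<rparr>"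

definition measurable_rep_family ::
    "'x measure \<Rightarrow> ('k, 'm) inner_prod_space_scheme
      \<Rightarrow> ('x \<Rightarrow> ('a :: topological_space \<Rightarrow> complex) \<Rightarrow> 'k \<Rightarrow> 'k) \<Rightarrow> bool" where
  "measurable_rep_family M K \<pi> \<longleftrightarrow>
     (\<forall>x\<in>space M. \<pi> x \<in> unital_star_hom continuous_fun_alg (bounded_op_alg K)) \<and>
     (\<forall>u\<in>carrier continuous_fun_alg. \<forall>\<xi>\<in>carrier K. \<forall>\<eta>\<in>carrier K.
        (\<lambda>x. ip K (\<pi> x u \<xi>) \<eta>) \<in> borel_measurable (completion M))"

end

theory Submission
  imports Defs
begin

text \<open>
  Fix a countable dense \<open>*\<close>-subalgebra \<open>D\<close> of \<open>C(A)\<close> and a dense sequence \<open>h\<^sub>j\<close> of \<open>H\<close>. Since \<open>D\<close> is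
  countable, almost every fibre \<open>\<phi>\<^sub>x\<close> is additive and completely positive on \<open>D\<close>, so the vectors
  \<open>v \<otimes> h\<^sub>j\<close> carry the Stinespring form of \<open>\<phi>\<^sub>x\<close>. To realise them in a Hilbert space and with an
  isometry that do not depend on \<open>x\<close>, split \<open>v \<otimes> h\<^sub>j\<close> into its compression \<open>\<phi>\<^sub>x(v) h\<^sub>j\<close>, placed in the
  even coordinates of \<open>\<ell>\<^sup>2\<close> through a fixed embedding of \<open>H\<close>, and the part orthogonal to \<open>1 \<otimes> H\<close>,
  placed in the odd coordinates by the Cholesky factor of its Gram matrix, which is measurable in \<open>x\<close>.
  Multiplication by \<open>u\<close> then acts on the closed span of these vectors, and on its orthogonal
  complement one lets \<open>u\<close> act by its value at a fixed point of \<open>A\<close>.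
\<close>

section \<open>Projections and the space of square-summable sequences\<close>

text \<open>The obstacle is that every identity for \<open>\<phi>\<close> holds only off a null set
  depending on the functions involved, and that the usual Stinespring space is a quotient that
  changes with the fibre. Countability of \<open>D\<close> leaves one null set for the algebra; a
  general \<open>u\<close> is treated only at the end, where Kadison-Schwarz applied to the
  differences between \<open>u\<close> and its approximants from \<open>D\<close> costs a further
  null set for that \<open>u\<close> but leaves the representation untouched. Cholesky factors
  replace the abstract quotient because they depend on the Gram entries by arithmetic and square
  roots alone, and degenerate Gram matrices merely produce zero columns. The constant isometry comes
  from unitality: the part of \<open>1 \<otimes> h j\<close> orthogonal to
  \<open>1 \<otimes> H\<close> has norm zero, so its image has no odd coordinates and does not see
  \<open>x\<close>. Evaluation at a point keeps the representation unital on the complement. What is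
  left is measurability of the projection onto a span that moves with \<open>x\<close>; it is
  obtained by selecting, among countably many vectors, the earliest one that nearly minimises the
  distance.\<close>

lemma projection_exists:
  fixes M :: "'a::{real_inner,complete_space} set"
  assumes M: "closed M" "subspace M"
  shows "\<exists>p\<in>M. \<forall>m\<in>M. inner (x - p) m = 0"
proof -
  define d where "d = infdist x M"
  have ne: "M \<noteq> {}" using subspace_0[OF M(2)] by blast
  have d_le: "d \<le> norm (x - m)" if "m \<in> M" for m
    using infdist_le[OF that, of x] by (simp add: d_def dist_norm)
  have d0: "d \<ge> 0" by (simp add: d_def infdist_nonneg)
  have "\<exists>y\<in>M. norm (x - y) < d + 1 / real (Suc n)" for n
  proof -
    have "(INF a\<in>M. dist x a) < d + 1 / real (Suc n)"
      using ne by (simp add: d_def infdist_def)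
    then obtain y where "y \<in> M" "dist x y < d + 1 / real (Suc n)"
      using cInf_lessD[of "dist x ` M"] ne by auto
    then show ?thesis by (auto simp: dist_norm)
  qed
  then obtain y where y: "\<And>n. y n \<in> M" "\<And>n. norm (x - y n) < d + 1 / real (Suc n)" by metis
  have lim: "(\<lambda>n. norm (x - y n)) \<longlonglongrightarrow> d"
  proof (rule tendsto_sandwich[of "\<lambda>_. d" _ _ "\<lambda>n. d + 1 / real (Suc n)"])
    have "(\<lambda>n. d + 1 / real (Suc n)) \<longlonglongrightarrow> d + 0"
      by (intro tendsto_intros LIMSEQ_Suc[OF lim_1_over_n])
    then show "(\<lambda>n. d + 1 / real (Suc n)) \<longlonglongrightarrow> d" by simp
  qed (use y d_le in \<open>auto intro!: always_eventually less_imp_le\<close>)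
  then have lim2: "(\<lambda>n. (norm (x - y n))\<^sup>2) \<longlonglongrightarrow> d\<^sup>2" by (intro tendsto_intros)
  \<comment> \<open>The midpoint of \<open>y m\<close> and \<open>y n\<close> lies in
    \<open>M\<close>, so its distance to \<open>x\<close> is at least \<open>d\<close>; the
    parallelogram identity turns this into a bound on the distance of the two points.\<close>
  have par: "(norm (y m - y n))\<^sup>2 \<le> 2 * (norm (x - y m))\<^sup>2 + 2 * (norm (x - y n))\<^sup>2 - 4 * d\<^sup>2" for m n
  proof -
    have "(1/2) *\<^sub>R (y m + y n) \<in> M"
      using y M by (intro subspace_scale subspace_add) auto
    then have "d\<^sup>2 \<le> (norm (x - (1/2) *\<^sub>R (y m + y n)))\<^sup>2" using d_le d0 by (intro power_mono) auto
    moreover have "(norm (y m - y n))\<^sup>2 = 2 * (norm (x - y m))\<^sup>2 + 2 * (norm (x - y n))\<^sup>2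
        - 4 * (norm (x - (1/2) *\<^sub>R (y m + y n)))\<^sup>2"
      by (simp add: power2_norm_eq_inner algebra_simps inner_commute)
    ultimately show ?thesis by simp
  qed
  have "Cauchy y"
  proof (rule metric_CauchyI)
    fix e :: real assume e: "e > 0"
    have "\<forall>\<^sub>F n in sequentially. (norm (x - y n))\<^sup>2 < d\<^sup>2 + e\<^sup>2/4"
      using order_tendstoD(2)[OF lim2, of "d\<^sup>2 + e\<^sup>2/4"] e by simp
    then obtain N where N: "\<And>n. n \<ge> N \<Longrightarrow> (norm (x - y n))\<^sup>2 < d\<^sup>2 + e\<^sup>2/4"
      by (auto simp: eventually_sequentially)
    have "dist (y m) (y n) < e" if "m \<ge> N" "n \<ge> N" for m n
    proof -
      have "(norm (y m - y n))\<^sup>2 < e\<^sup>2" using par[of m n] N[OF that(1)] N[OF that(2)] by linarith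
      then show ?thesis using e by (simp add: dist_norm power_less_imp_less_base)
    qed
    then show "\<exists>M. \<forall>m\<ge>M. \<forall>n\<ge>M. dist (y m) (y n) < e" by blast
  qed
  then obtain p where p: "y \<longlonglongrightarrow> p" using Cauchy_convergent convergent_def by blast
  then have pM: "p \<in> M" using M(1) y(1) closed_sequentially by blast
  have "(\<lambda>n. norm (x - y n)) \<longlonglongrightarrow> norm (x - p)" by (intro tendsto_intros p)
  then have pd: "norm (x - p) = d" using lim LIMSEQ_unique by blast
  have "inner (x - p) m = 0" if m: "m \<in> M" for m
  proof (cases "m = 0")
    case False
    \<comment> \<open>The minimiser of the squared distance from \<open>x\<close> to
      \<open>p + t m\<close>. Since \<open>p\<close> is already closest, the gain at this
      \<open>t\<close> must vanish.\<close>
    define t where "t = inner (x - p) m / inner m m"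
    have "p + t *\<^sub>R m \<in> M" using pM m M by (intro subspace_scale subspace_add) auto
    then have "(norm (x - p))\<^sup>2 \<le> (norm (x - (p + t *\<^sub>R m)))\<^sup>2"
      using d_le pd by (intro power_mono) auto
    also have "\<dots> = (norm (x - p - t *\<^sub>R m))\<^sup>2" by (simp add: diff_diff_eq)
    also have "\<dots> = (norm (x - p))\<^sup>2 - 2 * t * inner (x - p) m + t\<^sup>2 * inner m m"
      by (simp only: power2_norm_eq_inner inner_diff_left inner_diff_right inner_scaleR_left inner_scaleR_right)
        (simp add: algebra_simps inner_commute power2_eq_square)
    also have "\<dots> = (norm (x - p))\<^sup>2 - (inner (x - p) m)\<^sup>2 / inner m m"
      using False by (simp add: t_def power2_eq_square)
    finally have "(inner (x - p) m)\<^sup>2 / inner m m \<le> 0" by simp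
    then show ?thesis using False
      by (metis divide_nonneg_pos inner_gt_zero_iff less_eq_real_def not_less zero_less_divide_iff zero_less_power2)
  qed auto
  then show ?thesis using pM by blast
qed

text \<open>Characterised by real orthogonality; on a complex subspace this upgrades to complex
  orthogonality in \<open>ip2_proj_orth\<close>.\<close>

definition proj :: "'a::real_inner set \<Rightarrow> 'a \<Rightarrow> 'a" where
  "proj M x = (SOME p. p \<in> M \<and> (\<forall>m\<in>M. inner (x - p) m = 0))"

section \<open>The space l2 as a complete inner product space\<close>

text \<open>A genuine type, so that limits, closures and Cauchy sequences come from the type
  classes; \<open>l2_space\<close> later repackages it as a carrier.\<close>

typedef l2 = "{f :: nat \<Rightarrow> complex. summable (\<lambda>n. (cmod (f n))\<^sup>2)}"
  morphisms coord Abs_l2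
  by (rule exI[of _ "\<lambda>_. 0"]) simp

setup_lifting type_definition_l2

lemma summable_coord: "summable (\<lambda>n. (cmod (coord x n))\<^sup>2)"
  using coord[of x] by simp

lemma summable_l2_add:
  assumes "summable (\<lambda>n. (cmod (f n))\<^sup>2)" "summable (\<lambda>n. (cmod (g n))\<^sup>2)"
  shows "summable (\<lambda>n. (cmod (f n + g n))\<^sup>2)"
proof (rule summable_comparison_test[OF _ summable_add[OF summable_mult[OF assms(1), of 2] summable_mult[OF assms(2), of 2]]], intro exI allI impI)
  fix n
  have "(cmod (f n + g n))\<^sup>2 \<le> (cmod (f n) + cmod (g n))\<^sup>2" by (intro power_mono norm_triangle_ineq) auto
  also have "\<dots> \<le> 2 * (cmod (f n))\<^sup>2 + 2 * (cmod (g n))\<^sup>2"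
    using zero_le_power2[of "cmod (f n) - cmod (g n)"] by (simp add: power2_eq_square algebra_simps)
  finally show "norm ((cmod (f n + g n))\<^sup>2) \<le> 2 * (cmod (f n))\<^sup>2 + 2 * (cmod (g n))\<^sup>2" by simp
qed

text \<open>Complex scalars sit beside the class structure, which sees a real inner product space
  whose inner product is the real part of \<open>ip2\<close>.\<close>

lift_definition scaleC :: "complex \<Rightarrow> l2 \<Rightarrow> l2" is "\<lambda>c f n. c * f n"
  by (simp add: norm_mult power_mult_distrib summable_mult)

definition ip2 :: "l2 \<Rightarrow> l2 \<Rightarrow> complex" where
  "ip2 x y = (\<Sum>n. coord x n * cnj (coord y n))"

lemma summable_ip2: "summable (\<lambda>n. coord x n * cnj (coord y n))"
proof (rule summable_norm_cancel, rule summable_comparison_test[OF _ summable_add[OF summable_coord[of x] summable_coord[of y]]], intro exI allI impI)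
  fix n
  show "norm (norm (coord x n * cnj (coord y n))) \<le> (cmod (coord x n))\<^sup>2 + (cmod (coord y n))\<^sup>2"
    using sum_squares_bound[of "cmod (coord x n)" "cmod (coord y n)"]
      mult_nonneg_nonneg[OF norm_ge_zero[of "coord x n"] norm_ge_zero[of "coord y n"]]
    unfolding norm_mult real_norm_def complex_mod_cnj abs_mult abs_norm_cancel by linarith
qed

instantiation l2 :: real_inner
begin

lift_definition zero_l2 :: l2 is "\<lambda>_. 0" by simp
lift_definition plus_l2 :: "l2 \<Rightarrow> l2 \<Rightarrow> l2" is "\<lambda>f g n. f n + g n" by (rule summable_l2_add)
lift_definition uminus_l2 :: "l2 \<Rightarrow> l2" is "\<lambda>f n. - f n" by simp
lift_definition minus_l2 :: "l2 \<Rightarrow> l2 \<Rightarrow> l2" is "\<lambda>f g n. f n - g n"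
  using summable_l2_add[of _ "\<lambda>n. - _ n"] by simp
lift_definition scaleR_l2 :: "real \<Rightarrow> l2 \<Rightarrow> l2" is "\<lambda>c f n. of_real c * f n"
  by (simp add: norm_mult power_mult_distrib summable_mult)
definition inner_l2 :: "l2 \<Rightarrow> l2 \<Rightarrow> real" where "inner_l2 x y = Re (ip2 x y)"
definition norm_l2 :: "l2 \<Rightarrow> real" where "norm_l2 x = sqrt (inner x x)"
definition dist_l2 :: "l2 \<Rightarrow> l2 \<Rightarrow> real" where "dist_l2 x y = norm (x - y)"
definition sgn_l2 :: "l2 \<Rightarrow> l2" where "sgn_l2 x = inverse (norm x) *\<^sub>R x"
definition uniformity_l2 :: "(l2 \<times> l2) filter" where
  "uniformity_l2 = (INF e\<in>{0<..}. principal {(x, y). dist x y < e})"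
definition open_l2 :: "l2 set \<Rightarrow> bool" where
  "open_l2 U = (\<forall>x\<in>U. eventually (\<lambda>(x', y). x' = x \<longrightarrow> y \<in> U) uniformity)"

instance
proof
  fix x y z :: l2 and a b :: real
  show "x + y + z = x + (y + z)" "x + y = y + x" "0 + x = x" "- x + x = 0" "x - y = x + - y"
    "a *\<^sub>R (x + y) = a *\<^sub>R x + a *\<^sub>R y" "(a + b) *\<^sub>R x = a *\<^sub>R x + b *\<^sub>R x"
    "a *\<^sub>R b *\<^sub>R x = (a * b) *\<^sub>R x" "1 *\<^sub>R x = x"
    by (transfer; simp add: algebra_simps; fail)+
  show "dist x y = norm (x - y)" "sgn x = inverse (norm x) *\<^sub>R x" "norm x = sqrt (inner x x)"
    by (simp_all add: dist_l2_def sgn_l2_def norm_l2_def)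
  show "uniformity = (INF e\<in>{0<..}. principal {(x :: l2, y). dist x y < e})"
    by (simp add: uniformity_l2_def)
  show "open U = (\<forall>x\<in>U. eventually (\<lambda>(x', y). x' = x \<longrightarrow> y \<in> U) uniformity)" for U :: "l2 set"
    by (simp add: open_l2_def)
  have "ip2 y x = cnj (ip2 x y)"
    unfolding ip2_def using bounded_linear.suminf[OF bounded_linear_cnj summable_ip2[of x y]]
    by (simp add: mult.commute)
  then show "inner x y = inner y x" by (simp add: inner_l2_def)
  have "ip2 (x + y) z = ip2 x z + ip2 y z"
    unfolding ip2_def by (subst suminf_add[OF summable_ip2 summable_ip2]) (simp add: plus_l2.rep_eq algebra_simps)
  then show "inner (x + y) z = inner x z + inner y z" by (simp add: inner_l2_def)
  have "ip2 (a *\<^sub>R x) y = of_real a * ip2 x y"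
    unfolding ip2_def by (subst suminf_mult[OF summable_ip2, symmetric]) (simp add: scaleR_l2.rep_eq algebra_simps)
  then show "inner (a *\<^sub>R x) y = a * inner x y" by (simp add: inner_l2_def)
  have *: "inner x x = (\<Sum>n. (cmod (coord x n))\<^sup>2)"
    unfolding inner_l2_def ip2_def bounded_linear.suminf[OF bounded_linear_Re summable_ip2]
    by (simp only: complex_norm_square[symmetric] Re_complex_of_real)
  show "0 \<le> inner x x" unfolding * by (intro suminf_nonneg summable_coord) auto
  show "(inner x x = 0) = (x = 0)"
    unfolding * using suminf_eq_zero_iff[OF summable_coord[of x]]
    by (auto simp: coord_inject[symmetric] zero_l2.rep_eq fun_eq_iff)
qed

end

lemma norm_l2_sums: "(\<lambda>n. (cmod (coord x n))\<^sup>2) sums (norm x)\<^sup>2"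
proof -
  have "inner x x = (\<Sum>n. (cmod (coord x n))\<^sup>2)"
    unfolding inner_l2_def ip2_def bounded_linear.suminf[OF bounded_linear_Re summable_ip2]
    by (simp only: complex_norm_square[symmetric] Re_complex_of_real)
  then show ?thesis using summable_sums[OF summable_coord[of x]] by (simp add: power2_norm_eq_inner)
qed

lemma coord_norm_le: "cmod (coord x n) \<le> norm x"
proof -
  have "(\<Sum>k\<in>{n}. (cmod (coord x k))\<^sup>2) \<le> (\<Sum>n. (cmod (coord x n))\<^sup>2)"
    by (rule sum_le_suminf[OF summable_coord]) auto
  then have "(cmod (coord x n))\<^sup>2 \<le> (norm x)\<^sup>2" using norm_l2_sums[of x] by (simp add: sums_iff)
  then show ?thesis by (rule power2_le_imp_le) simp
qed

lemmas coord_simps = plus_l2.rep_eq minus_l2.rep_eq uminus_l2.rep_eq zero_l2.rep_eq scaleR_l2.rep_eq scaleC.rep_eq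

lemma l2_eqI: "(\<And>n. coord x n = coord y n) \<Longrightarrow> x = y"
  by (simp add: coord_inject[symmetric] fun_eq_iff)

lemma coord_sum: "coord (sum f A) n = (\<Sum>i\<in>A. coord (f i) n)"
  by (induction A rule: infinite_finite_induct) (auto simp: coord_simps)

text \<open>Bounds on the finite partial sums suit coordinatewise limits, where only finite sums
  pass to the limit directly; they yield membership and norm estimate together.\<close>

lemma norm_l2_le:
  assumes "\<And>K. (\<Sum>k<K. (cmod (f k))\<^sup>2) \<le> e\<^sup>2" "e \<ge> 0"
  shows "summable (\<lambda>n. (cmod (f n))\<^sup>2)" "norm (Abs_l2 f) \<le> e"
proof -
  show s: "summable (\<lambda>n. (cmod (f n))\<^sup>2)"
    by (rule bounded_imp_summable[of _ "e\<^sup>2"])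
       (use assms(1)[of "Suc _"] in \<open>simp_all add: lessThan_Suc_atMost\<close>)
  then have "coord (Abs_l2 f) = f" by (simp add: Abs_l2_inverse)
  then have "(norm (Abs_l2 f))\<^sup>2 = (\<Sum>n. (cmod (f n))\<^sup>2)" using norm_l2_sums[of "Abs_l2 f"] by (simp add: sums_iff)
  also have "\<dots> \<le> e\<^sup>2" by (rule suminf_le_const[OF s assms(1)])
  finally show "norm (Abs_l2 f) \<le> e" using assms(2) by (rule power2_le_imp_le)
qed

instance l2 :: complete_space
proof
  fix Y :: "nat \<Rightarrow> l2" assume C: "Cauchy Y"
  have "Cauchy (\<lambda>m. coord (Y m) k)" for k
  proof (rule metric_CauchyI)
    fix e :: real assume "e > 0"
    then obtain N where N: "\<And>m n. m \<ge> N \<Longrightarrow> n \<ge> N \<Longrightarrow> dist (Y m) (Y n) < e" using C metric_CauchyD by metis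
    have "dist (coord (Y m) k) (coord (Y n) k) < e" if "m \<ge> N" "n \<ge> N" for m n
      using coord_norm_le[of "Y m - Y n" k] N[OF that] by (simp add: dist_norm coord_simps)
    then show "\<exists>M. \<forall>m\<ge>M. \<forall>n\<ge>M. dist (coord (Y m) k) (coord (Y n) k) < e" by blast
  qed
  then have "\<exists>l. (\<lambda>m. coord (Y m) k) \<longlonglongrightarrow> l" for k using Cauchy_convergent convergent_def by blast
  then obtain f where f: "\<And>k. (\<lambda>m. coord (Y m) k) \<longlonglongrightarrow> f k" by metis
  \<comment> \<open>With \<open>K\<close> fixed, let the second index of the Cauchy estimate tend to
    infinity: the finite sum converges and the bound does not depend on \<open>K\<close>.\<close>
  have key: "\<exists>N. \<forall>m\<ge>N. \<forall>K. (\<Sum>k<K. (cmod (coord (Y m) k - f k))\<^sup>2) \<le> e\<^sup>2" if "e > 0" for e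
  proof -
    obtain N where N: "\<And>m n. m \<ge> N \<Longrightarrow> n \<ge> N \<Longrightarrow> dist (Y m) (Y n) < e" using C \<open>e > 0\<close> metric_CauchyD by metis
    have "(\<Sum>k<K. (cmod (coord (Y m) k - f k))\<^sup>2) \<le> e\<^sup>2" if "m \<ge> N" for m K
    proof (rule LIMSEQ_le_const2)
      show "(\<lambda>n. \<Sum>k<K. (cmod (coord (Y m) k - coord (Y n) k))\<^sup>2) \<longlonglongrightarrow> (\<Sum>k<K. (cmod (coord (Y m) k - f k))\<^sup>2)"
        by (intro tendsto_intros f)
      show "\<exists>N. \<forall>n\<ge>N. (\<Sum>k<K. (cmod (coord (Y m) k - coord (Y n) k))\<^sup>2) \<le> e\<^sup>2"
      proof (intro exI allI impI)
        fix n assume "n \<ge> N"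
        have "(\<Sum>k<K. (cmod (coord (Y m - Y n) k))\<^sup>2) \<le> (\<Sum>k. (cmod (coord (Y m - Y n) k))\<^sup>2)"
          by (rule sum_le_suminf[OF summable_coord]) auto
        also have "\<dots> = (norm (Y m - Y n))\<^sup>2" using norm_l2_sums[of "Y m - Y n"] by (simp add: sums_iff)
        also have "\<dots> \<le> e\<^sup>2" using N[OF \<open>m \<ge> N\<close> \<open>n \<ge> N\<close>] by (intro power_mono) (auto simp: dist_norm)
        finally show "(\<Sum>k<K. (cmod (coord (Y m) k - coord (Y n) k))\<^sup>2) \<le> e\<^sup>2" by (simp add: coord_simps)
      qed
    qed
    then show ?thesis by blast
  qed
  \<comment> \<open>The limit is the sum of \<open>Y N\<close> and the difference
    \<open>f - Y N\<close>, both square-summable.\<close>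
  have sf: "summable (\<lambda>n. (cmod (f n))\<^sup>2)"
  proof -
    obtain N where "\<forall>m\<ge>N. \<forall>K. (\<Sum>k<K. (cmod (coord (Y m) k - f k))\<^sup>2) \<le> 1\<^sup>2" using key[of 1] by auto
    then have "summable (\<lambda>n. (cmod (coord (Y N) n - f n))\<^sup>2)" by (intro norm_l2_le(1)[of _ 1]) auto
    then have "summable (\<lambda>n. (cmod (f n - coord (Y N) n))\<^sup>2)" by (simp add: norm_minus_commute)
    from summable_l2_add[OF this summable_coord[of "Y N"]] show ?thesis by simp
  qed
  have cf: "coord (Abs_l2 f) = f" using sf by (simp add: Abs_l2_inverse)
  have "Y \<longlonglongrightarrow> Abs_l2 f"
  proof (rule metric_LIMSEQ_I)
    fix r :: real assume "r > 0"
    then obtain N where N: "\<forall>m\<ge>N. \<forall>K. (\<Sum>k<K. (cmod (coord (Y m) k - f k))\<^sup>2) \<le> (r/2)\<^sup>2" using key[of "r/2"] by auto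
    have "dist (Y m) (Abs_l2 f) < r" if "m \<ge> N" for m
    proof -
      have "norm (Abs_l2 (\<lambda>k. coord (Y m) k - f k)) \<le> r/2"
        using N that \<open>r > 0\<close> by (intro norm_l2_le(2)) auto
      moreover have "Abs_l2 (\<lambda>k. coord (Y m) k - f k) = Y m - Abs_l2 f"
        using N that norm_l2_le(1)[of "\<lambda>k. coord (Y m) k - f k" "r/2"] \<open>r > 0\<close>
        by (intro l2_eqI) (simp add: Abs_l2_inverse coord_simps cf)
      ultimately show ?thesis using \<open>r > 0\<close> by (simp add: dist_norm)
    qed
    then show "\<exists>no. \<forall>n\<ge>no. dist (Y n) (Abs_l2 f) < r" by blast
  qed
  then show "convergent Y" by (auto simp: convergent_def)
qed

lemma ip2_sums: "(\<lambda>n. coord x n * cnj (coord y n)) sums ip2 x y"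
  unfolding ip2_def by (rule summable_sums[OF summable_ip2])

lemma ip2_cnj: "ip2 y x = cnj (ip2 x y)"
  unfolding ip2_def using bounded_linear.suminf[OF bounded_linear_cnj summable_ip2[of x y]]
  by (simp add: mult.commute)

lemma ip2_add_left: "ip2 (x + y) z = ip2 x z + ip2 y z"
  unfolding ip2_def by (subst suminf_add[OF summable_ip2 summable_ip2]) (simp add: plus_l2.rep_eq algebra_simps)

lemma ip2_scaleC_left: "ip2 (scaleC c x) y = c * ip2 x y"
  unfolding ip2_def by (subst suminf_mult[OF summable_ip2, symmetric]) (simp add: scaleC.rep_eq algebra_simps)

lemma scaleR_scaleC: "r *\<^sub>R x = scaleC (of_real r) x"
  by transfer simp

lemma ip2_add_right: "ip2 z (x + y) = ip2 z x + ip2 z y"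
  using ip2_add_left[of x y z] by (metis complex_cnj_add ip2_cnj)

lemma ip2_scaleC_right: "ip2 x (scaleC c y) = cnj c * ip2 x y"
  using ip2_scaleC_left[of c y x] by (metis complex_cnj_mult ip2_cnj)

lemma ip2_self: "ip2 x x = of_real ((norm x)\<^sup>2)"
proof -
  have "Im (ip2 x x) = 0" using ip2_cnj[of x x] by (metis cnj.simps(2) equal_neg_zero)
  then show ?thesis by (simp add: complex_eq_iff power2_norm_eq_inner inner_l2_def)
qed

lemma norm_scaleC: "norm (scaleC c x) = cmod c * norm x"
proof -
  have "of_real ((norm (scaleC c x))\<^sup>2) = (of_real ((cmod c * norm x)\<^sup>2) :: complex)"
    unfolding ip2_self[symmetric] ip2_scaleC_left ip2_scaleC_right
    using complex_norm_square[of c] by (simp add: ip2_self power_mult_distrib mult.assoc[symmetric])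
  then have "(norm (scaleC c x))\<^sup>2 = (cmod c * norm x)\<^sup>2" by (simp only: of_real_eq_iff)
  then show ?thesis by (simp add: power2_eq_iff_nonneg)
qed

lemma norm_ip2_le: "cmod (ip2 x y) \<le> norm x * norm y"
proof (cases "ip2 x y = 0")
  case False
  \<comment> \<open>A phase of modulus one that makes the complex inner product real and
    nonnegative, so that the real Cauchy-Schwarz inequality applies.\<close>
  define c where "c = cnj (sgn (ip2 x y))"
  have c: "cmod c = 1" using False by (simp add: c_def norm_sgn)
  have "c * ip2 x y = of_real (cmod (ip2 x y))"
    unfolding c_def using False
    by (simp add: sgn_eq field_simps complex_norm_square[symmetric] power2_eq_square)
  then have "cmod (ip2 x y) = inner (scaleC c x) y" by (simp add: inner_l2_def ip2_scaleC_left)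
  also have "\<dots> \<le> norm (scaleC c x) * norm y" by (rule norm_cauchy_schwarz)
  finally show ?thesis by (simp add: norm_scaleC c)
qed simp

lemma bounded_bilinear_ip2: "bounded_bilinear ip2"
proof
  show "\<exists>K. \<forall>a b. norm (ip2 a b) \<le> norm a * norm b * K"
    by (rule exI[of _ 1]) (simp add: norm_ip2_le)
qed (simp_all add: ip2_add_left ip2_add_right scaleR_scaleC ip2_scaleC_left ip2_scaleC_right scaleR_conv_of_real)

interpretation ip2: bounded_bilinear ip2 by (rule bounded_bilinear_ip2)

lemma bounded_bilinear_scaleC: "bounded_bilinear scaleC"
proof
  show "\<exists>K. \<forall>a b. norm (scaleC a b) \<le> norm a * norm b * K"
    by (rule exI[of _ 1]) (simp add: norm_scaleC)
qed (intro l2_eqI; simp add: coord_simps algebra_simps scaleR_conv_of_real)+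

interpretation scaleC: bounded_bilinear scaleC by (rule bounded_bilinear_scaleC)

lemma scaleC_1 [simp]: "scaleC 1 x = x" by transfer simp
lemma scaleC_scaleC [simp]: "scaleC a (scaleC b x) = scaleC (a * b) x" by transfer (simp add: mult.assoc)

section \<open>Complex subspaces, orthogonal projections and Riesz representation\<close>

definition csubspace :: "l2 set \<Rightarrow> bool" where
  "csubspace M \<longleftrightarrow> 0 \<in> M \<and> (\<forall>x\<in>M. \<forall>y\<in>M. x + y \<in> M) \<and> (\<forall>c. \<forall>x\<in>M. scaleC c x \<in> M)"

lemma csubspace_imp_subspace: "csubspace M \<Longrightarrow> subspace M"
  by (auto simp: csubspace_def subspace_def scaleR_scaleC)

lemma csubspace_add: "csubspace M \<Longrightarrow> x \<in> M \<Longrightarrow> y \<in> M \<Longrightarrow> x + y \<in> M"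
  and csubspace_scaleC: "csubspace M \<Longrightarrow> x \<in> M \<Longrightarrow> scaleC c x \<in> M"
  by (auto simp: csubspace_def)

lemma csubspace_diff: "csubspace M \<Longrightarrow> x \<in> M \<Longrightarrow> y \<in> M \<Longrightarrow> x - y \<in> M"
  using subspace_diff csubspace_imp_subspace by blast

context
  fixes M :: "l2 set" assumes M: "closed M" "csubspace M"
begin

lemma proj_in: "proj M x \<in> M"
  and proj_inner: "m \<in> M \<Longrightarrow> inner (x - proj M x) m = 0"
proof -
  have "\<exists>p. p \<in> M \<and> (\<forall>m\<in>M. inner (x - p) m = 0)"
    using projection_exists[OF M(1) csubspace_imp_subspace[OF M(2)]] by blast
  from someI_ex[OF this] show "proj M x \<in> M" "m \<in> M \<Longrightarrow> inner (x - proj M x) m = 0"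
    by (auto simp: proj_def)
qed

text \<open>The choice of \<open>proj\<close> controls only the real part; testing against
  \<open>\<i>\<close> times \<open>m\<close>, which is again in \<open>M\<close>, controls the
  imaginary part.\<close>

lemma ip2_proj_orth: "m \<in> M \<Longrightarrow> ip2 (x - proj M x) m = 0"
proof -
  assume m: "m \<in> M"
  have "Im (ip2 (x - proj M x) m) = Re (ip2 (x - proj M x) (scaleC \<i> m))"
    by (simp add: ip2_scaleC_right)
  also have "\<dots> = 0" using proj_inner[OF csubspace_scaleC[OF M(2) m], of x \<i>] by (simp add: inner_l2_def)
  finally show ?thesis using proj_inner[OF m, of x] by (simp add: inner_l2_def complex_eq_iff)
qed

lemma proj_unique:
  assumes "p \<in> M" "\<And>m. m \<in> M \<Longrightarrow> ip2 (x - p) m = 0"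
  shows "proj M x = p"
proof -
  have d: "proj M x - p \<in> M" using csubspace_diff[OF M(2) proj_in assms(1)] .
  have "ip2 (proj M x - p) (proj M x - p) = ip2 (x - p) (proj M x - p) - ip2 (x - proj M x) (proj M x - p)"
    by (simp add: ip2.diff_left)
  also have "\<dots> = 0" using assms(2)[OF d] ip2_proj_orth[OF d] by simp
  finally show ?thesis by (simp add: ip2_self)
qed

lemma proj_id: "x \<in> M \<Longrightarrow> proj M x = x"
  by (rule proj_unique) (auto simp: ip2.zero_left)

lemma proj_add: "proj M (x + y) = proj M x + proj M y"
proof (rule proj_unique)
  show "proj M x + proj M y \<in> M" by (intro csubspace_add[OF M(2)] proj_in)
  fix m assume m: "m \<in> M"
  have "ip2 (x + y - (proj M x + proj M y)) m = ip2 (x - proj M x) m + ip2 (y - proj M y) m"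
    by (simp add: ip2.diff_left ip2.add_left)
  then show "ip2 (x + y - (proj M x + proj M y)) m = 0" using m by (simp add: ip2_proj_orth)
qed

lemma proj_scaleC: "proj M (scaleC c x) = scaleC c (proj M x)"
proof (rule proj_unique)
  show "scaleC c (proj M x) \<in> M" by (intro csubspace_scaleC[OF M(2)] proj_in)
  fix m assume m: "m \<in> M"
  have "ip2 (scaleC c x - scaleC c (proj M x)) m = c * ip2 (x - proj M x) m"
    by (simp add: ip2.diff_left ip2_scaleC_left algebra_simps)
  then show "ip2 (scaleC c x - scaleC c (proj M x)) m = 0" using m by (simp add: ip2_proj_orth)
qed

lemma ip2_proj: "m \<in> M \<Longrightarrow> ip2 (proj M x) m = ip2 x m"
  using ip2_proj_orth[of m x] by (simp add: ip2.diff_left)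

lemma ip2_proj_right: "m \<in> M \<Longrightarrow> ip2 m (proj M x) = ip2 m x"
  using ip2_proj[of m x] by (metis ip2_cnj)

text \<open>Converts near-minimality of the distance into closeness to the projection, as needed in
  \<open>rho_near_minimizer\<close>.\<close>

lemma norm_proj_pythagoras: "m \<in> M \<Longrightarrow> (norm (x - m))\<^sup>2 = (norm (x - proj M x))\<^sup>2 + (norm (proj M x - m))\<^sup>2"
proof -
  assume m: "m \<in> M"
  then have "inner (x - proj M x) (proj M x - m) = 0" by (intro proj_inner csubspace_diff[OF M(2)] proj_in)
  then show ?thesis by (simp add: power2_norm_eq_inner algebra_simps inner_commute)
qed

end

lemma riesz_csubspace:
  fixes f :: "l2 \<Rightarrow> complex"
  assumes M: "closed M" "csubspace M"
    and add: "\<And>x y. x \<in> M \<Longrightarrow> y \<in> M \<Longrightarrow> f (x + y) = f x + f y"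
    and scale: "\<And>c x. x \<in> M \<Longrightarrow> f (scaleC c x) = c * f x"
    and bound: "\<And>x. x \<in> M \<Longrightarrow> cmod (f x) \<le> C * norm x"
  shows "\<exists>y\<in>M. \<forall>x\<in>M. f x = ip2 x y"
proof (cases "\<forall>x\<in>M. f x = 0")
  case True
  then show ?thesis using M(2) by (intro bexI[of _ 0]) (auto simp: csubspace_def ip2.zero_right)
next
  case False
  then obtain x0 where x0: "x0 \<in> M" "f x0 \<noteq> 0" by blast
  define N where "N = {x\<in>M. f x = 0}"
  have minus: "f (x - y) = f x - f y" if "x \<in> M" "y \<in> M" for x y
    using add[of x "scaleC (-1) y"] scale[of y "-1"] csubspace_scaleC[OF M(2) that(2), of "-1"] that
    by (simp add: scaleC.minus_left)
  have f0: "f 0 = 0" using minus[OF x0(1) x0(1)] by simp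
  have "csubspace N" using M(2) add scale unfolding csubspace_def N_def
    by (auto simp: f0)
  moreover have "closed N"
    unfolding closed_sequential_limits
  proof (intro allI impI, elim conjE)
    fix Y l assume Y: "\<forall>n. Y n \<in> N" "Y \<longlonglongrightarrow> l"
    then have lM: "l \<in> M" using M(1) closed_sequentially[of M Y l] by (auto simp: N_def)
    have "cmod (f l) \<le> C * norm (l - Y n)" for n
      using bound[of "l - Y n"] minus[of l "Y n"] Y(1) lM csubspace_diff[OF M(2)] by (auto simp: N_def)
    moreover have "(\<lambda>n. C * norm (l - Y n)) \<longlonglongrightarrow> C * norm (l - l)" by (intro tendsto_intros Y)
    ultimately have "cmod (f l) \<le> C * norm (l - l)" by (intro LIMSEQ_le_const) auto
    then show "l \<in> N" using lM by (simp add: N_def)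
  qed
  ultimately have N: "closed N" "csubspace N" by auto
  \<comment> \<open>The component of \<open>x0\<close> orthogonal to the kernel \<open>N\<close>.
    Every \<open>x\<close> in \<open>M\<close> differs from the multiple \<open>f x / f z\<close> of
    \<open>z\<close> by an element of \<open>N\<close>.\<close>
  define z where "z = x0 - proj N x0"
  have pN: "proj N x0 \<in> N" using proj_in[OF N] .
  have zM: "z \<in> M" using x0 pN csubspace_diff[OF M(2)] by (auto simp: z_def N_def)
  have fz: "f z = f x0" using pN minus[of x0 "proj N x0"] x0 by (auto simp: z_def N_def)
  have z0: "z \<noteq> 0" using fz x0 f0 by auto
  \<comment> \<open>The conjugate compensates for conjugate-linearity of \<open>ip2\<close> in its
    second argument.\<close>
  define y where "y = scaleC (cnj (f z) / of_real ((norm z)\<^sup>2)) z"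
  have "f x = ip2 x y" if x: "x \<in> M" for x
  proof -
    have cM: "scaleC (f x / f z) z \<in> M" by (intro csubspace_scaleC[OF M(2)] zM)
    have "x - scaleC (f x / f z) z \<in> N"
      using x cM csubspace_diff[OF M(2)] minus[OF x cM] scale[OF zM] fz x0 by (simp add: N_def)
    then have "ip2 (x - scaleC (f x / f z) z) z = 0"
      unfolding z_def using ip2_proj_orth[OF N] by (metis complex_cnj_zero ip2_cnj)
    then have "ip2 x z = f x / f z * of_real ((norm z)\<^sup>2)" by (simp add: ip2.diff_left ip2_scaleC_left ip2_self)
    then show ?thesis using z0 fz x0 by (simp add: y_def ip2_scaleC_right)
  qed
  moreover have "y \<in> M" unfolding y_def by (intro csubspace_scaleC[OF M(2)] zM)
  ultimately show ?thesis by blast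
qed

section \<open>Coordinate vectors, truncation and separability\<close>

definition unit_l2 :: "nat \<Rightarrow> l2" where
  "unit_l2 i = Abs_l2 (\<lambda>k. if k = i then 1 else 0)"

lemma coord_finite_support:
  assumes "finite A" "\<And>k. k \<notin> A \<Longrightarrow> f k = 0"
  shows "coord (Abs_l2 f) = f"
proof -
  have "summable (\<lambda>n. (cmod (f n))\<^sup>2)" by (rule summable_finite[OF assms(1)]) (simp add: assms(2))
  then show ?thesis by (simp add: Abs_l2_inverse)
qed

lemma coord_unit_l2: "coord (unit_l2 i) k = (if k = i then 1 else 0)"
  unfolding unit_l2_def by (subst coord_finite_support[of "{i}"]) auto

lemma ip2_unit_right: "ip2 x (unit_l2 i) = coord x i"
proof -
  have "(\<lambda>n. coord x n * cnj (coord (unit_l2 i) n)) sums coord x i"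
    using sums_single[of i "\<lambda>n. coord x n"] by (rule sums_cong[THEN iffD1, rotated]) (simp add: coord_unit_l2)
  then show ?thesis using ip2_sums sums_unique2 by blast
qed

lemma norm_unit_l2: "norm (unit_l2 i) = 1"
proof -
  have "complex_of_real ((norm (unit_l2 i))\<^sup>2) = of_real 1"
    using ip2_self[of "unit_l2 i"] unfolding ip2_unit_right by (simp add: coord_unit_l2)
  then have "(norm (unit_l2 i))\<^sup>2 = 1\<^sup>2" by (simp only: of_real_eq_iff one_power2)
  then show ?thesis by (simp only: power2_eq_iff_nonneg norm_ge_zero zero_le_one)
qed

definition trunc_l2 :: "nat \<Rightarrow> l2 \<Rightarrow> l2" where
  "trunc_l2 n x = (\<Sum>i<n. scaleC (coord x i) (unit_l2 i))"

lemma coord_trunc_l2: "coord (trunc_l2 n x) k = (if k < n then coord x k else 0)"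
  by (auto simp: trunc_l2_def coord_sum coord_simps coord_unit_l2 if_distrib sum.delta cong: if_cong)

lemma trunc_l2_tendsto: "(\<lambda>n. trunc_l2 n x) \<longlonglongrightarrow> x"
proof -
  have *: "(norm (trunc_l2 n x - x))\<^sup>2 = (norm x)\<^sup>2 - (\<Sum>k<n. (cmod (coord x k))\<^sup>2)" for n
  proof -
    have "(\<lambda>k. (cmod (coord x k))\<^sup>2 - (if k \<in> {..<n} then (cmod (coord x k))\<^sup>2 else 0)) sums
        ((norm x)\<^sup>2 - (\<Sum>k<n. (cmod (coord x k))\<^sup>2))"
      by (intro sums_diff norm_l2_sums sums_If_finite_set) simp
    moreover have "(\<lambda>k. (cmod (coord x k))\<^sup>2 - (if k \<in> {..<n} then (cmod (coord x k))\<^sup>2 else 0))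
        = (\<lambda>k. (cmod (coord (trunc_l2 n x - x) k))\<^sup>2)"
      by (auto simp: fun_eq_iff coord_simps coord_trunc_l2)
    ultimately show ?thesis using sums_unique2[OF norm_l2_sums[of "trunc_l2 n x - x"]] by simp
  qed
  have "(\<lambda>n. (norm x)\<^sup>2 - (\<Sum>k<n. (cmod (coord x k))\<^sup>2)) \<longlonglongrightarrow> (norm x)\<^sup>2 - (norm x)\<^sup>2"
    using norm_l2_sums[of x] unfolding sums_def by (intro tendsto_intros)
  then have "(\<lambda>n. (norm (trunc_l2 n x - x))\<^sup>2) \<longlonglongrightarrow> 0" by (simp add: *)
  then have "(\<lambda>n. sqrt ((norm (trunc_l2 n x - x))\<^sup>2)) \<longlonglongrightarrow> sqrt 0" by (rule tendsto_real_sqrt)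
  then have "(\<lambda>n. norm (trunc_l2 n x - x)) \<longlonglongrightarrow> 0" by simp
  then show ?thesis using tendsto_norm_zero_iff LIM_zero_iff by blast
qed

lemma l2_separable: "\<exists>D :: l2 set. countable D \<and> closure D = UNIV"
proof -
  obtain Q :: "complex set" where Q: "countable Q" "\<And>U. open U \<Longrightarrow> U \<noteq> {} \<Longrightarrow> \<exists>q\<in>Q. q \<in> U"
    using countable_dense_setE by blast
  define vec where "vec cs = (\<Sum>i<length cs. scaleC (cs ! i) (unit_l2 i))" for cs
  have "x \<in> closure (vec ` lists Q)" for x
  proof -
    \<comment> \<open>Each of the \<open>n\<close> retained coordinates may err by the inverse
      square of \<open>Suc n\<close>, so that the total error stays below
      \<open>1 / Suc n\<close>.\<close>
    have "\<exists>q\<in>Q. cmod (q - coord x i) < 1 / real (Suc n) / real (Suc n)" for n i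
    proof -
      have "0 < 1 / real (Suc n) / real (Suc n)" by simp
      then obtain p where "p \<in> Q" "p \<in> ball (coord x i) (1 / real (Suc n) / real (Suc n))"
        using Q(2)[of "ball (coord x i) (1 / real (Suc n) / real (Suc n))"] by (metis centre_in_ball emptyE open_ball)
      then show ?thesis by (auto simp: dist_norm norm_minus_commute simp del: of_nat_Suc)
    qed
    note ex = this
    define q where "q n i = (SOME q. q \<in> Q \<and> cmod (q - coord x i) < 1 / real (Suc n) / real (Suc n))" for n i
    have "q n i \<in> Q \<and> cmod (q n i - coord x i) < 1 / real (Suc n) / real (Suc n)" for n i
      unfolding q_def by (rule someI_ex) (use ex[where n=n and i=i] in \<open>simp only: Bex_def\<close>)
    then have q: "\<And>n i. q n i \<in> Q" "\<And>n i. cmod (q n i - coord x i) < 1 / real (Suc n) / real (Suc n)" by simp_all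
    define y where "y n = vec (map (q n) [0..<n])" for n
    have "norm (y n - trunc_l2 n x) \<le> 1 / real (Suc n)" for n
    proof -
      have "y n - trunc_l2 n x = (\<Sum>i<n. scaleC (q n i - coord x i) (unit_l2 i))"
        by (simp add: y_def vec_def trunc_l2_def scaleC.diff_left sum_subtractf)
      then have "norm (y n - trunc_l2 n x) \<le> (\<Sum>i<n. norm (scaleC (q n i - coord x i) (unit_l2 i)))"
        using norm_sum by simp
      also have "\<dots> \<le> (\<Sum>i<n. 1 / real (Suc n) / real (Suc n))"
        by (intro sum_mono) (use q(2) in \<open>simp add: norm_scaleC norm_unit_l2 less_imp_le\<close>)
      also have "\<dots> \<le> 1 / real (Suc n)" by (simp add: divide_simps)
      finally show ?thesis .
    qed
    then have "(\<lambda>n. y n - trunc_l2 n x) \<longlonglongrightarrow> 0"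
      by (intro Lim_null_comparison[OF _ LIMSEQ_Suc[OF lim_1_over_n]]) auto
    from tendsto_add[OF this trunc_l2_tendsto[of x]] have "y \<longlonglongrightarrow> x" by simp
    moreover have "y n \<in> vec ` lists Q" for n unfolding y_def by (rule imageI) (auto simp: q(1))
    ultimately show ?thesis unfolding closure_sequential by blast
  qed
  then show ?thesis using Q(1) by (intro exI[of _ "vec ` lists Q"]) auto
qed

section \<open>Isometries of l2 that spread out the coordinates\<close>

text \<open>Two such maps with disjoint ranges of indices have orthogonal images; even and odd
  indices thus realise a direct sum of two copies of l2 inside l2. Strict monotonicity of
  \<open>e\<close> is what the reindexing of series asks for.\<close>

definition emb :: "(nat \<Rightarrow> nat) \<Rightarrow> l2 \<Rightarrow> l2" where
  "emb e x = Abs_l2 (\<lambda>i. if i \<in> range e then coord x (inv_into UNIV e i) else 0)"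

lemma coord_emb:
  assumes "strict_mono e"
  shows "coord (emb e x) i = (if i \<in> range e then coord x (inv_into UNIV e i) else 0)"
proof -
  let ?f = "\<lambda>i. (cmod (if i \<in> range e then coord x (inv_into UNIV e i) else 0))\<^sup>2"
  have "inj e" using assms strict_mono_imp_inj_on by blast
  then have "(\<lambda>n. ?f (e n)) = (\<lambda>n. (cmod (coord x n))\<^sup>2)" by auto
  then have "summable (\<lambda>n. ?f (e n))" using summable_coord[of x] by simp
  then have "summable ?f" by (rule summable_mono_reindex[OF assms, THEN iffD1, rotated]) auto
  then show ?thesis by (simp add: emb_def Abs_l2_inverse)
qed

lemma ip2_emb:
  assumes "strict_mono e"
  shows "ip2 (emb e x) (emb e y) = ip2 x y"
proof -
  have "inj e" using assms strict_mono_imp_inj_on by blast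
  then have "(\<lambda>n. coord (emb e x) (e n) * cnj (coord (emb e y) (e n))) sums ip2 x y"
    using ip2_sums[of x y] by (simp add: coord_emb[OF assms])
  then have "(\<lambda>n. coord (emb e x) n * cnj (coord (emb e y) n)) sums ip2 x y"
    by (rule sums_mono_reindex[OF assms, THEN iffD1, rotated]) (simp add: coord_emb[OF assms])
  then show ?thesis using ip2_sums sums_unique2 by blast
qed

lemma ip2_emb_disjoint:
  assumes "strict_mono e" "strict_mono f" "range e \<inter> range f = {}"
  shows "ip2 (emb e x) (emb f y) = 0"
proof -
  have "(\<lambda>n. coord (emb e x) n * cnj (coord (emb f y) n)) = (\<lambda>n. 0)"
    using assms(3) by (auto simp: fun_eq_iff coord_emb[OF assms(1)] coord_emb[OF assms(2)])
  then show ?thesis unfolding ip2_def by (simp only: suminf_zero)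
qed

lemma emb_add: "strict_mono e \<Longrightarrow> emb e (x + y) = emb e x + emb e y"
  and emb_scaleC: "strict_mono e \<Longrightarrow> emb e (scaleC c x) = scaleC c (emb e x)"
  and emb_zero: "strict_mono e \<Longrightarrow> emb e 0 = 0"
  by (intro l2_eqI; simp add: coord_emb coord_simps)+

section \<open>Cholesky decomposition of positive semidefinite kernels\<close>

text \<open>With the conjugate placed this way, the double sum is the squared norm of the
  combination with coefficients \<open>c\<close> when \<open>G n m\<close> is the inner product of
  vectors \<open>n\<close> and \<open>m\<close>. Hermitian symmetry makes it real, so testing the
  real part loses nothing.\<close>

definition psd_kernel :: "(nat \<Rightarrow> nat \<Rightarrow> complex) \<Rightarrow> bool" where
  "psd_kernel G \<longleftrightarrow> (\<forall>n m. G m n = cnj (G n m)) \<and>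
     (\<forall>N c. 0 \<le> Re (\<Sum>n<N. \<Sum>m<N. c n * cnj (c m) * G n m))"

lemma psd_herm: "psd_kernel G \<Longrightarrow> G m n = cnj (G n m)"
  unfolding psd_kernel_def by blast

text \<open>General finite index sets serve the two-point test in \<open>psd_zero_diag\<close> and
  the addition of the pivot index in \<open>psd_schur\<close>; coefficients extended by zero reduce
  them to initial segments.\<close>

lemma psd_finite:
  assumes "psd_kernel G" "finite A"
  shows "0 \<le> Re (\<Sum>n\<in>A. \<Sum>m\<in>A. c n * cnj (c m) * G n m)"
proof -
  obtain N where N: "A \<subseteq> {..<N}" using assms(2) finite_nat_iff_bounded by blast
  define c' where "c' n = (if n \<in> A then c n else 0)" for n
  have "(\<Sum>n\<in>A. \<Sum>m\<in>A. c n * cnj (c m) * G n m) = (\<Sum>n<N. \<Sum>m\<in>A. c' n * cnj (c' m) * G n m)"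
    using N assms(2) by (intro sum.mono_neutral_cong_left) (auto simp: c'_def)
  also have "\<dots> = (\<Sum>n<N. \<Sum>m<N. c' n * cnj (c' m) * G n m)"
    using N assms(2) by (intro sum.cong refl sum.mono_neutral_cong_left) (auto simp: c'_def)
  finally have *: "(\<Sum>n\<in>A. \<Sum>m\<in>A. c n * cnj (c m) * G n m) = (\<Sum>n<N. \<Sum>m<N. c' n * cnj (c' m) * G n m)" .
  show ?thesis unfolding * using assms(1) unfolding psd_kernel_def by blast
qed

lemma psd_diag:
  assumes "psd_kernel G"
  shows "G n n = of_real (Re (G n n))" "0 \<le> Re (G n n)"
proof -
  have "G n n = cnj (G n n)" using psd_herm[OF assms] .
  then show "G n n = of_real (Re (G n n))" by (simp add: complex_eq_iff)
  show "0 \<le> Re (G n n)" using psd_finite[OF assms, of "{n}" "\<lambda>_. 1"] by simp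
qed

text \<open>Testing on \<open>n\<close> with coefficient one and on \<open>k\<close> with
  coefficient minus \<open>s\<close> times \<open>G n k\<close> gives an affine function of
  \<open>s\<close> that is never negative, so its slope vanishes.\<close>

lemma psd_zero_diag:
  assumes "psd_kernel G" "G k k = 0"
  shows "G n k = 0"
proof (cases "n = k")
  case False
  have h: "G k n = cnj (G n k)" using psd_herm[OF assms(1)] .
  have "0 \<le> Re (G n n) - 2 * s * (cmod (G n k))\<^sup>2" for s :: real
  proof -
    have "0 \<le> Re (\<Sum>i\<in>{n,k}. \<Sum>j\<in>{n,k}. (if i = n then 1 else - of_real s * G n k)
        * cnj (if j = n then 1 else - of_real s * G n k) * G i j)"
      using psd_finite[OF assms(1), of "{n,k}" "\<lambda>i. if i = n then 1 else - of_real s * G n k"] by simp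
    also have "\<dots> = Re (G n n) - 2 * s * (cmod (G n k))\<^sup>2"
      unfolding cmod_power2 using False by (simp add: assms(2) h power2_eq_square algebra_simps)
    finally show ?thesis .
  qed
  \<comment> \<open>At this \<open>s\<close> the affine function would take the value minus one if
    \<open>G n k\<close> were nonzero.\<close>
  from this[of "(Re (G n n) + 1) / (2 * (cmod (G n k))\<^sup>2)"] show ?thesis
    by (cases "G n k = 0") auto
qed (use assms in simp)

text \<open>The Schur complement, that is the Gram kernel left after projecting out vector
  \<open>k\<close>. A zero pivot leaves \<open>G\<close> unchanged because division by zero is zero,
  which is right since row \<open>k\<close> then vanishes.\<close>

definition schur :: "nat \<Rightarrow> (nat \<Rightarrow> nat \<Rightarrow> complex) \<Rightarrow> nat \<Rightarrow> nat \<Rightarrow> complex" where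
  "schur k G n m = G n m - G n k * G k m / G k k"

text \<open>The Schur form is the minimum of the form of \<open>G\<close> over the coefficient at
  the pivot, hence again nonnegative.\<close>

lemma psd_schur:
  assumes G: "psd_kernel G"
  shows "psd_kernel (schur k G)"
proof (cases "G k k = 0")
  case True
  then have "schur k G = G" by (simp add: schur_def fun_eq_iff)
  then show ?thesis using G by simp
next
  case False
  define g where "g = Re (G k k)"
  have gk: "G k k = of_real g" using psd_diag(1)[OF G] by (simp add: g_def)
  have g0: "g \<noteq> 0" using False gk by auto
  note h = psd_herm[OF G]
  have "schur k G m n = cnj (schur k G n m)" for n m
    using h[of m n] h[of m k] h[of k n] by (simp add: schur_def gk mult.commute)
  moreover have "0 \<le> Re (\<Sum>n<N. \<Sum>m<N. c n * cnj (c m) * schur k G n m)" for N c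
  proof -
    \<comment> \<open>The pivot may lie outside the initial segment, so it is added;
      \<open>d\<close> extends \<open>c\<close> by zero and \<open>e\<close> alters only the pivot
      coefficient.\<close>
    define A where "A = insert k {..<N}"
    have A: "finite A" "k \<in> A" by (auto simp: A_def)
    define d where "d n = (if n < N then c n else 0)" for n
    define b where "b = (\<Sum>n\<in>A. d n * G n k)"
    have b': "cnj b = (\<Sum>m\<in>A. cnj (d m) * G k m)"
      unfolding b_def using h[of k] by simp
    \<comment> \<open>Completing the square: this shift of the pivot coefficient attains the
      minimum, and its cost is exactly the term subtracted in \<open>schur\<close>.\<close>
    define a where "a = - b / g"
    define e where "e n = (if n = k then a else 0)" for n
    have eA: "(\<Sum>n\<in>A. e n * f n) = a * f k" "(\<Sum>n\<in>A. cnj (e n) * f n) = cnj a * f k" for f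
      using A by (simp_all add: e_def if_distrib[of cnj] if_distrib[of "\<lambda>x. x * _"] cong: if_cong)
    have "(\<Sum>n\<in>A. \<Sum>m\<in>A. (d n + e n) * cnj (d m + e m) * G n m)
        = (\<Sum>n\<in>A. \<Sum>m\<in>A. d n * cnj (d m) * G n m) + (\<Sum>n\<in>A. d n * (\<Sum>m\<in>A. cnj (e m) * G n m))
          + (\<Sum>n\<in>A. e n * (\<Sum>m\<in>A. cnj (d m) * G n m)) + (\<Sum>n\<in>A. e n * (\<Sum>m\<in>A. cnj (e m) * G n m))"
      by (simp add: algebra_simps sum.distrib sum_distrib_left)
    also have "\<dots> = (\<Sum>n\<in>A. \<Sum>m\<in>A. d n * cnj (d m) * G n m) + cnj a * b + a * cnj b + a * cnj a * g"
      unfolding eA b' unfolding b_def by (simp add: gk sum_distrib_left algebra_simps)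
    also have "\<dots> = (\<Sum>n\<in>A. \<Sum>m\<in>A. d n * cnj (d m) * G n m) - b * cnj b / g"
      using g0 by (simp add: a_def field_simps)
    also have "b * cnj b / g = (\<Sum>n\<in>A. \<Sum>m\<in>A. d n * cnj (d m) * (G n k * G k m / G k k))"
      unfolding b' unfolding b_def sum_product sum_divide_distrib gk by (simp add: algebra_simps)
    finally have "(\<Sum>n\<in>A. \<Sum>m\<in>A. (d n + e n) * cnj (d m + e m) * G n m)
        = (\<Sum>n\<in>A. \<Sum>m\<in>A. d n * cnj (d m) * schur k G n m)"
      by (simp add: schur_def sum_subtractf[symmetric] algebra_simps)
    also have "\<dots> = (\<Sum>n\<in>A. \<Sum>m<N. d n * cnj (d m) * schur k G n m)"
      by (intro sum.cong refl sum.mono_neutral_right A) (auto simp: A_def d_def)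
    also have "\<dots> = (\<Sum>n<N. \<Sum>m<N. d n * cnj (d m) * schur k G n m)"
      by (intro sum.mono_neutral_right A) (auto simp: A_def d_def)
    also have "\<dots> = (\<Sum>n<N. \<Sum>m<N. c n * cnj (c m) * schur k G n m)" by (simp add: d_def)
    finally show ?thesis using psd_finite[OF G A(1), of "\<lambda>n. d n + e n"] by simp
  qed
  ultimately show ?thesis unfolding psd_kernel_def by blast
qed

primrec schur_iter :: "(nat \<Rightarrow> nat \<Rightarrow> complex) \<Rightarrow> nat \<Rightarrow> nat \<Rightarrow> nat \<Rightarrow> complex" where
  "schur_iter G 0 = G"
| "schur_iter G (Suc k) = schur k (schur_iter G k)"

text \<open>Column \<open>k\<close> is the pivot column of the \<open>k\<close>-th Schur complement,
  divided by the root of the pivot. Zero pivots give zero columns, so no pivoting or rank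
  distinction intervenes and the factor stays lower triangular.\<close>

definition chol :: "(nat \<Rightarrow> nat \<Rightarrow> complex) \<Rightarrow> nat \<Rightarrow> nat \<Rightarrow> complex" where
  "chol G n k = schur_iter G k n k / of_real (sqrt (Re (schur_iter G k k k)))"

context
  fixes G assumes G: "psd_kernel G"
begin

lemma psd_schur_iter: "psd_kernel (schur_iter G k)"
  by (induction k) (auto simp: G psd_schur)

text \<open>Elimination at \<open>k\<close> clears row \<open>k\<close>: by cancellation if the
  pivot is nonzero, by \<open>psd_zero_diag\<close> otherwise. Later eliminations keep zero rows
  zero.\<close>

lemma schur_iter_zero: "n < k \<Longrightarrow> schur_iter G k n m = 0"
proof (induction k arbitrary: n m)
  case (Suc k)
  let ?S = "schur_iter G k"
  show ?case
  proof (cases "n = k")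
    case True
    show ?thesis
    proof (cases "?S k k = 0")
      case z: True
      have "?S k m = 0" using psd_zero_diag[OF psd_schur_iter z, of m] psd_herm[OF psd_schur_iter, of k k m] by simp
      then show ?thesis using True by (simp add: schur_def)
    qed (simp add: True schur_def)
  qed (use Suc in \<open>simp add: schur_def\<close>)
qed simp

lemma chol_zero: "n < k \<Longrightarrow> chol G n k = 0"
  by (simp add: chol_def schur_iter_zero)

text \<open>One elimination removes a rank-one kernel. The identity survives a zero pivot, where
  both quotients are zero.\<close>

lemma chol_step: "schur_iter G k n m = chol G n k * cnj (chol G m k) + schur_iter G (Suc k) n m"
proof -
  let ?S = "schur_iter G k"
  have d: "?S k k = of_real (Re (?S k k))" "0 \<le> Re (?S k k)" using psd_diag[OF psd_schur_iter] by auto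
  have "chol G n k * cnj (chol G m k) = ?S n k * ?S k m / (of_real (sqrt (Re (?S k k))) * of_real (sqrt (Re (?S k k))))"
    using psd_herm[OF psd_schur_iter, of k k m] by (simp add: chol_def)
  also have "\<dots> = ?S n k * ?S k m / ?S k k"
    using d by (simp flip: of_real_mult)
  finally show ?thesis by (simp add: schur_def)
qed

lemma chol_sum: "G n m = (\<Sum>k<N. chol G n k * cnj (chol G m k)) + schur_iter G N n m"
proof (induction N)
  case (Suc N)
  then show ?case using chol_step[of N n m] by (simp add: add.assoc)
qed simp

lemma coord_chol: "coord (Abs_l2 (chol G n)) = chol G n"
  by (rule coord_finite_support[of "{..n}"]) (auto simp: chol_zero)

text \<open>Row \<open>n\<close> has support in \<open>{..n}\<close>, and the remainder in row
  \<open>n\<close> is gone after \<open>Suc n\<close> eliminations, so the series is a finite sum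
  with no error.\<close>

lemma ip2_chol: "ip2 (Abs_l2 (chol G n)) (Abs_l2 (chol G m)) = G n m"
proof -
  have "(\<lambda>k. chol G n k * cnj (chol G m k)) sums (\<Sum>k<Suc n. chol G n k * cnj (chol G m k))"
    by (rule sums_finite) (auto simp: chol_zero)
  also have "(\<Sum>k<Suc n. chol G n k * cnj (chol G m k)) = G n m"
    using chol_sum[of n m "Suc n"] by (simp add: schur_iter_zero del: sum.lessThan_Suc schur_iter.simps)
  finally show ?thesis using ip2_sums[of "Abs_l2 (chol G n)" "Abs_l2 (chol G m)"] sums_unique2
    unfolding coord_chol by blast
qed

end

text \<open>Each entry is a fixed expression in finitely many entries of the kernel. This is why the
  fibre vectors depend measurably on the base point.\<close>

lemma measurable_chol:
  assumes "\<And>n m. (\<lambda>x. G x n m) \<in> borel_measurable M"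
  shows "(\<lambda>x. chol (G x) n k) \<in> borel_measurable M"
proof -
  have "(\<lambda>x. schur_iter (G x) k n m) \<in> borel_measurable M" for n m
    by (induction k arbitrary: n m) (use assms in \<open>simp_all add: schur_def\<close>)
  then show ?thesis unfolding chol_def by measurable
qed

section \<open>Carrier-based Hilbert spaces\<close>

lemma ring_of_type_algebra_simps [simp]:
  "carrier ring_of_type_algebra = UNIV"
  "add ring_of_type_algebra = (+)"
  "mult ring_of_type_algebra = (*)"
  "zero ring_of_type_algebra = 0"
  "one ring_of_type_algebra = 1"
  by (simp_all add: ring_of_type_algebra_def)

context hilbert_space
begin

lemma smult_in [simp, intro]: "a \<in> carrier H \<Longrightarrow> c \<odot> a \<in> carrier H"
  by (rule smult_closed) auto

lemma ip_add_right:
  "\<lbrakk>a \<in> carrier H; b \<in> carrier H; c \<in> carrier H\<rbrakk> \<Longrightarrow> ip H c (a \<oplus> b) = ip H c a + ip H c b"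
  using ip_cnj[of "a \<oplus> b" c] ip_cnj[of a c] ip_cnj[of b c] by (simp add: ip_add)

lemma ip_smult_right:
  "\<lbrakk>a \<in> carrier H; b \<in> carrier H\<rbrakk> \<Longrightarrow> ip H b (c \<odot> a) = cnj c * ip H b a"
  using ip_cnj[of "c \<odot> a" b] ip_cnj[of a b] by (simp add: ip_smult)

lemma ip_zero_left [simp]: "a \<in> carrier H \<Longrightarrow> ip H \<zero> a = 0"
  using ip_add[of \<zero> \<zero> a] by simp

lemma ip_zero_right [simp]: "a \<in> carrier H \<Longrightarrow> ip H a \<zero> = 0"
  using ip_cnj[of \<zero> a] by simp

lemma ip_diff_left:
  "\<lbrakk>a \<in> carrier H; b \<in> carrier H; c \<in> carrier H\<rbrakk> \<Longrightarrow> ip H (a \<ominus> b) c = ip H a c - ip H b c"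
  using ip_add[of b "\<ominus> b" c] by (simp add: M.r_neg a_minus_def ip_add) (metis add_eq_0_iff)

lemma ip_diff_right:
  "\<lbrakk>a \<in> carrier H; b \<in> carrier H; c \<in> carrier H\<rbrakk> \<Longrightarrow> ip H c (a \<ominus> b) = ip H c a - ip H c b"
  using ip_cnj[of "a \<ominus> b" c] ip_cnj[of a c] ip_cnj[of b c] by (simp add: ip_diff_left)

lemma ip_norm_nonneg [simp]: "a \<in> carrier H \<Longrightarrow> 0 \<le> ip_norm H a"
  by (simp add: ip_norm_def ip_nonneg)

lemma ip_self: "a \<in> carrier H \<Longrightarrow> ip H a a = of_real ((ip_norm H a)\<^sup>2)"
proof -
  assume a: "a \<in> carrier H"
  have "Im (ip H a a) = 0" using ip_cnj[OF a a] by (metis cnj.simps(2) equal_neg_zero)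
  then show ?thesis using ip_nonneg[OF a] by (simp add: ip_norm_def complex_eq_iff)
qed

lemma ip_norm_zero_iff: "a \<in> carrier H \<Longrightarrow> ip_norm H a = 0 \<longleftrightarrow> a = \<zero>"
  using ip_self[of a] ip_definite[of a] by auto

lemma ip_eqI:
  assumes "a \<in> carrier H" "b \<in> carrier H" "\<And>c. c \<in> carrier H \<Longrightarrow> ip H a c = ip H b c"
  shows "a = b"
proof -
  have "ip H (a \<ominus> b) (a \<ominus> b) = 0" using assms by (simp add: ip_diff_left)
  then have "a \<ominus> b = \<zero>" using assms by (intro ip_definite) auto
  moreover have "a = (a \<ominus> b) \<oplus> b" using assms by (simp add: a_minus_def M.a_assoc M.l_neg)
  ultimately show ?thesis using assms by simp
qed

lemma diff_zero_iff: "a \<in> carrier H \<Longrightarrow> b \<in> carrier H \<Longrightarrow> a \<ominus> b = \<zero> \<longleftrightarrow> a = b"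
  by (auto simp: a_minus_def M.r_neg ip_diff_left[unfolded a_minus_def] intro!: ip_eqI)
    (metis ip_diff_left[unfolded a_minus_def] ip_zero_left eq_iff_diff_eq_0)

lemma cauchy_schwarz:
  assumes "a \<in> carrier H" "b \<in> carrier H"
  shows "cmod (ip H a b) \<le> ip_norm H a * ip_norm H b"
proof (cases "b = \<zero>")
  case False
  define g where "g = (ip_norm H b)\<^sup>2"
  have g: "ip H b b = of_real g" "g > 0" using ip_self assms(2) False ip_norm_zero_iff by (auto simp: g_def)
  define t where "t = ip H a b / g"
  have "ip H (a \<ominus> t \<odot> b) (a \<ominus> t \<odot> b)
      = ip H a a - cnj t * ip H a b - t * ip H b a + t * cnj t * ip H b b"
    using assms by (simp add: ip_diff_left ip_diff_right ip_smult ip_smult_right algebra_simps)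
  also have "\<dots> = ip H a a - ip H a b * cnj (ip H a b) / g"
    using g ip_cnj[OF assms] by (simp add: t_def)
  also have "\<dots> = of_real ((ip_norm H a)\<^sup>2 - (cmod (ip H a b))\<^sup>2 / g)"
    using assms complex_norm_square[of "ip H a b"] by (simp add: ip_self)
  finally have "Re (ip H (a \<ominus> t \<odot> b) (a \<ominus> t \<odot> b)) = (ip_norm H a)\<^sup>2 - (cmod (ip H a b))\<^sup>2 / g"
    by (simp only: Re_complex_of_real)
  then have "(cmod (ip H a b))\<^sup>2 / g \<le> (ip_norm H a)\<^sup>2"
    using ip_nonneg[of "a \<ominus> t \<odot> b"] assms by simp
  then have "(cmod (ip H a b))\<^sup>2 \<le> (ip_norm H a * ip_norm H b)\<^sup>2"
    using g(2) by (simp add: divide_simps power_mult_distrib g_def)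
  then show ?thesis by (rule power2_le_imp_le) (use assms in simp)
qed (use assms in simp)

lemma ip_norm_add: 
  assumes "a \<in> carrier H" "b \<in> carrier H"
  shows "ip_norm H (a \<oplus> b) \<le> ip_norm H a + ip_norm H b"
proof (rule power2_le_imp_le)
  have "of_real ((ip_norm H (a \<oplus> b))\<^sup>2) = ip H a a + ip H b b + (ip H a b + cnj (ip H a b))"
    using assms ip_cnj[OF assms] ip_self[of "a \<oplus> b", symmetric] by (simp add: ip_add ip_add_right)
  also have "\<dots> = of_real ((ip_norm H a)\<^sup>2 + (ip_norm H b)\<^sup>2 + 2 * Re (ip H a b))"
    using assms by (simp add: ip_self complex_add_cnj)
  finally have "(ip_norm H (a \<oplus> b))\<^sup>2 = (ip_norm H a)\<^sup>2 + (ip_norm H b)\<^sup>2 + 2 * Re (ip H a b)"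
    by (simp only: of_real_eq_iff)
  also have "Re (ip H a b) \<le> ip_norm H a * ip_norm H b"
    using cauchy_schwarz[OF assms] complex_Re_le_cmod[of "ip H a b"] by linarith
  finally show "(ip_norm H (a \<oplus> b))\<^sup>2 \<le> (ip_norm H a + ip_norm H b)\<^sup>2" by (simp add: power2_sum)
qed (use assms in simp)

lemma ip_norm_minus_commute:
  assumes "a \<in> carrier H" "b \<in> carrier H"
  shows "ip_norm H (a \<ominus> b) = ip_norm H (b \<ominus> a)"
  using assms unfolding ip_norm_def by (simp add: ip_diff_left ip_diff_right algebra_simps)

lemma ip_norm_triangle_diff:
  assumes "a \<in> carrier H" "b \<in> carrier H" "c \<in> carrier H"
  shows "ip_norm H (a \<ominus> c) \<le> ip_norm H (a \<ominus> b) + ip_norm H (b \<ominus> c)"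
proof -
  have "a \<ominus> c = (a \<ominus> b) \<oplus> (b \<ominus> c)"
    using assms by (intro ip_eqI) (auto simp: ip_diff_left ip_add)
  then show ?thesis using ip_norm_add[of "a \<ominus> b" "b \<ominus> c"] assms by simp
qed

lemma Metric_space_carrier: "Metric_space (carrier H) (ip_dist H)"
proof
  show "ip_dist H a b = 0 \<longleftrightarrow> a = b" if "a \<in> carrier H" "b \<in> carrier H" for a b
    using that by (simp add: ip_dist_def ip_norm_zero_iff diff_zero_iff)
  show "ip_dist H a c \<le> ip_dist H a b + ip_dist H b c" if "a \<in> carrier H" "b \<in> carrier H" "c \<in> carrier H" for a b c
    using that ip_norm_triangle_diff by (simp add: ip_dist_def)
qed (auto simp: ip_dist_def ip_norm_minus_commute)

text \<open>Describes a linear combination by its inner products alone, which is how all finite sums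
  in \<open>H\<close> are handled below.\<close>

lemma ex_lincomb:
  fixes N :: nat
  assumes "\<And>n. n < N \<Longrightarrow> h n \<in> carrier H"
  shows "\<exists>s\<in>carrier H. \<forall>z\<in>carrier H. ip H s z = (\<Sum>n<N. c n * ip H (h n) z)"
  using assms
proof (induction N)
  case 0
  then show ?case by (intro bexI[of _ \<zero>]) auto
next
  case (Suc N)
  then obtain s where "s \<in> carrier H" "\<forall>z\<in>carrier H. ip H s z = (\<Sum>n<N. c n * ip H (h n) z)" by auto
  then show ?case using Suc.prems[of N]
    by (intro bexI[of _ "s \<oplus> c N \<odot> h N"]) (auto simp: ip_add ip_smult)
qed

lemma ip_tendsto:
  assumes "\<And>k. a k \<in> carrier H" "\<And>k. b k \<in> carrier H" "x \<in> carrier H" "y \<in> carrier H"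
    and "(\<lambda>k. ip_norm H (a k \<ominus> x)) \<longlonglongrightarrow> 0" "(\<lambda>k. ip_norm H (b k \<ominus> y)) \<longlonglongrightarrow> 0"
  shows "(\<lambda>k. ip H (a k) (b k)) \<longlonglongrightarrow> ip H x y"
proof -
  have "(\<lambda>k. ip H (a k) (b k) - ip H x y) \<longlonglongrightarrow> 0"
  proof (rule Lim_null_comparison)
    let ?g = "\<lambda>k. ip_norm H (a k \<ominus> x) * ip_norm H (b k \<ominus> y) + ip_norm H (a k \<ominus> x) * ip_norm H y
        + ip_norm H x * ip_norm H (b k \<ominus> y)"
    show "\<forall>\<^sub>F k in sequentially. norm (ip H (a k) (b k) - ip H x y) \<le> ?g k"
    proof (rule always_eventually, rule allI)
      fix k
      have "ip H (a k) (b k) - ip H x y = ip H (a k \<ominus> x) (b k \<ominus> y) + ip H (a k \<ominus> x) y + ip H x (b k \<ominus> y)"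
        using assms(1-4) by (simp add: ip_diff_left ip_diff_right)
      then show "norm (ip H (a k) (b k) - ip H x y) \<le> ?g k"
        using assms(1-4) by (simp only:) (intro norm_triangle_mono cauchy_schwarz; simp)
    qed
    have "?g \<longlonglongrightarrow> 0 * 0 + 0 * ip_norm H y + ip_norm H x * 0" by (intro tendsto_intros assms)
    then show "?g \<longlonglongrightarrow> 0" by simp
  qed
  then show ?thesis by (rule LIM_zero_cancel)
qed

text \<open>Restates completeness through norms of differences, ready for sequences pulled back from
  l2.\<close>

lemma carrier_complete:
  assumes "\<And>n. a n \<in> carrier H"
    and "\<And>e. e > 0 \<Longrightarrow> \<exists>N. \<forall>m\<ge>N. \<forall>n\<ge>N. ip_norm H (a m \<ominus> a n) < e"
  shows "\<exists>l\<in>carrier H. (\<lambda>n. ip_norm H (a n \<ominus> l)) \<longlonglongrightarrow> 0"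
proof -
  interpret MS: Metric_space "carrier H" "ip_dist H" by (rule Metric_space_carrier)
  have "MS.MCauchy a" unfolding MS.MCauchy_def using assms by (auto simp: ip_dist_def) 
  then obtain l where "limitin MS.mtopology a l sequentially" using complete MS.mcomplete_def by blast
  then have l: "l \<in> carrier H" "\<And>e. e > 0 \<Longrightarrow> \<exists>N. \<forall>n\<ge>N. ip_dist H (a n) l < e"
    unfolding MS.limit_metric_sequentially by blast+
  have "(\<lambda>n. ip_norm H (a n \<ominus> l)) \<longlonglongrightarrow> 0"
    by (rule LIMSEQ_I) (use l assms(1) in \<open>auto simp: ip_dist_def\<close>)
  then show ?thesis using l by blast
qed

end

section \<open>Embedding a separable Hilbert space isometrically into l2\<close>

text \<open>Only preservation of inner products is asked of the choice; linearity follows from it.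
  An embedding, rather than a unitary map, covers finite-dimensional \<open>H\<close> as
  well.\<close>

definition l2emb :: "('h, 'm) inner_prod_space_scheme \<Rightarrow> 'h \<Rightarrow> l2" where
  "l2emb H = (SOME V. \<forall>a\<in>carrier H. \<forall>b\<in>carrier H. ip2 (V a) (V b) = ip H a b)"

context separable_hilbert_space
begin

lemma dense_seq:
  obtains h :: "nat \<Rightarrow> 'a" where "\<And>n. h n \<in> carrier H"
    "\<And>a e. a \<in> carrier H \<Longrightarrow> e > 0 \<Longrightarrow> \<exists>n. ip_norm H (h n \<ominus> a) < e"
proof -
  interpret MS: Metric_space "carrier H" "ip_dist H" by (rule Metric_space_carrier)
  obtain C where C: "countable C" "C \<subseteq> carrier H" "MS.mtopology closure_of C = carrier H"
    using separable by (auto simp: separable_space_def)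
  have d: "\<exists>y\<in>C. ip_norm H (y \<ominus> a) < e" if a: "a \<in> carrier H" and "e > 0" for a e
  proof -
    have "a \<in> MS.mtopology closure_of C" using C(3) a by simp
    then obtain y where "y \<in> C" "y \<in> MS.mball a e" using \<open>e > 0\<close> unfolding MS.metric_closure_of by blast
    then show ?thesis using a C(2) ip_norm_minus_commute[OF a, of y] by (intro bexI[of _ y]) (auto simp: ip_dist_def)
  qed
  have "C \<noteq> {}" using d[of \<zero> 1] by auto
  show ?thesis
  proof (rule that[of "from_nat_into C"])
    show "from_nat_into C n \<in> carrier H" for n using from_nat_into[OF \<open>C \<noteq> {}\<close>] C(2) by blast
    show "\<exists>n. ip_norm H (from_nat_into C n \<ominus> a) < e" if "a \<in> carrier H" "e > 0" for a e
      using d[OF that] from_nat_into_surj[OF C(1)] by metis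
  qed
qed

text \<open>The Cholesky rows of the Gram kernel of a dense sequence have the same mutual inner
  products as the sequence, hence the same distances, so the map extends to limits without any
  Gram-Schmidt process.\<close>

lemma ex_l2emb: "\<exists>V. \<forall>a\<in>carrier H. \<forall>b\<in>carrier H. ip2 (V a) (V b) = ip H a b"
proof -
  obtain h :: "nat \<Rightarrow> 'a" where h: "\<And>n. h n \<in> carrier H"
    and dense: "\<And>a e. a \<in> carrier H \<Longrightarrow> e > 0 \<Longrightarrow> \<exists>n. ip_norm H (h n \<ominus> a) < e" by (rule dense_seq) blast
  define G where "G n m = ip H (h n) (h m)" for n m
  have G: "psd_kernel G"
    unfolding psd_kernel_def
  proof (intro conjI allI)
    show "G m n = cnj (G n m)" for n m unfolding G_def by (rule ip_cnj) (rule h)+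
    show "0 \<le> Re (\<Sum>n<N. \<Sum>m<N. c n * cnj (c m) * G n m)" for N c
    proof -
      obtain s where s: "s \<in> carrier H" "\<And>z. z \<in> carrier H \<Longrightarrow> ip H s z = (\<Sum>n<N. c n * ip H (h n) z)"
        using ex_lincomb[of N h c] h by blast
      have "ip H (h n) s = (\<Sum>m<N. cnj (c m) * G n m)" for n
        unfolding ip_cnj[OF s(1) h[of n]] s(2)[OF h[of n]] by (simp add: G_def ip_cnj[OF h h, symmetric])
      then have "(\<Sum>n<N. \<Sum>m<N. c n * cnj (c m) * G n m) = ip H s s"
        using s by (simp add: sum_distrib_left mult.assoc)
      then show ?thesis using ip_nonneg[OF s(1)] by simp
    qed
  qed
  define r where "r n = Abs_l2 (chol G n)" for n
  have r: "ip2 (r n) (r m) = ip H (h n) (h m)" for n m unfolding r_def ip2_chol[OF G] G_def ..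
  have r_norm: "norm (r n - r m) = ip_norm H (h n \<ominus> h m)" for n m
    unfolding norm_eq_sqrt_inner inner_l2_def ip_norm_def
    by (simp add: ip2.diff_left ip2.diff_right r ip_diff_left ip_diff_right h)
  \<comment> \<open>Indices of a sequence of dense vectors approaching \<open>a\<close>; the image
    of \<open>a\<close> is the limit of the corresponding Cholesky rows.\<close>
  define s where "s a k = (SOME n. ip_norm H (h n \<ominus> a) < 1 / real (Suc k))" for a k
  have s: "ip_norm H (h (s a k) \<ominus> a) < 1 / real (Suc k)" if "a \<in> carrier H" for a k
    unfolding s_def by (rule someI_ex[OF dense[OF that]]) simp
  have s_lim: "(\<lambda>k. ip_norm H (h (s a k) \<ominus> a)) \<longlonglongrightarrow> 0" if "a \<in> carrier H" for a
    by (rule Lim_null_comparison[OF _ LIMSEQ_Suc[OF lim_1_over_n]])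
       (use s[OF that] h that in \<open>auto intro!: always_eventually less_imp_le\<close>)
  have "convergent (\<lambda>k. r (s a k))" if a: "a \<in> carrier H" for a
  proof -
    have "Cauchy (\<lambda>k. r (s a k))"
    proof (rule metric_CauchyI)
      fix e :: real assume "e > 0"
      then obtain N where N: "\<And>k. k \<ge> N \<Longrightarrow> ip_norm H (h (s a k) \<ominus> a) < e / 2"
        using order_tendstoD(2)[OF s_lim[OF a], of "e/2"] by (auto simp: eventually_sequentially)
      have "dist (r (s a m)) (r (s a n)) < e" if "m \<ge> N" "n \<ge> N" for m n
        using ip_norm_triangle_diff[of "h (s a m)" a "h (s a n)"] N[OF that(1)] N[OF that(2)] h a
          ip_norm_minus_commute[of a "h (s a n)"] by (simp add: dist_norm r_norm)
      then show "\<exists>M. \<forall>m\<ge>M. \<forall>n\<ge>M. dist (r (s a m)) (r (s a n)) < e" by blast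
    qed
    then show ?thesis by (rule Cauchy_convergent)
  qed
  then have lim: "(\<lambda>k. r (s a k)) \<longlonglongrightarrow> lim (\<lambda>k. r (s a k))" if "a \<in> carrier H" for a
    using that convergent_LIMSEQ_iff by blast
  have "ip2 (lim (\<lambda>k. r (s a k))) (lim (\<lambda>k. r (s b k))) = ip H a b" if "a \<in> carrier H" "b \<in> carrier H" for a b
  proof -
    have "(\<lambda>k. ip2 (r (s a k)) (r (s b k))) \<longlonglongrightarrow> ip2 (lim (\<lambda>k. r (s a k))) (lim (\<lambda>k. r (s b k)))"
      by (intro ip2.tendsto lim that)
    moreover have "(\<lambda>k. ip2 (r (s a k)) (r (s b k))) \<longlonglongrightarrow> ip H a b"
      unfolding r by (intro ip_tendsto h that s_lim)
    ultimately show ?thesis by (rule LIMSEQ_unique)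
  qed
  then show ?thesis by (intro exI[of _ "\<lambda>a. lim (\<lambda>k. r (s a k))"] ballI)
qed

lemma ip2_l2emb: "a \<in> carrier H \<Longrightarrow> b \<in> carrier H \<Longrightarrow> ip2 (l2emb H a) (l2emb H b) = ip H a b"
  using someI_ex[OF ex_l2emb] by (simp add: l2emb_def)

lemma norm_l2emb: "a \<in> carrier H \<Longrightarrow> norm (l2emb H a) = ip_norm H a"
  by (simp add: norm_eq_sqrt_inner inner_l2_def ip_norm_def ip2_l2emb)

text \<open>The squared norm of the defect expands into inner products of embedded vectors, which
  cancel as they do in \<open>H\<close>.\<close>

lemma l2emb_add:
  assumes "a \<in> carrier H" "b \<in> carrier H"
  shows "l2emb H (a \<oplus> b) = l2emb H a + l2emb H b"
proof -
  let ?d = "l2emb H (a \<oplus> b) - (l2emb H a + l2emb H b)"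
  have "ip2 ?d ?d = 0"
    using assms by (simp add: ip2.diff_left ip2.diff_right ip2.add_left ip2.add_right ip2_l2emb ip_add ip_add_right)
  then show ?thesis by (simp add: ip2_self)
qed

lemma l2emb_smult:
  assumes "a \<in> carrier H"
  shows "l2emb H (c \<odot> a) = scaleC c (l2emb H a)"
proof -
  let ?d = "l2emb H (c \<odot> a) - scaleC c (l2emb H a)"
  have "ip2 ?d ?d = 0"
    using assms by (simp add: ip2.diff_left ip2.diff_right ip2_scaleC_left ip2_scaleC_right ip2_l2emb ip_smult ip_smult_right)
  then show ?thesis by (simp add: ip2_self)
qed

lemma l2emb_diff:
  assumes "a \<in> carrier H" "b \<in> carrier H"
  shows "l2emb H (a \<ominus> b) = l2emb H a - l2emb H b"
  using l2emb_add[of "a \<ominus> b" b] assms by (simp add: a_minus_def M.a_assoc M.l_neg)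

lemma csubspace_l2emb: "csubspace (l2emb H ` carrier H)"
  unfolding csubspace_def
proof (intro conjI ballI allI)
  have "l2emb H \<zero> = 0" using norm_l2emb[of \<zero>] ip_norm_zero_iff[of \<zero>] by simp
  then show "0 \<in> l2emb H ` carrier H" by (intro image_eqI[of _ _ \<zero>]) auto
  fix x assume "x \<in> l2emb H ` carrier H"
  then obtain a where a: "a \<in> carrier H" "x = l2emb H a" by blast
  then show "scaleC c x \<in> l2emb H ` carrier H" for c
    by (intro image_eqI[of _ _ "c \<odot> a"]) (simp_all add: l2emb_smult)
  fix y assume "y \<in> l2emb H ` carrier H"
  then obtain b where "b \<in> carrier H" "y = l2emb H b" by blast
  then show "x + y \<in> l2emb H ` carrier H"
    using a by (intro image_eqI[of _ _ "a \<oplus> b"]) (simp_all add: l2emb_add)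
qed

text \<open>An isometric image of a complete space is closed; this makes projection onto the copy of
  \<open>H\<close>, and thereby \<open>riesz\<close> and \<open>frame\<close>, available.\<close>

lemma closed_l2emb: "closed (l2emb H ` carrier H)"
  unfolding closed_sequential_limits
proof (intro allI impI, elim conjE)
  fix y l assume y: "\<forall>n. y n \<in> l2emb H ` carrier H" and l: "y \<longlonglongrightarrow> l"
  then have "\<forall>n. \<exists>a. a \<in> carrier H \<and> y n = l2emb H a" by blast
  then obtain a where a: "\<And>n. a n \<in> carrier H" "\<And>n. y n = l2emb H (a n)" by metis
  have d: "ip_norm H (a m \<ominus> a n) = dist (y m) (y n)" for m n
    using a by (simp add: dist_norm l2emb_diff[symmetric] norm_l2emb)
  have "\<exists>x\<in>carrier H. (\<lambda>n. ip_norm H (a n \<ominus> x)) \<longlonglongrightarrow> 0"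
    using LIMSEQ_imp_Cauchy[OF l] a(1) unfolding Cauchy_def d[symmetric] by (intro carrier_complete) auto
  then obtain x where x: "x \<in> carrier H" "(\<lambda>n. ip_norm H (a n \<ominus> x)) \<longlonglongrightarrow> 0" by blast
  have "(\<lambda>n. norm (y n - l2emb H x)) \<longlonglongrightarrow> 0"
    using x a by (simp add: l2emb_diff[symmetric] norm_l2emb)
  then have "y \<longlonglongrightarrow> l2emb H x" using tendsto_norm_zero_iff LIM_zero_iff by blast
  then show "l \<in> l2emb H ` carrier H" using l x(1) LIMSEQ_unique by blast
qed

lemma riesz:
  assumes add: "\<And>a b. a \<in> carrier H \<Longrightarrow> b \<in> carrier H \<Longrightarrow> f (a \<oplus> b) = f a + f b"
    and smult: "\<And>c a. a \<in> carrier H \<Longrightarrow> f (c \<odot> a) = c * f a"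
    and bound: "\<And>a. a \<in> carrier H \<Longrightarrow> cmod (f a) \<le> C * ip_norm H a"
  shows "\<exists>y\<in>carrier H. \<forall>a\<in>carrier H. f a = ip H a y"
proof -
  have inj: "inj_on (l2emb H) (carrier H)"
  proof (rule inj_onI)
    fix a b assume ab: "a \<in> carrier H" "b \<in> carrier H" "l2emb H a = l2emb H b"
    show "a = b" using ab ip2_l2emb by (intro ip_eqI) (metis, metis, metis)
  qed
  define g where "g = f \<circ> the_inv_into (carrier H) (l2emb H)"
  have g: "g (l2emb H a) = f a" if "a \<in> carrier H" for a
    using that inj by (simp add: g_def the_inv_into_f_f)
  have "\<exists>y\<in>l2emb H ` carrier H. \<forall>x\<in>l2emb H ` carrier H. g x = ip2 x y"
  proof (rule riesz_csubspace[OF closed_l2emb csubspace_l2emb, of g C])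
    show "g (x + y) = g x + g y" if "x \<in> l2emb H ` carrier H" "y \<in> l2emb H ` carrier H" for x y
      using that by (auto simp: l2emb_add[symmetric] g add)
    show "g (scaleC c x) = c * g x" if "x \<in> l2emb H ` carrier H" for x c
      using that by (auto simp: l2emb_smult[symmetric] g smult)
    show "cmod (g x) \<le> C * norm x" if "x \<in> l2emb H ` carrier H" for x
      using that by (auto simp: norm_l2emb g bound)
  qed
  then show ?thesis by (auto simp: g ip2_l2emb)
qed

text \<open>The coordinate vectors of l2 projected onto the copy of \<open>H\<close>: a Parseval
  frame, in general not an orthonormal basis, so the dimension of \<open>H\<close> never
  matters.\<close>

definition frame :: "nat \<Rightarrow> 'a" where
  "frame k = (SOME e. e \<in> carrier H \<and> l2emb H e = proj (l2emb H ` carrier H) (unit_l2 k))"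

lemma frame: "frame k \<in> carrier H" "l2emb H (frame k) = proj (l2emb H ` carrier H) (unit_l2 k)"
proof -
  have "\<exists>e. e \<in> carrier H \<and> l2emb H e = proj (l2emb H ` carrier H) (unit_l2 k)"
    using proj_in[OF closed_l2emb csubspace_l2emb, of "unit_l2 k"] by (metis imageE)
  from someI_ex[OF this] show "frame k \<in> carrier H" "l2emb H (frame k) = proj (l2emb H ` carrier H) (unit_l2 k)"
    by (auto simp: frame_def)
qed

lemma coord_l2emb: "a \<in> carrier H \<Longrightarrow> coord (l2emb H a) k = ip H a (frame k)"
  using ip2_proj_right[OF closed_l2emb csubspace_l2emb, of "l2emb H a" "unit_l2 k"]
  by (simp add: ip2_l2emb[symmetric] frame ip2_unit_right)

text \<open>The terms are products of coordinates of two embedded vectors. The expansion makes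
  products of weakly measurable operator functions measurable in \<open>ess_mult\<close>.\<close>

lemma parseval: "a \<in> carrier H \<Longrightarrow> b \<in> carrier H \<Longrightarrow> (\<lambda>k. ip H a (frame k) * ip H (frame k) b) sums ip H a b"
  using ip2_sums[of "l2emb H a" "l2emb H b"] ip_cnj[OF _ frame(1), of b] by (simp add: coord_l2emb ip2_l2emb)

end

section \<open>Bounded operators and their adjoints\<close>

lemma bounded_opsD:
  assumes "T \<in> bounded_ops H K"
  shows "\<xi> \<in> carrier H \<Longrightarrow> T \<xi> \<in> carrier K"
    and "\<xi> \<in> carrier H \<Longrightarrow> \<eta> \<in> carrier H \<Longrightarrow> T (\<xi> \<oplus>\<^bsub>H\<^esub> \<eta>) = T \<xi> \<oplus>\<^bsub>K\<^esub> T \<eta>"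
    and "\<xi> \<in> carrier H \<Longrightarrow> T (c \<odot>\<^bsub>H\<^esub> \<xi>) = c \<odot>\<^bsub>K\<^esub> T \<xi>"
    and "T \<in> extensional (carrier H)"
    and "\<exists>C. \<forall>\<xi>\<in>carrier H. ip_norm K (T \<xi>) \<le> C * ip_norm H \<xi>"
  using assms by (auto simp: bounded_ops_def PiE_def)

lemma bounded_opsI:
  assumes "\<And>\<xi>. \<xi> \<in> carrier H \<Longrightarrow> T \<xi> \<in> carrier K" "T \<in> extensional (carrier H)"
    and "\<And>\<xi> \<eta>. \<xi> \<in> carrier H \<Longrightarrow> \<eta> \<in> carrier H \<Longrightarrow> T (\<xi> \<oplus>\<^bsub>H\<^esub> \<eta>) = T \<xi> \<oplus>\<^bsub>K\<^esub> T \<eta>"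
    and "\<And>c \<xi>. \<xi> \<in> carrier H \<Longrightarrow> T (c \<odot>\<^bsub>H\<^esub> \<xi>) = c \<odot>\<^bsub>K\<^esub> T \<xi>"
    and "\<And>\<xi>. \<xi> \<in> carrier H \<Longrightarrow> ip_norm K (T \<xi>) \<le> C * ip_norm H \<xi>"
  shows "T \<in> bounded_ops H K"
  unfolding bounded_ops_def
proof (intro CollectI conjI ballI allI exI[of _ C])
  show "T \<in> carrier H \<rightarrow>\<^sub>E carrier K" using assms(1,2) by (auto simp: PiE_def)
qed (simp_all add: assms)

lemma (in hilbert_space) adjoint_op_eqI:
  assumes "\<zeta> \<in> carrier H" "\<And>\<xi>. \<xi> \<in> carrier H \<Longrightarrow> ip K (T \<xi>) \<eta> = ip H \<xi> \<zeta>" "\<eta> \<in> carrier K"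
  shows "adjoint_op H K T \<eta> = \<zeta>"
proof -
  have "(THE \<zeta>. \<zeta> \<in> carrier H \<and> (\<forall>\<xi>\<in>carrier H. ip K (T \<xi>) \<eta> = ip H \<xi> \<zeta>)) = \<zeta>"
  proof (rule the_equality)
    fix z assume z: "z \<in> carrier H \<and> (\<forall>\<xi>\<in>carrier H. ip K (T \<xi>) \<eta> = ip H \<xi> z)"
    show "z = \<zeta>"
    proof (rule ip_eqI)
      fix c assume c: "c \<in> carrier H"
      then have "ip H c z = ip H c \<zeta>" using z assms(2) by auto
      then show "ip H z c = ip H \<zeta> c" using ip_cnj c z assms(1) by metis
    qed (use z assms in auto)
  qed (use assms in auto)
  then show ?thesis using assms(3) by (simp add: adjoint_op_def)
qed

context separable_hilbert_space
begin

lemma adjoint_op: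
  assumes T: "T \<in> bounded_ops H H"
  shows "\<eta> \<in> carrier H \<Longrightarrow> adjoint_op H H T \<eta> \<in> carrier H"
    and "\<xi> \<in> carrier H \<Longrightarrow> \<eta> \<in> carrier H \<Longrightarrow> ip H (T \<xi>) \<eta> = ip H \<xi> (adjoint_op H H T \<eta>)"
proof -
  have *: "adjoint_op H H T \<eta> \<in> carrier H \<and> (\<forall>\<xi>\<in>carrier H. ip H (T \<xi>) \<eta> = ip H \<xi> (adjoint_op H H T \<eta>))"
    if e: "\<eta> \<in> carrier H" for \<eta>
  proof -
    obtain C where C: "\<forall>\<xi>\<in>carrier H. ip_norm H (T \<xi>) \<le> C * ip_norm H \<xi>" using bounded_opsD(5)[OF T] by blast
    have "\<exists>y\<in>carrier H. \<forall>\<xi>\<in>carrier H. ip H (T \<xi>) \<eta> = ip H \<xi> y"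
    proof (rule riesz[of "\<lambda>\<xi>. ip H (T \<xi>) \<eta>" "C * ip_norm H \<eta>"])
      fix \<xi> assume x: "\<xi> \<in> carrier H"
      have "cmod (ip H (T \<xi>) \<eta>) \<le> ip_norm H (T \<xi>) * ip_norm H \<eta>"
        by (rule cauchy_schwarz) (use e x bounded_opsD(1)[OF T] in auto)
      also have "\<dots> \<le> (C * ip_norm H \<xi>) * ip_norm H \<eta>" using C x e by (intro mult_right_mono) auto
      finally show "cmod (ip H (T \<xi>) \<eta>) \<le> C * ip_norm H \<eta> * ip_norm H \<xi>" by (simp add: algebra_simps)
    qed (use e bounded_opsD[OF T] in \<open>auto simp: ip_add ip_smult\<close>)
    then obtain y where "y \<in> carrier H" "\<forall>\<xi>\<in>carrier H. ip H (T \<xi>) \<eta> = ip H \<xi> y" by blast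
    moreover from this have "adjoint_op H H T \<eta> = y" by (intro adjoint_op_eqI e) auto
    ultimately show ?thesis by simp
  qed
  show "\<eta> \<in> carrier H \<Longrightarrow> adjoint_op H H T \<eta> \<in> carrier H"
    "\<xi> \<in> carrier H \<Longrightarrow> \<eta> \<in> carrier H \<Longrightarrow> ip H (T \<xi>) \<eta> = ip H \<xi> (adjoint_op H H T \<eta>)"
    using * by auto
qed

lemma adjoint_op_bound:
  assumes T: "T \<in> bounded_ops H H" and C: "\<forall>\<xi>\<in>carrier H. ip_norm H (T \<xi>) \<le> C * ip_norm H \<xi>"
    and e: "\<eta> \<in> carrier H"
  shows "ip_norm H (adjoint_op H H T \<eta>) \<le> C * ip_norm H \<eta>"
proof -
  let ?y = "adjoint_op H H T \<eta>"
  have y: "?y \<in> carrier H" using adjoint_op(1)[OF T e] .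
  have "(ip_norm H ?y)\<^sup>2 = cmod (ip H ?y ?y)" using y by (simp add: ip_self norm_power)
  also have "ip H ?y ?y = ip H (T ?y) \<eta>" using adjoint_op(2)[OF T y e] by simp
  also have "cmod (ip H (T ?y) \<eta>) \<le> ip_norm H (T ?y) * ip_norm H \<eta>"
    by (rule cauchy_schwarz) (use e y bounded_opsD(1)[OF T] in auto)
  also have "\<dots> \<le> (C * ip_norm H ?y) * ip_norm H \<eta>" using C y e by (intro mult_right_mono) auto
  finally have *: "ip_norm H ?y * ip_norm H ?y \<le> ip_norm H ?y * (C * ip_norm H \<eta>)"
    by (simp add: power2_eq_square algebra_simps)
  show ?thesis
  proof (cases "ip_norm H ?y = 0")
    case True
    \<comment> \<open>Nothing says that \<open>C\<close> is nonnegative; the sign of this product is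
      read off from the bound for \<open>T \<eta>\<close> itself.\<close>
    have "0 \<le> C * ip_norm H \<eta>" using C e ip_norm_nonneg[OF bounded_opsD(1)[OF T e]] by (meson order_trans)
    then show ?thesis using True by simp
  next
    case False
    then have "0 < ip_norm H ?y" using ip_norm_nonneg[OF y] by linarith
    then show ?thesis using * by simp
  qed
qed

lemma adjoint_op_in:
  assumes T: "T \<in> bounded_ops H H"
  shows "adjoint_op H H T \<in> bounded_ops H H"
proof -
  note a = adjoint_op(1)[OF T]
  have a2: "ip H \<xi> (adjoint_op H H T \<eta>) = ip H (T \<xi>) \<eta>" if "\<xi> \<in> carrier H" "\<eta> \<in> carrier H" for \<xi> \<eta>
    using adjoint_op(2)[OF T that] by simp
  note Tc = bounded_opsD(1)[OF T]
  obtain C where C: "\<forall>\<xi>\<in>carrier H. ip_norm H (T \<xi>) \<le> C * ip_norm H \<xi>" using bounded_opsD(5)[OF T] by blast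
  show ?thesis
  proof (rule bounded_opsI)
    show "adjoint_op H H T (\<xi> \<oplus> \<eta>) = adjoint_op H H T \<xi> \<oplus> adjoint_op H H T \<eta>"
      if "\<xi> \<in> carrier H" "\<eta> \<in> carrier H" for \<xi> \<eta>
      using that a a2 Tc by (intro adjoint_op_eqI) (auto simp: ip_add_right)
    show "adjoint_op H H T (c \<odot> \<xi>) = c \<odot> adjoint_op H H T \<xi>" if "\<xi> \<in> carrier H" for c \<xi>
      using that a a2 Tc by (intro adjoint_op_eqI) (auto simp: ip_smult_right)
    show "adjoint_op H H T \<in> extensional (carrier H)" by (simp add: adjoint_op_def)
  qed (use a adjoint_op_bound[OF T C] in auto)
qed

end

section \<open>The sequence space as a Hilbert space\<close>

text \<open>The points are coefficient functions rather than elements of the type \<open>l2\<close>,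
  so the dilation space has the type of the theorem's \<open>K\<close>.\<close>

definition l2_space :: "(nat \<Rightarrow> complex) inner_prod_space" where
  "l2_space = \<lparr>carrier = range coord, mult = (\<lambda>f g. f), one = (\<lambda>_. 0), zero = (\<lambda>_. 0),
     add = (\<lambda>f g n. f n + g n), smult = (\<lambda>c f n. c * f n), ip = (\<lambda>f g. \<Sum>n. f n * cnj (g n))\<rparr>"

lemma l2_space_simps [simp]:
  "carrier l2_space = range coord"
  "\<zero>\<^bsub>l2_space\<^esub> = coord 0"
  "coord x \<oplus>\<^bsub>l2_space\<^esub> coord y = coord (x + y)"
  "c \<odot>\<^bsub>l2_space\<^esub> coord x = coord (scaleC c x)"
  "ip l2_space (coord x) (coord y) = ip2 x y"
  by (auto simp: l2_space_def coord_simps fun_eq_iff ip2_def)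

lemma abelian_group_l2: "abelian_group l2_space"
proof (rule abelian_groupI)
  fix x assume "x \<in> carrier l2_space"
  then obtain a where "x = coord a" by auto
  then show "\<exists>y\<in>carrier l2_space. y \<oplus>\<^bsub>l2_space\<^esub> x = \<zero>\<^bsub>l2_space\<^esub>"
    by (intro bexI[of _ "coord (- a)"]) auto
qed (auto simp: algebra_simps)

lemma l2_space_minus [simp]: "coord x \<ominus>\<^bsub>l2_space\<^esub> coord y = coord (x - y)"
proof -
  interpret abelian_group l2_space by (rule abelian_group_l2)
  have "\<ominus>\<^bsub>l2_space\<^esub> coord y = coord (- y)" by (rule minus_equality) auto
  then show ?thesis by (simp add: a_minus_def)
qed

lemma ip_norm_l2_space [simp]: "ip_norm l2_space (coord x) = norm x"
  by (simp add: ip_norm_def norm_eq_sqrt_inner inner_l2_def)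

lemma ip_dist_l2_space [simp]: "ip_dist l2_space (coord x) (coord y) = dist x y"
  by (simp add: ip_dist_def dist_norm)

lemma Metric_space_l2: "Metric_space (carrier l2_space) (ip_dist l2_space)"
proof
  show "0 \<le> ip_dist l2_space x y" for x y
    by (cases "x \<in> range coord \<and> y \<in> range coord") (auto simp: ip_dist_def)
  show "ip_dist l2_space x y = ip_dist l2_space y x" for x y
    by (cases "x \<in> range coord \<and> y \<in> range coord") (auto simp: ip_dist_def norm_minus_commute)
  show "ip_dist l2_space x y = 0 \<longleftrightarrow> x = y" if "x \<in> carrier l2_space" "y \<in> carrier l2_space" for x y
    using that by (auto simp: coord_inject)
  show "ip_dist l2_space x z \<le> ip_dist l2_space x y + ip_dist l2_space y z"
    if "x \<in> carrier l2_space" "y \<in> carrier l2_space" "z \<in> carrier l2_space" for x y z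
    using that by (auto simp: dist_triangle)
qed

lemma separable_hilbert_space_l2: "separable_hilbert_space l2_space"
proof -
  interpret MS: Metric_space "carrier l2_space" "ip_dist l2_space" by (rule Metric_space_l2)
  have "module (ring_of_type_algebra :: complex ring) l2_space"
    by (rule moduleI[OF cring_from_type_algebra abelian_group_l2])
       (auto simp: scaleC.add_left scaleC.add_right)
  moreover have "MS.mcomplete"
    unfolding MS.mcomplete_def
  proof (intro allI impI)
    fix s assume s: "MS.MCauchy s"
    define t where "t n = Abs_l2 (s n)" for n
    have st: "s n = coord (t n)" for n
    proof -
      have "s n \<in> range coord" using s unfolding MS.MCauchy_def by auto
      then show ?thesis by (auto simp: t_def coord_inverse)
    qed
    have "Cauchy t" using s unfolding MS.MCauchy_def Cauchy_def st by auto
    then obtain l where "t \<longlonglongrightarrow> l" using Cauchy_convergent convergent_def by blast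
    then have "limitin MS.mtopology s (coord l) sequentially"
      unfolding MS.limit_metric_sequentially st by (auto dest: metric_LIMSEQ_D)
    then show "\<exists>x. limitin MS.mtopology s x sequentially" by blast
  qed
  moreover have "separable_space MS.mtopology"
  proof -
    obtain D :: "l2 set" where D: "countable D" "closure D = UNIV" using l2_separable by blast
    have "MS.mtopology closure_of (coord ` D) = range coord"
      unfolding MS.metric_closure_of
    proof (intro equalityI subsetI CollectI conjI allI impI)
      fix x and r :: real assume x: "x \<in> range coord" and r: "0 < r"
      then obtain a where a: "x = coord a" by auto
      have "a \<in> closure D" using D by simp
      then obtain d where "d \<in> D" "dist d a < r" using r closure_approachable by blast
      then have "coord d \<in> MS.mball x r" unfolding MS.in_mball by (simp add: a dist_commute)
      then show "\<exists>y\<in>coord ` D. y \<in> MS.mball x r" using \<open>d \<in> D\<close> by blast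
    qed auto
    then show ?thesis using D(1) unfolding separable_space_def MS.topspace_mtopology
      by (intro exI[of _ "coord ` D"]) auto
  qed
  ultimately show ?thesis
    by (intro separable_hilbert_space.intro hilbert_space.intro hilbert_space_axioms.intro separable_hilbert_space_axioms.intro)
       (auto simp: ip2_add_left ip2_scaleC_left ip2_self intro: ip2_cnj)
qed

section \<open>The algebra of essentially bounded operator functions\<close>

lemma bounded_op_alg_simps [simp]:
  "carrier (bounded_op_alg H) = bounded_ops H H"
  "S \<otimes>\<^bsub>bounded_op_alg H\<^esub> T = compose (carrier H) S T"
  "\<one>\<^bsub>bounded_op_alg H\<^esub> = (\<lambda>\<xi>\<in>carrier H. \<xi>)"
  "\<zero>\<^bsub>bounded_op_alg H\<^esub> = (\<lambda>_\<in>carrier H. \<zero>\<^bsub>H\<^esub>)"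
  "S \<oplus>\<^bsub>bounded_op_alg H\<^esub> T = (\<lambda>\<xi>\<in>carrier H. S \<xi> \<oplus>\<^bsub>H\<^esub> T \<xi>)"
  "c \<odot>\<^bsub>bounded_op_alg H\<^esub> T = (\<lambda>\<xi>\<in>carrier H. c \<odot>\<^bsub>H\<^esub> T \<xi>)"
  "star (bounded_op_alg H) = adjoint_op H H"
  by (simp_all add: bounded_op_alg_def)

lemma Linf_alg_simps:
  "carrier (Linf_alg M H) = Linf_class M H ` ess_bounded_op_funs M H"
  "a \<otimes>\<^bsub>Linf_alg M H\<^esub> b = (\<Union>F\<in>a. \<Union>G\<in>b. Linf_class M H (\<lambda>x. compose (carrier H) (F x) (G x)))"
  "\<one>\<^bsub>Linf_alg M H\<^esub> = Linf_class M H (\<lambda>_. \<lambda>\<xi>\<in>carrier H. \<xi>)"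
  "\<zero>\<^bsub>Linf_alg M H\<^esub> = Linf_class M H (\<lambda>_. \<lambda>\<xi>\<in>carrier H. \<zero>\<^bsub>H\<^esub>)"
  "a \<oplus>\<^bsub>Linf_alg M H\<^esub> b = (\<Union>F\<in>a. \<Union>G\<in>b. Linf_class M H (\<lambda>x. \<lambda>\<xi>\<in>carrier H. F x \<xi> \<oplus>\<^bsub>H\<^esub> G x \<xi>))"
  "c \<odot>\<^bsub>Linf_alg M H\<^esub> a = (\<Union>F\<in>a. Linf_class M H (\<lambda>x. \<lambda>\<xi>\<in>carrier H. c \<odot>\<^bsub>H\<^esub> F x \<xi>))"
  "star (Linf_alg M H) a = (\<Union>F\<in>a. Linf_class M H (\<lambda>x. adjoint_op H H (F x)))"
  by (simp_all add: Linf_alg_def)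

lemma Linf_class_cong: "(AE x in M. F x = G x) \<Longrightarrow> Linf_class M H F = Linf_class M H G"
proof -
  assume *: "AE x in M. F x = G x"
  have "(AE x in M. K x = F x) \<longleftrightarrow> (AE x in M. K x = G x)" for K
  proof
    show "AE x in M. K x = G x" if "AE x in M. K x = F x" using that * by eventually_elim simp
    show "AE x in M. K x = F x" if "AE x in M. K x = G x" using that * by eventually_elim simp
  qed
  then show ?thesis by (simp add: Linf_class_def)
qed

lemma Linf_classD: "G \<in> Linf_class M H F \<Longrightarrow> G \<in> ess_bounded_op_funs M H"
  "G \<in> Linf_class M H F \<Longrightarrow> AE x in M. G x = F x"
  by (auto simp: Linf_class_def)

lemma Linf_class_self: "F \<in> ess_bounded_op_funs M H \<Longrightarrow> F \<in> Linf_class M H F"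
  by (auto simp: Linf_class_def)

lemma Linf_class_eq_iff:
  "F \<in> ess_bounded_op_funs M H \<Longrightarrow> Linf_class M H F = Linf_class M H G \<longleftrightarrow> (AE x in M. F x = G x)"
  using Linf_class_cong Linf_class_self Linf_classD(2) by metis

text \<open>Collapses the unions over representatives that define the operations of
  \<open>Linf_alg\<close>, once the class of the result is seen not to depend on them.\<close>

lemma UN_const: "x \<in> A \<Longrightarrow> (\<And>y. y \<in> A \<Longrightarrow> f y = L) \<Longrightarrow> (\<Union>y\<in>A. f y) = L"
  by auto

lemma Linf_mult_class:
  assumes "F \<in> ess_bounded_op_funs M H" "G \<in> ess_bounded_op_funs M H"
  shows "Linf_class M H F \<otimes>\<^bsub>Linf_alg M H\<^esub> Linf_class M H G = Linf_class M H (\<lambda>x. compose (carrier H) (F x) (G x))"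
proof -
  have "Linf_class M H (\<lambda>x. compose (carrier H) (F' x) (G' x)) = Linf_class M H (\<lambda>x. compose (carrier H) (F x) (G x))"
    if "F' \<in> Linf_class M H F" "G' \<in> Linf_class M H G" for F' G'
  proof (rule Linf_class_cong)
    show "AE x in M. (compose (carrier H) (F' x) (G' x)) = (compose (carrier H) (F x) (G x))"
      using Linf_classD(2)[OF that(1)] Linf_classD(2)[OF that(2)] by eventually_elim simp
  qed
  then show ?thesis unfolding Linf_alg_simps
    by (intro UN_const[OF Linf_class_self[OF assms(1)]] UN_const[OF Linf_class_self[OF assms(2)]])
qed

lemma Linf_add_class:
  assumes "F \<in> ess_bounded_op_funs M H" "G \<in> ess_bounded_op_funs M H"
  shows "Linf_class M H F \<oplus>\<^bsub>Linf_alg M H\<^esub> Linf_class M H G = Linf_class M H (\<lambda>x. \<lambda>\<xi>\<in>carrier H. F x \<xi> \<oplus>\<^bsub>H\<^esub> G x \<xi>)"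
proof -
  have "Linf_class M H (\<lambda>x. \<lambda>\<xi>\<in>carrier H. F' x \<xi> \<oplus>\<^bsub>H\<^esub> G' x \<xi>) = Linf_class M H (\<lambda>x. \<lambda>\<xi>\<in>carrier H. F x \<xi> \<oplus>\<^bsub>H\<^esub> G x \<xi>)"
    if "F' \<in> Linf_class M H F" "G' \<in> Linf_class M H G" for F' G'
  proof (rule Linf_class_cong)
    show "AE x in M. (\<lambda>\<xi>\<in>carrier H. F' x \<xi> \<oplus>\<^bsub>H\<^esub> G' x \<xi>) = (\<lambda>\<xi>\<in>carrier H. F x \<xi> \<oplus>\<^bsub>H\<^esub> G x \<xi>)"
      using Linf_classD(2)[OF that(1)] Linf_classD(2)[OF that(2)] by eventually_elim simp
  qed
  then show ?thesis unfolding Linf_alg_simps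
    by (intro UN_const[OF Linf_class_self[OF assms(1)]] UN_const[OF Linf_class_self[OF assms(2)]])
qed

lemma Linf_smult_class:
  assumes "F \<in> ess_bounded_op_funs M H"
  shows "c \<odot>\<^bsub>Linf_alg M H\<^esub> Linf_class M H F = Linf_class M H (\<lambda>x. \<lambda>\<xi>\<in>carrier H. c \<odot>\<^bsub>H\<^esub> F x \<xi>)"
proof -
  have "Linf_class M H (\<lambda>x. \<lambda>\<xi>\<in>carrier H. c \<odot>\<^bsub>H\<^esub> F' x \<xi>) = Linf_class M H (\<lambda>x. \<lambda>\<xi>\<in>carrier H. c \<odot>\<^bsub>H\<^esub> F x \<xi>)"
    if "F' \<in> Linf_class M H F" for F'
  proof (rule Linf_class_cong)
    show "AE x in M. (\<lambda>\<xi>\<in>carrier H. c \<odot>\<^bsub>H\<^esub> F' x \<xi>) = (\<lambda>\<xi>\<in>carrier H. c \<odot>\<^bsub>H\<^esub> F x \<xi>)"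
      using Linf_classD(2)[OF that(1)] by eventually_elim simp
  qed
  then show ?thesis unfolding Linf_alg_simps by (intro UN_const[OF Linf_class_self[OF assms(1)]])
qed

lemma Linf_star_class:
  assumes "F \<in> ess_bounded_op_funs M H"
  shows "star (Linf_alg M H) (Linf_class M H F) = Linf_class M H (\<lambda>x. adjoint_op H H (F x))"
proof -
  have "Linf_class M H (\<lambda>x. adjoint_op H H (F' x)) = Linf_class M H (\<lambda>x. adjoint_op H H (F x))"
    if "F' \<in> Linf_class M H F" for F'
  proof (rule Linf_class_cong)
    show "AE x in M. (adjoint_op H H (F' x)) = (adjoint_op H H (F x))"
      using Linf_classD(2)[OF that(1)] by eventually_elim simp
  qed
  then show ?thesis unfolding Linf_alg_simps by (intro UN_const[OF Linf_class_self[OF assms(1)]])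
qed

section \<open>Closure of the essentially bounded operator functions under the algebra
  operations\<close>

context separable_hilbert_space
begin

lemma add_in_bounded_ops:
  assumes "S \<in> bounded_ops H H" "T \<in> bounded_ops H H"
  shows "(\<lambda>\<xi>\<in>carrier H. S \<xi> \<oplus> T \<xi>) \<in> bounded_ops H H"
proof -
  obtain C D where C: "\<forall>\<xi>\<in>carrier H. ip_norm H (S \<xi>) \<le> C * ip_norm H \<xi>" "\<forall>\<xi>\<in>carrier H. ip_norm H (T \<xi>) \<le> D * ip_norm H \<xi>"
    using bounded_opsD(5)[OF assms(1)] bounded_opsD(5)[OF assms(2)] by blast
  note S = bounded_opsD[OF assms(1)] and T = bounded_opsD[OF assms(2)]
  show ?thesis
  proof (rule bounded_opsI)
    show "ip_norm H ((\<lambda>\<xi>\<in>carrier H. S \<xi> \<oplus> T \<xi>) \<xi>) \<le> (C + D) * ip_norm H \<xi>" if "\<xi> \<in> carrier H" for \<xi>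
    proof -
      have "ip_norm H (S \<xi> \<oplus> T \<xi>) \<le> ip_norm H (S \<xi>) + ip_norm H (T \<xi>)"
        using that S(1) T(1) by (intro ip_norm_add)
      also have "\<dots> \<le> C * ip_norm H \<xi> + D * ip_norm H \<xi>" using C that by (intro add_mono) auto
      finally show ?thesis using that by (simp add: algebra_simps)
    qed
    show "(\<lambda>\<xi>\<in>carrier H. S \<xi> \<oplus> T \<xi>) (\<xi> \<oplus> \<eta>) = (\<lambda>\<xi>\<in>carrier H. S \<xi> \<oplus> T \<xi>) \<xi> \<oplus> (\<lambda>\<xi>\<in>carrier H. S \<xi> \<oplus> T \<xi>) \<eta>"
      if "\<xi> \<in> carrier H" "\<eta> \<in> carrier H" for \<xi> \<eta>
      using that S(1) T(1) by (simp add: S(2) T(2)) (intro ip_eqI; simp add: ip_add)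
    show "(\<lambda>\<xi>\<in>carrier H. S \<xi> \<oplus> T \<xi>) (c \<odot> \<xi>) = c \<odot> (\<lambda>\<xi>\<in>carrier H. S \<xi> \<oplus> T \<xi>) \<xi>"
      if "\<xi> \<in> carrier H" for c \<xi>
      using that S(1) T(1) by (simp add: S(3) T(3)) (intro ip_eqI; simp add: ip_add ip_smult algebra_simps)
  qed (use S(1) T(1) in auto)
qed

lemma compose_in_bounded_ops:
  assumes "S \<in> bounded_ops H H" "T \<in> bounded_ops H H"
  shows "compose (carrier H) S T \<in> bounded_ops H H"
proof -
  obtain C D where C: "\<forall>\<xi>\<in>carrier H. ip_norm H (S \<xi>) \<le> C * ip_norm H \<xi>" "\<forall>\<xi>\<in>carrier H. ip_norm H (T \<xi>) \<le> D * ip_norm H \<xi>"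
    using bounded_opsD(5)[OF assms(1)] bounded_opsD(5)[OF assms(2)] by blast
  note S = bounded_opsD[OF assms(1)] and T = bounded_opsD[OF assms(2)]
  show ?thesis
  proof (rule bounded_opsI)
    show "ip_norm H (compose (carrier H) S T \<xi>) \<le> (\<bar>C\<bar> * D) * ip_norm H \<xi>" if "\<xi> \<in> carrier H" for \<xi>
    proof -
      have "ip_norm H (S (T \<xi>)) \<le> C * ip_norm H (T \<xi>)" using C that T(1) by auto
      also have "\<dots> \<le> \<bar>C\<bar> * ip_norm H (T \<xi>)" using that T(1) by (intro mult_right_mono) auto
      also have "\<dots> \<le> \<bar>C\<bar> * (D * ip_norm H \<xi>)" using C that by (intro mult_left_mono) auto
      finally show ?thesis using that by (simp add: algebra_simps compose_eq)
    qed
  qed (use S(1-3) T(1-3) in \<open>auto simp: compose_eq compose_extensional\<close>)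
qed

lemma zero_in_bounded_ops: "(\<lambda>\<xi>\<in>carrier H. \<zero>) \<in> bounded_ops H H"
  by (rule bounded_opsI[where C = 1]) (auto simp: ip_norm_zero_iff[THEN iffD2] intro!: ip_eqI simp: ip_smult)

lemma ess_boundedD:
  assumes "F \<in> ess_bounded_op_funs M H"
  shows "x \<in> space M \<Longrightarrow> F x \<in> bounded_ops H H"
    and "\<xi> \<in> carrier H \<Longrightarrow> \<eta> \<in> carrier H \<Longrightarrow> (\<lambda>x. ip H (F x \<xi>) \<eta>) \<in> borel_measurable (completion M)"
    and "\<exists>C. AE x in M. \<forall>\<xi>\<in>carrier H. ip_norm H (F x \<xi>) \<le> C * ip_norm H \<xi>"
    and "x \<in> space M \<Longrightarrow> \<xi> \<in> carrier H \<Longrightarrow> F x \<xi> \<in> carrier H"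
  using assms by (auto simp: ess_bounded_op_funs_def dest: bounded_opsD(1))

lemma ess_boundedI:
  assumes "\<And>x. x \<in> space M \<Longrightarrow> F x \<in> bounded_ops H H"
    and "\<And>\<xi> \<eta>. \<xi> \<in> carrier H \<Longrightarrow> \<eta> \<in> carrier H \<Longrightarrow> (\<lambda>x. ip H (F x \<xi>) \<eta>) \<in> borel_measurable (completion M)"
    and "AE x in M. \<forall>\<xi>\<in>carrier H. ip_norm H (F x \<xi>) \<le> C * ip_norm H \<xi>"
  shows "F \<in> ess_bounded_op_funs M H"
  using assms by (auto simp: ess_bounded_op_funs_def)

lemma measurable_completion_cong:
  assumes "\<And>x. x \<in> space M \<Longrightarrow> f x = g x" "g \<in> borel_measurable (completion M)"
  shows "f \<in> borel_measurable (completion M)"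
proof -
  have "f \<in> borel_measurable (completion M) \<longleftrightarrow> g \<in> borel_measurable (completion M)"
    by (rule measurable_cong) (simp add: assms(1))
  then show ?thesis using assms(2) by simp
qed

lemma ess_add:
  assumes F: "F \<in> ess_bounded_op_funs M H" and G: "G \<in> ess_bounded_op_funs M H"
  shows "(\<lambda>x. \<lambda>\<xi>\<in>carrier H. F x \<xi> \<oplus> G x \<xi>) \<in> ess_bounded_op_funs M H"
proof -
  obtain C D where CD: "AE x in M. \<forall>\<xi>\<in>carrier H. ip_norm H (F x \<xi>) \<le> C * ip_norm H \<xi>"
    "AE x in M. \<forall>\<xi>\<in>carrier H. ip_norm H (G x \<xi>) \<le> D * ip_norm H \<xi>"
    using ess_boundedD(3)[OF F] ess_boundedD(3)[OF G] by blast
  show ?thesis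
  proof (rule ess_boundedI)
    show "AE x in M. \<forall>\<xi>\<in>carrier H. ip_norm H ((\<lambda>\<xi>\<in>carrier H. F x \<xi> \<oplus> G x \<xi>) \<xi>) \<le> (C + D) * ip_norm H \<xi>"
      using CD AE_space
    proof eventually_elim
      case (elim x)
      show ?case
      proof
        fix \<xi> assume x: "\<xi> \<in> carrier H"
        have "ip_norm H (F x \<xi> \<oplus> G x \<xi>) \<le> ip_norm H (F x \<xi>) + ip_norm H (G x \<xi>)"
          using x elim(3) ess_boundedD(4)[OF F] ess_boundedD(4)[OF G] by (intro ip_norm_add) auto
        also have "\<dots> \<le> C * ip_norm H \<xi> + D * ip_norm H \<xi>" using elim x by (intro add_mono) auto
        finally show "ip_norm H ((\<lambda>\<xi>\<in>carrier H. F x \<xi> \<oplus> G x \<xi>) \<xi>) \<le> (C + D) * ip_norm H \<xi>"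
          using x by (simp add: algebra_simps)
      qed
    qed
    show "(\<lambda>x. ip H ((\<lambda>\<xi>\<in>carrier H. F x \<xi> \<oplus> G x \<xi>) \<xi>) \<eta>) \<in> borel_measurable (completion M)"
      if "\<xi> \<in> carrier H" "\<eta> \<in> carrier H" for \<xi> \<eta>
      by (rule measurable_completion_cong[where g = "\<lambda>x. ip H (F x \<xi>) \<eta> + ip H (G x \<xi>) \<eta>"])
         (use that ess_boundedD(4)[OF F] ess_boundedD(4)[OF G] ess_boundedD(2)[OF F] ess_boundedD(2)[OF G] in \<open>auto simp: ip_add\<close>)
  qed (use ess_boundedD(1)[OF F] ess_boundedD(1)[OF G] add_in_bounded_ops in auto)
qed

lemma ess_mult:
  assumes F: "F \<in> ess_bounded_op_funs M H" and G: "G \<in> ess_bounded_op_funs M H"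
  shows "(\<lambda>x. compose (carrier H) (F x) (G x)) \<in> ess_bounded_op_funs M H"
proof -
  obtain C D where CD: "AE x in M. \<forall>\<xi>\<in>carrier H. ip_norm H (F x \<xi>) \<le> C * ip_norm H \<xi>"
    "AE x in M. \<forall>\<xi>\<in>carrier H. ip_norm H (G x \<xi>) \<le> D * ip_norm H \<xi>"
    using ess_boundedD(3)[OF F] ess_boundedD(3)[OF G] by blast
  show ?thesis
  proof (rule ess_boundedI)
    show "AE x in M. \<forall>\<xi>\<in>carrier H. ip_norm H (compose (carrier H) (F x) (G x) \<xi>) \<le> (\<bar>C\<bar> * D) * ip_norm H \<xi>"
      using CD AE_space
    proof eventually_elim
      case (elim x)
      show ?case
      proof
        fix \<xi> assume x: "\<xi> \<in> carrier H"
        have g: "G x \<xi> \<in> carrier H" using x elim(3) ess_boundedD(4)[OF G] by auto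
        have "ip_norm H (F x (G x \<xi>)) \<le> C * ip_norm H (G x \<xi>)" using elim(1) g by auto
        also have "\<dots> \<le> \<bar>C\<bar> * ip_norm H (G x \<xi>)" using g by (intro mult_right_mono) auto
        also have "\<dots> \<le> \<bar>C\<bar> * (D * ip_norm H \<xi>)" using elim x by (intro mult_left_mono) auto
        finally show "ip_norm H (compose (carrier H) (F x) (G x) \<xi>) \<le> (\<bar>C\<bar> * D) * ip_norm H \<xi>"
          using x by (simp add: algebra_simps compose_eq)
      qed
    qed
    show "(\<lambda>x. ip H (compose (carrier H) (F x) (G x) \<xi>) \<eta>) \<in> borel_measurable (completion M)"
      if xe: "\<xi> \<in> carrier H" "\<eta> \<in> carrier H" for \<xi> \<eta>
    \<comment> \<open>In the product both the operator and its argument move with the point. Moving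
      \<open>F x\<close> to the other side and expanding in the fixed frame leaves a series of
      products of weakly measurable functions.\<close>
    proof (rule measurable_completion_cong[where g = "\<lambda>x. \<Sum>k. ip H (G x \<xi>) (frame k) * ip H (F x (frame k)) \<eta>"])
      fix x assume x: "x \<in> space M"
      have T: "F x \<in> bounded_ops H H" using ess_boundedD(1)[OF F x] .
      have g: "G x \<xi> \<in> carrier H" using x xe ess_boundedD(4)[OF G] by auto
      have "ip H (F x (G x \<xi>)) \<eta> = ip H (G x \<xi>) (adjoint_op H H (F x) \<eta>)" using adjoint_op(2)[OF T g xe(2)] .
      also have "\<dots> = (\<Sum>k. ip H (G x \<xi>) (frame k) * ip H (frame k) (adjoint_op H H (F x) \<eta>))"
        using parseval[OF g adjoint_op(1)[OF T xe(2)]] by (simp add: sums_iff)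
      also have "\<dots> = (\<Sum>k. ip H (G x \<xi>) (frame k) * ip H (F x (frame k)) \<eta>)"
        by (simp add: adjoint_op(2)[OF T frame(1) xe(2)])
      finally show "ip H (compose (carrier H) (F x) (G x) \<xi>) \<eta> = (\<Sum>k. ip H (G x \<xi>) (frame k) * ip H (F x (frame k)) \<eta>)"
        using xe by (simp add: compose_eq)
    next
      show "(\<lambda>x. \<Sum>k. ip H (G x \<xi>) (frame k) * ip H (F x (frame k)) \<eta>) \<in> borel_measurable (completion M)"
        by (intro borel_measurable_suminf borel_measurable_times ess_boundedD(2)[OF F] ess_boundedD(2)[OF G] xe frame(1))
    qed
  qed (use ess_boundedD(1)[OF F] ess_boundedD(1)[OF G] compose_in_bounded_ops in auto)
qed

lemma ess_star:
  assumes F: "F \<in> ess_bounded_op_funs M H"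
  shows "(\<lambda>x. adjoint_op H H (F x)) \<in> ess_bounded_op_funs M H"
proof -
  obtain C where C: "AE x in M. \<forall>\<xi>\<in>carrier H. ip_norm H (F x \<xi>) \<le> C * ip_norm H \<xi>"
    using ess_boundedD(3)[OF F] by blast
  show ?thesis
  proof (rule ess_boundedI)
    show "AE x in M. \<forall>\<xi>\<in>carrier H. ip_norm H (adjoint_op H H (F x) \<xi>) \<le> C * ip_norm H \<xi>"
      using C AE_space by eventually_elim (use adjoint_op_bound ess_boundedD(1)[OF F] in blast)
    show "(\<lambda>x. ip H (adjoint_op H H (F x) \<xi>) \<eta>) \<in> borel_measurable (completion M)"
      if xe: "\<xi> \<in> carrier H" "\<eta> \<in> carrier H" for \<xi> \<eta>
    proof (rule measurable_completion_cong[where g = "\<lambda>x. cnj (ip H (F x \<eta>) \<xi>)"])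
      show "ip H (adjoint_op H H (F x) \<xi>) \<eta> = cnj (ip H (F x \<eta>) \<xi>)" if x: "x \<in> space M" for x
      proof -
        have T: "F x \<in> bounded_ops H H" using ess_boundedD(1)[OF F x] .
        show ?thesis using adjoint_op[OF T] xe ip_cnj by metis
      qed
      have "(\<lambda>x. cnj (ip H (F x \<eta>) \<xi>)) = cnj \<circ> (\<lambda>x. ip H (F x \<eta>) \<xi>)" by auto
      also have "\<dots> \<in> borel_measurable (completion M)"
        by (rule measurable_comp[OF ess_boundedD(2)[OF F xe(2,1)]]) (intro borel_measurable_continuous_onI continuous_intros)
      finally show "(\<lambda>x. cnj (ip H (F x \<eta>) \<xi>)) \<in> borel_measurable (completion M)" .
    qed
  qed (use ess_boundedD(1)[OF F] adjoint_op_in in auto)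
qed

lemma ess_zero: "(\<lambda>x. \<lambda>\<xi>\<in>carrier H. \<zero>) \<in> ess_bounded_op_funs M H"
  by (rule ess_boundedI[where C = 1]) (auto simp: zero_in_bounded_ops ip_norm_zero_iff[THEN iffD2])

text \<open>The matrix product is defined through finite sums in the algebra, which can only be
  evaluated in a commutative monoid.\<close>

lemma abelian_monoid_Linf: "abelian_monoid (Linf_alg M H)"
proof (rule abelian_monoidI)
  show "\<zero>\<^bsub>Linf_alg M H\<^esub> \<in> carrier (Linf_alg M H)" by (simp add: Linf_alg_simps ess_zero)
next
  fix a b assume "a \<in> carrier (Linf_alg M H)" "b \<in> carrier (Linf_alg M H)"
  then obtain F G where *: "F \<in> ess_bounded_op_funs M H" "a = Linf_class M H F"
      "G \<in> ess_bounded_op_funs M H" "b = Linf_class M H G" by (auto simp: Linf_alg_simps)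
  then show "a \<oplus>\<^bsub>Linf_alg M H\<^esub> b \<in> carrier (Linf_alg M H)"
    by (simp add: Linf_add_class) (simp add: Linf_alg_simps(1) ess_add)
  show "a \<oplus>\<^bsub>Linf_alg M H\<^esub> b = b \<oplus>\<^bsub>Linf_alg M H\<^esub> a"
    unfolding *(2,4) Linf_add_class[OF *(1,3)] Linf_add_class[OF *(3,1)]
    by (rule Linf_class_cong, rule AE_I2)
       (use ess_boundedD(4)[OF *(1)] ess_boundedD(4)[OF *(3)] in \<open>auto simp: M.a_comm intro!: restrict_ext\<close>)
  fix c assume "c \<in> carrier (Linf_alg M H)"
  then obtain E where c: "E \<in> ess_bounded_op_funs M H" "c = Linf_class M H E" by (auto simp: Linf_alg_simps)
  show "a \<oplus>\<^bsub>Linf_alg M H\<^esub> b \<oplus>\<^bsub>Linf_alg M H\<^esub> c = a \<oplus>\<^bsub>Linf_alg M H\<^esub> (b \<oplus>\<^bsub>Linf_alg M H\<^esub> c)"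
    unfolding *(2,4) c(2) Linf_add_class[OF *(1,3)] Linf_add_class[OF *(3) c(1)]
      Linf_add_class[OF ess_add[OF *(1,3)] c(1)] Linf_add_class[OF *(1) ess_add[OF *(3) c(1)]]
    by (rule Linf_class_cong, rule AE_I2)
       (use ess_boundedD(4)[OF *(1)] ess_boundedD(4)[OF *(3)] ess_boundedD(4)[OF c(1)] in \<open>auto simp: M.a_assoc intro!: restrict_ext\<close>)
next
  fix a assume "a \<in> carrier (Linf_alg M H)"
  then obtain F where *: "F \<in> ess_bounded_op_funs M H" "a = Linf_class M H F" by (auto simp: Linf_alg_simps)
  have "AE x in M. (\<lambda>\<xi>\<in>carrier H. (\<lambda>\<xi>\<in>carrier H. \<zero>) \<xi> \<oplus> F x \<xi>) = F x"
  proof (rule AE_I2)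
    fix x assume x: "x \<in> space M"
    show "(\<lambda>\<xi>\<in>carrier H. (\<lambda>\<xi>\<in>carrier H. \<zero>) \<xi> \<oplus> F x \<xi>) = F x"
      by (rule extensionalityI[OF restrict_extensional bounded_opsD(4)[OF ess_boundedD(1)[OF *(1) x]]])
         (use ess_boundedD(4)[OF *(1) x] in auto)
  qed
  then show "\<zero>\<^bsub>Linf_alg M H\<^esub> \<oplus>\<^bsub>Linf_alg M H\<^esub> a = a"
    unfolding *(2) Linf_alg_simps(4) Linf_add_class[OF ess_zero *(1)] by (rule Linf_class_cong)
qed

text \<open>Turns a sum of classes into a sum of numbers at every point, the form in which an entry
  of a matrix product is used.\<close>

lemma Linf_finsum:
  assumes "finite J" "\<And>k. k \<in> J \<Longrightarrow> \<beta> k \<in> ess_bounded_op_funs M H"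
  shows "\<exists>F\<in>ess_bounded_op_funs M H. (\<Oplus>\<^bsub>Linf_alg M H\<^esub>k\<in>J. Linf_class M H (\<beta> k)) = Linf_class M H F \<and>
     (\<forall>x\<in>space M. \<forall>\<xi>\<in>carrier H. \<forall>\<eta>\<in>carrier H. ip H (F x \<xi>) \<eta> = (\<Sum>k\<in>J. ip H (\<beta> k x \<xi>) \<eta>))"
  using assms
proof (induction J)
  case empty
  interpret L: abelian_monoid "Linf_alg M H" by (rule abelian_monoid_Linf)
  show ?case
  proof (intro bexI conjI ballI)
    show "(\<Oplus>\<^bsub>Linf_alg M H\<^esub>k\<in>{}. Linf_class M H (\<beta> k)) = Linf_class M H (\<lambda>_. \<lambda>\<xi>\<in>carrier H. \<zero>)"
      unfolding L.finsum_empty Linf_alg_simps(4) ..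
    show "(\<lambda>_. \<lambda>\<xi>\<in>carrier H. \<zero>) \<in> ess_bounded_op_funs M H" by (rule ess_zero)
  qed simp
next
  case (insert j J)
  interpret L: abelian_monoid "Linf_alg M H" by (rule abelian_monoid_Linf)
  obtain F where F: "F \<in> ess_bounded_op_funs M H" "(\<Oplus>\<^bsub>Linf_alg M H\<^esub>k\<in>J. Linf_class M H (\<beta> k)) = Linf_class M H F"
    "\<And>x \<xi> \<eta>. x \<in> space M \<Longrightarrow> \<xi> \<in> carrier H \<Longrightarrow> \<eta> \<in> carrier H \<Longrightarrow> ip H (F x \<xi>) \<eta> = (\<Sum>k\<in>J. ip H (\<beta> k x \<xi>) \<eta>)"
    using insert by auto
  have j: "\<beta> j \<in> ess_bounded_op_funs M H" using insert.prems by auto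
  have "(\<Oplus>\<^bsub>Linf_alg M H\<^esub>k\<in>insert j J. Linf_class M H (\<beta> k)) = Linf_class M H (\<beta> j) \<oplus>\<^bsub>Linf_alg M H\<^esub> Linf_class M H F"
    unfolding F(2)[symmetric]
    by (rule L.finsum_insert) (use insert in \<open>auto simp: Linf_alg_simps\<close>)
  also have "\<dots> = Linf_class M H (\<lambda>x. \<lambda>\<xi>\<in>carrier H. \<beta> j x \<xi> \<oplus> F x \<xi>)" by (rule Linf_add_class[OF j F(1)])
  finally have eq: "(\<Oplus>\<^bsub>Linf_alg M H\<^esub>k\<in>insert j J. Linf_class M H (\<beta> k))
      = Linf_class M H (\<lambda>x. \<lambda>\<xi>\<in>carrier H. \<beta> j x \<xi> \<oplus> F x \<xi>)" .
  show ?case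
  proof (intro bexI[OF _ ess_add[OF j F(1)]] conjI ballI)
    show "ip H ((\<lambda>\<xi>\<in>carrier H. \<beta> j x \<xi> \<oplus> F x \<xi>) \<xi>) \<eta> = (\<Sum>k\<in>insert j J. ip H (\<beta> k x \<xi>) \<eta>)"
      if "x \<in> space M" "\<xi> \<in> carrier H" "\<eta> \<in> carrier H" for x \<xi> \<eta>
      using that insert.hyps ess_boundedD(4)[OF j] ess_boundedD(4)[OF F(1)] by (simp add: ip_add F(3))
  qed (rule eq)
qed

end

lemma continuous_fun_alg_simps:
  "carrier continuous_fun_alg = {u. continuous_on UNIV u}"
  "mult continuous_fun_alg = (\<lambda>u v x. u x * v x)"
  "\<one>\<^bsub>continuous_fun_alg\<^esub> = (\<lambda>_. 1)"
  "\<zero>\<^bsub>continuous_fun_alg\<^esub> = (\<lambda>_. 0)"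
  "add continuous_fun_alg = (\<lambda>u v x. u x + v x)"
  "smult continuous_fun_alg = (\<lambda>c u x. c * u x)"
  "star continuous_fun_alg = (\<lambda>u x. cnj (u x))"
  by (simp_all add: continuous_fun_alg_def)

lemma abelian_monoid_continuous_fun:
  "abelian_monoid (continuous_fun_alg :: ('a :: topological_space \<Rightarrow> complex) star_algebra)"
  by (rule abelian_monoidI) (auto simp: continuous_fun_alg_simps add.assoc add.commute intro!: continuous_intros)

lemma continuous_fun_finsum:
  fixes u :: "'k \<Rightarrow> 'a :: topological_space \<Rightarrow> complex"
  assumes "finite J" "\<And>k. k \<in> J \<Longrightarrow> continuous_on UNIV (u k)"
  shows "(\<Oplus>\<^bsub>continuous_fun_alg\<^esub>k\<in>J. u k) = (\<lambda>x. \<Sum>k\<in>J. u k x)"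
proof -
  interpret C: abelian_monoid "continuous_fun_alg :: ('a \<Rightarrow> complex) star_algebra"
    by (rule abelian_monoid_continuous_fun)
  show ?thesis using assms
  proof (induction J)
    case (insert j J)
    have "(\<Oplus>\<^bsub>continuous_fun_alg\<^esub>k\<in>insert j J. u k) = u j \<oplus>\<^bsub>continuous_fun_alg\<^esub> (\<Oplus>\<^bsub>continuous_fun_alg\<^esub>k\<in>J. u k)"
      by (rule C.finsum_insert) (use insert in \<open>auto simp: continuous_fun_alg_simps\<close>)
    then show ?case using insert by (simp add: continuous_fun_alg_simps)
  qed (simp add: continuous_fun_alg_simps)
qed

section \<open>Representatives of a completely positive map\<close>

locale ucp_map = separable_hilbert_space H for H :: "('h, 'm) inner_prod_space_scheme" (structure) +
  fixes \<mu> :: "'x measure" and \<phi> :: "('a :: topological_space \<Rightarrow> complex) \<Rightarrow> ('x \<Rightarrow> 'h \<Rightarrow> 'h) set"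
  assumes ucp: "unital_completely_positive continuous_fun_alg (Linf_alg \<mu> H) \<phi>"
begin

text \<open>One representative per function, fixed once. The fibre map sending \<open>u\<close> to
  \<open>rep u x\<close> is linear and positive only up to null sets that depend on the functions
  compared.\<close>

definition rep :: "('a \<Rightarrow> complex) \<Rightarrow> 'x \<Rightarrow> 'h \<Rightarrow> 'h" where
  "rep u = (SOME F. F \<in> ess_bounded_op_funs \<mu> H \<and> \<phi> u = Linf_class \<mu> H F)"

lemma rep:
  assumes "continuous_on UNIV u"
  shows "rep u \<in> ess_bounded_op_funs \<mu> H" "\<phi> u = Linf_class \<mu> H (rep u)"
proof -
  have "\<phi> u \<in> carrier (Linf_alg \<mu> H)"
    using ucp assms unfolding unital_completely_positive_def completely_positive_def
    by (auto simp: continuous_fun_alg_simps)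
  then have "\<exists>F. F \<in> ess_bounded_op_funs \<mu> H \<and> \<phi> u = Linf_class \<mu> H F" by (auto simp: Linf_alg_simps)
  from someI_ex[OF this] show "rep u \<in> ess_bounded_op_funs \<mu> H" "\<phi> u = Linf_class \<mu> H (rep u)"
    by (auto simp: rep_def)
qed

text \<open>The Stinespring form of the fibre at \<open>x\<close>, evaluated on the sum of the
  \<open>v i \<otimes> \<xi> i\<close>.\<close>

abbreviation gform :: "'x \<Rightarrow> nat \<Rightarrow> (nat \<Rightarrow> 'a \<Rightarrow> complex) \<Rightarrow> (nat \<Rightarrow> 'h) \<Rightarrow> complex" where
  "gform x n v \<xi> \<equiv> \<Sum>i<n. \<Sum>j<n. ip H (rep (\<lambda>a. cnj (v i a) * v j a) x (\<xi> j)) (\<xi> i)"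

lemma rep_in: "continuous_on UNIV u \<Longrightarrow> x \<in> space \<mu> \<Longrightarrow> \<xi> \<in> carrier H \<Longrightarrow> rep u x \<xi> \<in> carrier H"
  using ess_boundedD(4)[OF rep(1)] .

lemma rep_eq_AE: "continuous_on UNIV u \<Longrightarrow> F \<in> \<phi> u \<Longrightarrow> AE x in \<mu>. F x = rep u x"
  using rep(2) Linf_classD(2) by metis

lemma rep_add:
  assumes "continuous_on UNIV u" "continuous_on UNIV v"
  shows "AE x in \<mu>. \<forall>\<xi>\<in>carrier H. rep (\<lambda>a. u a + v a) x \<xi> = rep u x \<xi> \<oplus> rep v x \<xi>"
proof -
  have uv: "continuous_on UNIV (\<lambda>a. u a + v a)" using assms by (intro continuous_intros)
  have "\<phi> (u \<oplus>\<^bsub>continuous_fun_alg\<^esub> v) = \<phi> u \<oplus>\<^bsub>Linf_alg \<mu> H\<^esub> \<phi> v"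
    using ucp assms unfolding unital_completely_positive_def completely_positive_def
    by (auto simp: continuous_fun_alg_simps)
  then have "Linf_class \<mu> H (rep (\<lambda>a. u a + v a)) = Linf_class \<mu> H (\<lambda>x. \<lambda>\<xi>\<in>carrier H. rep u x \<xi> \<oplus> rep v x \<xi>)"
    using rep[OF assms(1)] rep[OF assms(2)] rep(2)[OF uv] by (simp add: continuous_fun_alg_simps Linf_add_class)
  then have "AE x in \<mu>. rep (\<lambda>a. u a + v a) x = (\<lambda>\<xi>\<in>carrier H. rep u x \<xi> \<oplus> rep v x \<xi>)"
    by (rule Linf_class_eq_iff[OF rep(1)[OF uv], THEN iffD1])
  then show ?thesis by eventually_elim auto
qed

lemma rep_smult:
  assumes "continuous_on UNIV u"
  shows "AE x in \<mu>. \<forall>\<xi>\<in>carrier H. rep (\<lambda>a. c * u a) x \<xi> = c \<odot> rep u x \<xi>"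
proof -
  have uv: "continuous_on UNIV (\<lambda>a. c * u a)" using assms by (intro continuous_intros)
  have "\<phi> (c \<odot>\<^bsub>continuous_fun_alg\<^esub> u) = c \<odot>\<^bsub>Linf_alg \<mu> H\<^esub> \<phi> u"
    using ucp assms unfolding unital_completely_positive_def completely_positive_def
    by (auto simp: continuous_fun_alg_simps)
  then have "Linf_class \<mu> H (rep (\<lambda>a. c * u a)) = Linf_class \<mu> H (\<lambda>x. \<lambda>\<xi>\<in>carrier H. c \<odot> rep u x \<xi>)"
    using rep[OF assms(1)] rep(2)[OF uv] by (simp add: continuous_fun_alg_simps Linf_smult_class)
  then have "AE x in \<mu>. rep (\<lambda>a. c * u a) x = (\<lambda>\<xi>\<in>carrier H. c \<odot> rep u x \<xi>)"
    by (rule Linf_class_eq_iff[OF rep(1)[OF uv], THEN iffD1])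
  then show ?thesis by eventually_elim auto
qed

lemma rep_one: "AE x in \<mu>. \<forall>\<xi>\<in>carrier H. rep (\<lambda>a. 1) x \<xi> = \<xi>"
proof -
  have c: "continuous_on UNIV (\<lambda>a::'a. 1 :: complex)" by (intro continuous_intros)
  have "\<phi> \<one>\<^bsub>continuous_fun_alg\<^esub> = \<one>\<^bsub>Linf_alg \<mu> H\<^esub>"
    using ucp unfolding unital_completely_positive_def by auto
  then have "Linf_class \<mu> H (rep (\<lambda>a. 1)) = Linf_class \<mu> H (\<lambda>_. \<lambda>\<xi>\<in>carrier H. \<xi>)"
    using rep(2)[OF c] by (simp add: continuous_fun_alg_simps Linf_alg_simps)
  then have "AE x in \<mu>. rep (\<lambda>a. 1) x = (\<lambda>\<xi>\<in>carrier H. \<xi>)"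
    by (rule Linf_class_eq_iff[OF rep(1)[OF c], THEN iffD1])
  then show ?thesis by eventually_elim auto
qed

text \<open>The matrix with entries \<open>cnj (v i) * v j\<close> is positive, so its image is some
  \<open>star B\<close> times \<open>B\<close>; the \<open>\<beta>\<close> represent the entries of
  \<open>B\<close>.\<close>

lemma rep_factor:
  fixes n :: nat
  assumes v: "\<And>i. i < n \<Longrightarrow> continuous_on UNIV (v i)"
  shows "\<exists>\<beta>. (\<forall>k<n. \<forall>j<n. \<beta> k j \<in> ess_bounded_op_funs \<mu> H) \<and>
    (\<forall>i<n. \<forall>j<n. AE x in \<mu>. \<forall>\<xi>\<in>carrier H. \<forall>\<eta>\<in>carrier H.
      ip H (rep (\<lambda>a. cnj (v i a) * v j a) x \<xi>) \<eta> = (\<Sum>k<n. ip H (\<beta> k j x \<xi>) (\<beta> k i x \<eta>)))"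
proof -
  let ?C = "continuous_fun_alg :: ('a \<Rightarrow> complex) star_algebra"
  let ?L = "Linf_alg \<mu> H"
  \<comment> \<open>The row \<open>v\<close> padded with zero rows to a square matrix, since
    positive elements are taken inside \<open>matrix_alg n\<close>.\<close>
  define b where "b = (\<lambda>(k, j)\<in>{..<n} \<times> {..<n}. if k = 0 then v j else (\<lambda>_. 0))"
  define P where "P = star (matrix_alg n ?C) b \<otimes>\<^bsub>matrix_alg n ?C\<^esub> b"
  have b: "b \<in> carrier (matrix_alg n ?C)"
    using v by (auto simp: matrix_alg_def b_def continuous_fun_alg_simps)
  have P: "P (i, j) = (\<lambda>a. cnj (v i a) * v j a)" if "i < n" "j < n" for i j
  proof -
    have "P (i, j) = (\<Oplus>\<^bsub>?C\<^esub>k\<in>{..<n}. (\<lambda>a. cnj (b (k, i) a) * b (k, j) a))"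
    proof -
      interpret C: abelian_monoid ?C by (rule abelian_monoid_continuous_fun)
      have "P (i, j) = (\<Oplus>\<^bsub>?C\<^esub>k\<in>{..<n}. (\<lambda>(i, j)\<in>{..<n} \<times> {..<n}. star ?C (b (j, i))) (i, k) \<otimes>\<^bsub>?C\<^esub> b (k, j))"
        using that by (simp add: P_def matrix_alg_def)
      also have "\<dots> = (\<Oplus>\<^bsub>?C\<^esub>k\<in>{..<n}. (\<lambda>a. cnj (b (k, i) a) * b (k, j) a))"
        using b that by (intro C.finsum_cong' refl)
          (auto simp: matrix_alg_def continuous_fun_alg_simps intro!: continuous_intros)
      finally show ?thesis .
    qed
    also have "\<dots> = (\<lambda>a. \<Sum>k<n. cnj (b (k, i) a) * b (k, j) a)"
      using b that by (intro continuous_fun_finsum)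
        (auto simp: matrix_alg_def continuous_fun_alg_simps intro!: continuous_intros)
    also have "\<dots> = (\<lambda>a. \<Sum>k<n. if k = 0 then cnj (v i a) * v j a else 0)"
      using that by (intro ext sum.cong) (auto simp: b_def)
    also have "\<dots> = (\<lambda>a. cnj (v i a) * v j a)" using that by (simp add: fun_eq_iff)
    finally show ?thesis .
  qed
  have "(\<lambda>p\<in>{..<n} \<times> {..<n}. \<phi> (P p)) \<in> positive_elems (matrix_alg n ?L)"
  proof -
    have "P \<in> positive_elems (matrix_alg n ?C)" using b by (auto simp: positive_elems_def P_def)
    then show ?thesis using ucp unfolding unital_completely_positive_def completely_positive_def by blast
  qed
  then obtain B where B: "B \<in> carrier (matrix_alg n ?L)"
    "(\<lambda>p\<in>{..<n} \<times> {..<n}. \<phi> (P p)) = star (matrix_alg n ?L) B \<otimes>\<^bsub>matrix_alg n ?L\<^esub> B"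
    by (auto simp: positive_elems_def)
  define \<beta> where "\<beta> k j = (SOME F. F \<in> ess_bounded_op_funs \<mu> H \<and> B (k, j) = Linf_class \<mu> H F)" for k j
  have \<beta>: "\<beta> k j \<in> ess_bounded_op_funs \<mu> H" "B (k, j) = Linf_class \<mu> H (\<beta> k j)" if "k < n" "j < n" for k j
  proof -
    have "B (k, j) \<in> carrier ?L" using B(1) that by (auto simp: matrix_alg_def)
    then have "\<exists>F. F \<in> ess_bounded_op_funs \<mu> H \<and> B (k, j) = Linf_class \<mu> H F" by (auto simp: Linf_alg_simps)
    from someI_ex[OF this] show "\<beta> k j \<in> ess_bounded_op_funs \<mu> H" "B (k, j) = Linf_class \<mu> H (\<beta> k j)"
      by (auto simp: \<beta>_def)
  qed
  have "AE x in \<mu>. \<forall>\<xi>\<in>carrier H. \<forall>\<eta>\<in>carrier H.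
      ip H (rep (\<lambda>a. cnj (v i a) * v j a) x \<xi>) \<eta> = (\<Sum>k<n. ip H (\<beta> k j x \<xi>) (\<beta> k i x \<eta>))"
    if ij: "i < n" "j < n" for i j
  proof -
    let ?\<gamma> = "\<lambda>k x. compose (carrier H) (adjoint_op H H (\<beta> k i x)) (\<beta> k j x)"
    have g: "?\<gamma> k \<in> ess_bounded_op_funs \<mu> H" if "k \<in> {..<n}" for k
      using that ij \<beta>(1) by (intro ess_mult ess_star) auto
    have "\<phi> (P (i, j)) = (star (matrix_alg n ?L) B \<otimes>\<^bsub>matrix_alg n ?L\<^esub> B) (i, j)"
      using ij by (simp flip: B(2))
    also have "\<dots> = (\<Oplus>\<^bsub>?L\<^esub>k\<in>{..<n}. (\<lambda>(i, j)\<in>{..<n} \<times> {..<n}. star ?L (B (j, i))) (i, k) \<otimes>\<^bsub>?L\<^esub> B (k, j))"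
      using ij by (simp add: matrix_alg_def)
    also have "\<dots> = (\<Oplus>\<^bsub>?L\<^esub>k\<in>{..<n}. Linf_class \<mu> H (?\<gamma> k))"
    proof -
      interpret L: abelian_monoid ?L by (rule abelian_monoid_Linf)
      show ?thesis
        using ij \<beta> g by (intro L.finsum_cong' refl)
          (auto simp: Linf_star_class ess_star Linf_mult_class, simp add: Linf_alg_simps(1))
    qed
    finally have 1: "\<phi> (P (i, j)) = (\<Oplus>\<^bsub>?L\<^esub>k\<in>{..<n}. Linf_class \<mu> H (?\<gamma> k))" .
    obtain F where F: "F \<in> ess_bounded_op_funs \<mu> H" "(\<Oplus>\<^bsub>?L\<^esub>k\<in>{..<n}. Linf_class \<mu> H (?\<gamma> k)) = Linf_class \<mu> H F"
      "\<forall>x\<in>space \<mu>. \<forall>\<xi>\<in>carrier H. \<forall>\<eta>\<in>carrier H. ip H (F x \<xi>) \<eta> = (\<Sum>k<n. ip H (?\<gamma> k x \<xi>) \<eta>)"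
      using Linf_finsum[of "{..<n}" ?\<gamma> \<mu>] g by auto
    have c: "continuous_on UNIV (\<lambda>a. cnj (v i a) * v j a)" using v ij by (intro continuous_intros)
    have "F \<in> \<phi> (\<lambda>a. cnj (v i a) * v j a)" using 1 F(1,2) P[OF ij] Linf_class_self by simp
    from rep_eq_AE[OF c this] show ?thesis using AE_space
    proof eventually_elim
      case (elim x)
      show ?case
      proof (intro ballI)
        fix \<xi> \<eta> assume xe: "\<xi> \<in> carrier H" "\<eta> \<in> carrier H"
        have "ip H (rep (\<lambda>a. cnj (v i a) * v j a) x \<xi>) \<eta> = (\<Sum>k<n. ip H (?\<gamma> k x \<xi>) \<eta>)"
          unfolding elim(1)[symmetric] using F(3) elim(2) xe by blast
        also have "\<dots> = (\<Sum>k<n. ip H (\<beta> k j x \<xi>) (\<beta> k i x \<eta>))"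
        proof (rule sum.cong[OF refl])
          fix k assume k: "k \<in> {..<n}"
          have T: "\<beta> k i x \<in> bounded_ops H H" using \<beta>(1)[of k i] k ij elim(2) ess_boundedD(1) by auto
          have bx: "\<beta> k j x \<xi> \<in> carrier H" using \<beta>(1)[of k j] k ij elim(2) xe ess_boundedD(4) by auto
          have "ip H (adjoint_op H H (\<beta> k i x) (\<beta> k j x \<xi>)) \<eta> = cnj (ip H \<eta> (adjoint_op H H (\<beta> k i x) (\<beta> k j x \<xi>)))"
            by (rule ip_cnj) (use xe adjoint_op(1)[OF T bx] in auto)
          also have "\<dots> = cnj (ip H (\<beta> k i x \<eta>) (\<beta> k j x \<xi>))" using adjoint_op(2)[OF T xe(2) bx] by simp
          also have "\<dots> = ip H (\<beta> k j x \<xi>) (\<beta> k i x \<eta>)"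
            by (rule ip_cnj[symmetric]) (use bx bounded_opsD(1)[OF T xe(2)] in auto)
          finally show "ip H (?\<gamma> k x \<xi>) \<eta> = ip H (\<beta> k j x \<xi>) (\<beta> k i x \<eta>)" using xe by (simp add: compose_eq)
        qed
        finally show "ip H (rep (\<lambda>a. cnj (v i a) * v j a) x \<xi>) \<eta> = (\<Sum>k<n. ip H (\<beta> k j x \<xi>) (\<beta> k i x \<eta>))" .
      qed
    qed
  qed
  then show ?thesis using \<beta>(1) by blast
qed

text \<open>All vectors are quantified inside, so one null set serves every choice of them.
  Hermitian symmetry is recorded separately because positivity mentions only the real part and the
  Gram kernel needs both.\<close>

definition cp_at :: "'x \<Rightarrow> nat \<Rightarrow> (nat \<Rightarrow> 'a \<Rightarrow> complex) \<Rightarrow> bool" where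
  "cp_at x n v \<longleftrightarrow>
     (\<forall>i<n. \<forall>j<n. \<forall>\<xi>\<in>carrier H. \<forall>\<eta>\<in>carrier H.
        ip H (rep (\<lambda>a. cnj (v i a) * v j a) x \<xi>) \<eta> = cnj (ip H (rep (\<lambda>a. cnj (v j a) * v i a) x \<eta>) \<xi>)) \<and>
     (\<forall>\<xi>. (\<forall>i<n. \<xi> i \<in> carrier H) \<longrightarrow> 0 \<le> Re (gform x n v \<xi>))"

text \<open>By \<open>rep_factor\<close> the form is a sum over \<open>k\<close> of squared norms.
  The exceptional set comes from the factors \<open>\<beta>\<close> and not from the
  vectors.\<close>

lemma rep_positive:
  fixes n :: nat
  assumes v: "\<And>i. i < n \<Longrightarrow> continuous_on UNIV (v i)"
  shows "AE x in \<mu>. cp_at x n v"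
proof -
  obtain \<beta> where b: "(\<forall>k<n. \<forall>j<n. \<beta> k j \<in> ess_bounded_op_funs \<mu> H) \<and>
    (\<forall>i<n. \<forall>j<n. AE x in \<mu>. \<forall>\<xi>\<in>carrier H. \<forall>\<eta>\<in>carrier H.
      ip H (rep (\<lambda>a. cnj (v i a) * v j a) x \<xi>) \<eta> = (\<Sum>k<n. ip H (\<beta> k j x \<xi>) (\<beta> k i x \<eta>)))"
    by (rule exE[OF rep_factor[of n v]]) (rule v, assumption, rule that)
  have \<beta>: "\<And>k j. k < n \<Longrightarrow> j < n \<Longrightarrow> \<beta> k j \<in> ess_bounded_op_funs \<mu> H"
    "\<And>i j. i < n \<Longrightarrow> j < n \<Longrightarrow> AE x in \<mu>. \<forall>\<xi>\<in>carrier H. \<forall>\<eta>\<in>carrier H.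
      ip H (rep (\<lambda>a. cnj (v i a) * v j a) x \<xi>) \<eta> = (\<Sum>k<n. ip H (\<beta> k j x \<xi>) (\<beta> k i x \<eta>))"
    using b by simp_all
  have "AE x in \<mu>. \<forall>i\<in>{..<n}. \<forall>j\<in>{..<n}. \<forall>\<xi>\<in>carrier H. \<forall>\<eta>\<in>carrier H.
      ip H (rep (\<lambda>a. cnj (v i a) * v j a) x \<xi>) \<eta> = (\<Sum>k<n. ip H (\<beta> k j x \<xi>) (\<beta> k i x \<eta>))"
    by (rule AE_finite_allI[OF finite_lessThan], rule AE_finite_allI[OF finite_lessThan], rule \<beta>(2)) auto
  then show ?thesis using AE_space
  proof eventually_elim
    case (elim x)
    have f: "ip H (rep (\<lambda>a. cnj (v i a) * v j a) x \<xi>) \<eta> = (\<Sum>k<n. ip H (\<beta> k j x \<xi>) (\<beta> k i x \<eta>))"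
      if "i < n" "j < n" "\<xi> \<in> carrier H" "\<eta> \<in> carrier H" for i j \<xi> \<eta> using elim(1) that by auto
    have bc: "\<beta> k j x \<xi> \<in> carrier H" if "k < n" "j < n" "\<xi> \<in> carrier H" for k j \<xi>
      by (rule ess_boundedD(4)[OF \<beta>(1)[OF that(1,2)] elim(2) that(3)])
    show ?case unfolding cp_at_def
    proof (intro conjI allI impI ballI)
      fix i j \<xi> \<eta> assume a: "i < n" "j < n" "\<xi> \<in> carrier H" "\<eta> \<in> carrier H"
      show "ip H (rep (\<lambda>a. cnj (v i a) * v j a) x \<xi>) \<eta> = cnj (ip H (rep (\<lambda>a. cnj (v j a) * v i a) x \<eta>) \<xi>)"
        unfolding f[OF a] f[OF a(2,1,4,3)] cnj_sum
        by (intro sum.cong refl ip_cnj bc) (use a in auto)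
    next
      fix \<xi> :: "nat \<Rightarrow> 'h" assume x: "\<forall>i<n. \<xi> i \<in> carrier H"
      have "\<exists>s\<in>carrier H. \<forall>z\<in>carrier H. ip H s z = (\<Sum>j<n. ip H (\<beta> k j x (\<xi> j)) z)" if "k < n" for k
        using ex_lincomb[of n "\<lambda>j. \<beta> k j x (\<xi> j)" "\<lambda>_. 1"] bc x that by auto
      note ex = this
      \<comment> \<open>The sum over \<open>j\<close> of the vectors
        \<open>\<beta> k j x (\<xi> j)\<close>; its squared norm is the contribution of
        \<open>k\<close> to the form.\<close>
      define s where "s k = (SOME s. s \<in> carrier H \<and> (\<forall>z\<in>carrier H. ip H s z = (\<Sum>j<n. ip H (\<beta> k j x (\<xi> j)) z)))" for k
      have "s k \<in> carrier H \<and> (\<forall>z\<in>carrier H. ip H (s k) z = (\<Sum>j<n. ip H (\<beta> k j x (\<xi> j)) z))" if "k < n" for k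
        unfolding s_def by (rule someI_ex) (use ex[OF that] in \<open>simp only: Bex_def\<close>)
      then have s: "\<And>k. k < n \<Longrightarrow> s k \<in> carrier H"
        "\<And>k z. k < n \<Longrightarrow> z \<in> carrier H \<Longrightarrow> ip H (s k) z = (\<Sum>j<n. ip H (\<beta> k j x (\<xi> j)) z)" by simp_all
      have s2: "ip H z (s k) = (\<Sum>i<n. ip H z (\<beta> k i x (\<xi> i)))" if "k < n" "z \<in> carrier H" for k z
        unfolding ip_cnj[OF s(1)[OF that(1)] that(2)] s(2)[OF that] cnj_sum
        by (intro sum.cong refl ip_cnj[symmetric] bc that) (use x in auto)
      have "(gform x n v \<xi>)
          = (\<Sum>i<n. \<Sum>j<n. \<Sum>k<n. ip H (\<beta> k j x (\<xi> j)) (\<beta> k i x (\<xi> i)))"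
        using x by (intro sum.cong refl f) auto
      also have "\<dots> = (\<Sum>i<n. \<Sum>k<n. \<Sum>j<n. ip H (\<beta> k j x (\<xi> j)) (\<beta> k i x (\<xi> i)))"
        by (intro sum.cong refl sum.swap)
      also have "\<dots> = (\<Sum>k<n. \<Sum>i<n. \<Sum>j<n. ip H (\<beta> k j x (\<xi> j)) (\<beta> k i x (\<xi> i)))"
        by (rule sum.swap)
      also have "\<dots> = (\<Sum>k<n. ip H (s k) (s k))"
      proof (rule sum.cong[OF refl])
        fix k assume "k \<in> {..<n}"
        then show "(\<Sum>i<n. \<Sum>j<n. ip H (\<beta> k j x (\<xi> j)) (\<beta> k i x (\<xi> i))) = ip H (s k) (s k)"
          using s2[of k "s k"] s bc x by simp
      qed
      finally show "0 \<le> Re (gform x n v \<xi>)"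
        using s(1) by (auto intro!: sum_nonneg ip_nonneg)
    qed
  qed
qed

end

section \<open>A countable dense subalgebra of the continuous functions\<close>

lemma urysohn_points:
  fixes x y :: "'a :: t2_space"
  assumes "compact (UNIV :: 'a set)" "closed S" "closed T" "S \<inter> T = {}"
  shows "\<exists>f :: 'a \<Rightarrow> real. continuous_on UNIV f \<and> (\<forall>x\<in>S. f x = 0) \<and> (\<forall>y\<in>T. f y = 1)"
proof -
  have "Hausdorff_space (euclidean :: 'a topology)"
    unfolding Hausdorff_space_def by (simp add: disjnt_def) (meson hausdorff)
  then have "normal_space (euclidean :: 'a topology)"
    using assms(1) by (intro compact_Hausdorff_or_regular_imp_normal_space) (auto simp: compact_space_def)
  then obtain f where "continuous_map (euclidean :: 'a topology) euclideanreal f" "f ` S \<subseteq> {0}" "f ` T \<subseteq> {1}"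
    using Urysohn_lemma_alt[of "euclidean :: 'a topology" S T 0 1] assms by (auto simp: disjnt_def)
  then show ?thesis by (intro exI[of _ f]) auto
qed

text \<open>One Urysohn function is taken for each pair of basic open sets with disjoint closures,
  which keeps the family countable.\<close>

lemma countable_separating_functions:
  assumes "compact (UNIV :: 'a :: {second_countable_topology, t2_space} set)"
  obtains F :: "('a :: {second_countable_topology, t2_space} \<Rightarrow> real) set" where "countable F" "\<And>f. f \<in> F \<Longrightarrow> continuous_on UNIV f"
    "\<And>x y. x \<noteq> y \<Longrightarrow> \<exists>f\<in>F. f x \<noteq> f y"
proof -
  obtain B :: "'a set set" where B: "countable B" "topological_basis B" using ex_countable_basis by blast
  define ur where "ur U V = (SOME f :: 'a \<Rightarrow> real. continuous_on UNIV f \<and> (\<forall>x\<in>closure U. f x = 0) \<and> (\<forall>y\<in>closure V. f y = 1))" for U V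
  define P where "P = {(U, V) \<in> B \<times> B. closure U \<inter> closure V = {}}"
  have ur: "continuous_on UNIV (ur U V) \<and> (\<forall>x\<in>closure U. ur U V x = 0) \<and> (\<forall>y\<in>closure V. ur U V y = 1)"
    if "(U, V) \<in> P" for U V
    using someI_ex[OF urysohn_points[OF assms, of "closure U" "closure V"]] that by (simp add: ur_def P_def)
  show ?thesis
  proof (rule that[of "(\<lambda>(U, V). ur U V) ` P"])
    have "countable P" by (rule countable_subset[of _ "B \<times> B"]) (use B(1) in \<open>auto simp: P_def\<close>)
    then show "countable ((\<lambda>(U, V). ur U V) ` P)" by simp
    show "continuous_on UNIV f" if "f \<in> (\<lambda>(U, V). ur U V) ` P" for f using that ur by auto
    show "\<exists>f\<in>(\<lambda>(U, V). ur U V) ` P. f x \<noteq> f y" if xy: "x \<noteq> y" for x y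
    proof -
      obtain f :: "'a \<Rightarrow> real" where f: "continuous_on UNIV f" "f x = 0" "f y = 1"
        using urysohn_points[OF assms, of "{x}" "{y}"] xy by auto
      \<comment> \<open>The thresholds one third and two thirds leave a gap, so basic sets inside
        these regions have disjoint closures.\<close>
      have o: "open {z. f z < 1/3}" "open {z. f z > 2/3}"
        using f(1) by (auto intro!: open_Collect_less continuous_intros)
      obtain U where U: "U \<in> B" "x \<in> U" "U \<subseteq> {z. f z < 1/3}"
        using topological_basisE[OF B(2) o(1), of x] f(2) by auto
      obtain V where V: "V \<in> B" "y \<in> V" "V \<subseteq> {z. f z > 2/3}"
        using topological_basisE[OF B(2) o(2), of y] f(3) by auto
      have "closure U \<subseteq> {z. f z \<le> 1/3}"
        by (rule closure_minimal) (use U(3) f(1) in \<open>auto intro!: closed_Collect_le continuous_intros\<close>)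
      moreover have "closure V \<subseteq> {z. f z \<ge> 2/3}"
        by (rule closure_minimal) (use V(3) f(1) in \<open>auto intro!: closed_Collect_le continuous_intros\<close>)
      ultimately have "closure U \<inter> closure V = {}" by force
      then have "(U, V) \<in> P" using U V by (auto simp: P_def)
      moreover have "x \<in> closure U" "y \<in> closure V" using U V closure_subset by auto
      ultimately show ?thesis using ur[of U V] by (intro bexI[of _ "ur U V"]) (auto intro: image_eqI[of _ _ "(U, V)"])
    qed
  qed
qed

lemma compact_UNIV_bound:
  fixes f :: "'a :: topological_space \<Rightarrow> 'b :: real_normed_vector"
  assumes "compact (UNIV :: 'a set)" "continuous_on UNIV f"
  obtains B where "B > 0" "\<And>a. norm (f a) \<le> B"
proof -
  have "bounded (f ` UNIV)" using assms by (intro compact_imp_bounded compact_continuous_image)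
  then show ?thesis using that by (auto simp: bounded_pos)
qed

text \<open>Closing a countable set in countably many stages keeps it countable; scalars enter only
  as the constants contained in \<open>F\<close>.\<close>

primrec gen_alg :: "('a \<Rightarrow> complex) set \<Rightarrow> nat \<Rightarrow> ('a \<Rightarrow> complex) set" where
  "gen_alg F 0 = F"
| "gen_alg F (Suc n) = gen_alg F n \<union> (\<lambda>(u, v) a. u a + v a) ` (gen_alg F n \<times> gen_alg F n)
     \<union> (\<lambda>(u, v) a. u a * v a) ` (gen_alg F n \<times> gen_alg F n) \<union> (\<lambda>u a. cnj (u a)) ` gen_alg F n"

text \<open>Closure under all complex scalars would destroy countability. Approximation of every
  scalar by constants in \<open>D\<close> replaces it, and the constant minus one provides
  differences.\<close>

definition dense_alg :: "('a :: topological_space \<Rightarrow> complex) set \<Rightarrow> bool" where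
  "dense_alg D \<longleftrightarrow> countable D \<and> (\<forall>u\<in>D. continuous_on UNIV u)
     \<and> (\<forall>u\<in>D. \<forall>v\<in>D. (\<lambda>a. u a + v a) \<in> D) \<and> (\<forall>u\<in>D. \<forall>v\<in>D. (\<lambda>a. u a * v a) \<in> D)
     \<and> (\<forall>u\<in>D. (\<lambda>a. cnj (u a)) \<in> D) \<and> (\<lambda>_. 1) \<in> D \<and> (\<lambda>_. - 1) \<in> D
     \<and> (\<forall>u e. continuous_on UNIV u \<longrightarrow> e > 0 \<longrightarrow> (\<exists>d\<in>D. \<forall>a. cmod (u a - d a) < e))
     \<and> (\<forall>c e. e > 0 \<longrightarrow> (\<exists>q. (\<lambda>_. q) \<in> D \<and> cmod (c - q) < e))"

lemma ex_dense_alg: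
  assumes cpt: "compact (UNIV :: 'a :: {second_countable_topology, t2_space} set)"
  shows "\<exists>D :: ('a :: {second_countable_topology, t2_space} \<Rightarrow> complex) set. dense_alg D"
proof -
  obtain F0 :: "('a \<Rightarrow> real) set" where F0: "countable F0" "\<And>f. f \<in> F0 \<Longrightarrow> continuous_on UNIV f"
    "\<And>x y. x \<noteq> y \<Longrightarrow> \<exists>f\<in>F0. f x \<noteq> f y" using countable_separating_functions[OF cpt] by metis
  obtain Q :: "complex set" where Q: "countable Q" "\<And>U. open U \<Longrightarrow> U \<noteq> {} \<Longrightarrow> \<exists>q\<in>Q. q \<in> U"
    using countable_dense_setE by blast
  define F where "F = (\<lambda>f a. complex_of_real (f a)) ` F0 \<union> (\<lambda>q _. q) ` (Q \<union> {1, -1, \<i>})"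
  define D where "D = (\<Union>n. gen_alg F n)"
  have mono: "gen_alg F m \<subseteq> gen_alg F n" if "m \<le> n" for m n
    using that by (induction n rule: dec_induct) auto
  have step: "\<exists>n. u \<in> gen_alg F n \<and> v \<in> gen_alg F n" if uv: "u \<in> D" "v \<in> D" for u v
  proof -
    obtain m n where "u \<in> gen_alg F m" "v \<in> gen_alg F n" using uv by (auto simp: D_def)
    then have "u \<in> gen_alg F (max m n) \<and> v \<in> gen_alg F (max m n)"
      using mono[of m "max m n"] mono[of n "max m n"] by auto
    then show ?thesis ..
  qed
  have add: "(\<lambda>a. u a + v a) \<in> D" and mult: "(\<lambda>a. u a * v a) \<in> D" if uv: "u \<in> D" "v \<in> D" for u v
  proof -
    obtain n where "u \<in> gen_alg F n" "v \<in> gen_alg F n" using step[OF uv] by blast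
    then have "(\<lambda>a. u a + v a) \<in> gen_alg F (Suc n)" "(\<lambda>a. u a * v a) \<in> gen_alg F (Suc n)"
      by (auto intro!: image_eqI[of _ _ "(u, v)"])
    then show "(\<lambda>a. u a + v a) \<in> D" "(\<lambda>a. u a * v a) \<in> D" unfolding D_def by blast+
  qed
  have cnj_in: "(\<lambda>a. cnj (u a)) \<in> D" if u: "u \<in> D" for u
  proof -
    obtain n where "u \<in> gen_alg F n" using step[OF u u] by blast
    then have "(\<lambda>a. cnj (u a)) \<in> gen_alg F (Suc n)" by auto
    then show ?thesis unfolding D_def by blast
  qed
  have FD: "F \<subseteq> D" unfolding D_def by (rule order_trans[OF _ UN_upper[of 0]]) auto
  have cont: "continuous_on UNIV u" if "u \<in> D" for u
  proof -
    have "\<forall>u\<in>gen_alg F n. continuous_on UNIV u" for n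
      by (induction n) (auto simp: F_def intro!: continuous_intros F0(2))
    then show ?thesis using that by (auto simp: D_def)
  qed
  have count: "countable D"
  proof -
    have "countable F" using F0(1) Q(1) by (simp add: F_def)
    then have "countable (gen_alg F n)" for n by (induction n) simp_all
    then show ?thesis by (simp add: D_def)
  qed
  have const_dense: "\<exists>q. (\<lambda>_. q) \<in> D \<and> cmod (c - q) < e" if e: "e > 0" for c e
  proof -
    obtain q where "q \<in> Q" "q \<in> ball c e" using Q(2)[of "ball c e"] e by (metis centre_in_ball emptyE open_ball)
    then show ?thesis using FD by (intro exI[of _ q]) (auto simp: F_def dist_norm)
  qed
  \<comment> \<open>Stone-Weierstrass needs all real constants, which the countable \<open>D\<close>
    cannot contain; the real functions uniformly approximable from \<open>D\<close> do contain
    them.\<close>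
  define R where "R = {f :: 'a \<Rightarrow> real. continuous_on UNIV f \<and> (\<forall>e>0. \<exists>d\<in>D. \<forall>a. cmod (of_real (f a) - d a) < e)}"
  have R_approx: "\<exists>d\<in>D. \<forall>a. cmod (of_real (f a) - d a) < e" if "f \<in> R" "e > 0" for f e
    using that by (simp add: R_def)
  interpret R: function_ring_on R UNIV
  proof
    show "compact (UNIV :: 'a set)" by (rule cpt)
    show "continuous_on UNIV f" if "f \<in> R" for f using that by (simp add: R_def)
    show "(\<lambda>x. f x + g x) \<in> R" if fg: "f \<in> R" "g \<in> R" for f g
      unfolding R_def
    proof (intro CollectI conjI allI impI)
      show "continuous_on UNIV (\<lambda>x. f x + g x)" using fg by (auto simp: R_def intro!: continuous_intros)
      fix e :: real assume "e > 0"
      then obtain d d' where d: "d \<in> D" "\<And>a. cmod (of_real (f a) - d a) < e/2" "d' \<in> D" "\<And>a. cmod (of_real (g a) - d' a) < e/2"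
        using R_approx[OF fg(1), of "e/2"] R_approx[OF fg(2), of "e/2"] half_gt_zero by blast
      have "cmod (of_real (f a + g a) - (d a + d' a)) < e" for a
        using norm_triangle_ineq[of "of_real (f a) - d a" "of_real (g a) - d' a"] d(2)[of a] d(4)[of a]
        by (simp add: algebra_simps)
      then show "\<exists>d\<in>D. \<forall>a. cmod (of_real (f a + g a) - d a) < e" by (intro bexI[OF _ add[OF d(1,3)]] allI)
    qed
    show "(\<lambda>x. f x * g x) \<in> R" if fg: "f \<in> R" "g \<in> R" for f g
      unfolding R_def
    proof (intro CollectI conjI allI impI)
      show "continuous_on UNIV (\<lambda>x. f x * g x)" using fg by (auto simp: R_def intro!: continuous_intros)
      fix e :: real assume e: "e > 0"
      obtain B where B: "B > 0" "\<And>a. norm (f a) \<le> B" using compact_UNIV_bound[OF cpt, of f] fg(1) by (auto simp: R_def)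
      obtain B' where B': "B' > 0" "\<And>a. norm (g a) \<le> B'" using compact_UNIV_bound[OF cpt, of g] fg(2) by (auto simp: R_def)
      \<comment> \<open>Each factor's error is to contribute at most half of \<open>e\<close>. The
        cap at one in \<open>e2\<close> bounds the approximant of \<open>g\<close> by
        \<open>B' + 1\<close>, which is the divisor here.\<close>
      define e1 where "e1 = e / (2 * (B' + 1))"
      define e2 where "e2 = min 1 (e / (2 * B))"
      have "e1 > 0" "e2 > 0" using e B B' by (auto simp: e1_def e2_def)
      then obtain d d' where d: "d \<in> D" "\<And>a. cmod (of_real (f a) - d a) < e1" "d' \<in> D" "\<And>a. cmod (of_real (g a) - d' a) < e2"
        using R_approx[OF fg(1), of e1] R_approx[OF fg(2), of e2] by blast
      have "cmod (of_real (f a * g a) - d a * d' a) < e" for a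
      proof -
        have eq: "of_real (f a * g a) - d a * d' a = of_real (f a) * (of_real (g a) - d' a) + (of_real (f a) - d a) * d' a"
          by (simp add: algebra_simps)
        have d'B: "cmod (d' a) \<le> B' + 1"
          using norm_triangle_ineq2[of "d' a" "of_real (g a)"] d(4)[of a] B'(2)[of a]
          by (simp add: norm_minus_commute e2_def)
        have "cmod (of_real (f a) * (of_real (g a) - d' a)) \<le> B * e2"
          unfolding norm_mult using B d(4)[of a] by (intro mult_mono) auto
        also have "\<dots> \<le> B * (e / (2 * B))" using B by (intro mult_left_mono) (auto simp: e2_def)
        also have "\<dots> = e / 2" using B by simp
        finally have 1: "cmod (of_real (f a) * (of_real (g a) - d' a)) \<le> e / 2" .
        have "cmod ((of_real (f a) - d a) * d' a) \<le> cmod (of_real (f a) - d a) * (B' + 1)"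
          unfolding norm_mult using d'B by (intro mult_left_mono) auto
        also have "\<dots> < e1 * (B' + 1)" using d(2)[of a] B' by (intro mult_strict_right_mono) auto
        also have "\<dots> = e / 2" using B' by (simp add: e1_def field_simps)
        finally have 2: "cmod ((of_real (f a) - d a) * d' a) < e / 2" .
        show ?thesis unfolding eq using norm_triangle_ineq 1 2
          by (smt (verit) field_sum_of_halves)
      qed
      then show "\<exists>d\<in>D. \<forall>a. cmod (of_real (f a * g a) - d a) < e" by (intro bexI[OF _ mult[OF d(1,3)]] allI)
    qed
    show "(\<lambda>_. c) \<in> R" for c
      unfolding R_def using const_dense[of _ "of_real c"] by fastforce
    show "\<exists>f\<in>R. f x \<noteq> f y" if "x \<noteq> y" for x y
    proof -
      obtain f where f: "f \<in> F0" "f x \<noteq> f y" using F0(3)[OF \<open>x \<noteq> y\<close>] by blast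
      have "(\<lambda>a. complex_of_real (f a)) \<in> D" using FD f(1) by (auto simp: F_def)
      then have "f \<in> R" unfolding R_def using F0(2)[OF f(1)] by force
      then show ?thesis using f(2) by blast
    qed
  qed
  have dense_real: "\<exists>d\<in>D. \<forall>a. cmod (of_real (f a) - d a) < e" if f: "continuous_on UNIV f" and e: "e > 0" for f :: "'a \<Rightarrow> real" and e
  proof -
    obtain g where g: "g \<in> R" "\<And>a. \<bar>f a - g a\<bar> < e/2" using R.Stone_Weierstrass_basic[OF f, of "e/2"] e by auto
    obtain d where d: "d \<in> D" "\<And>a. cmod (of_real (g a) - d a) < e/2" 
      using R_approx[OF g(1), of "e/2"] half_gt_zero[OF e] by blast
    have "cmod (of_real (f a) - d a) < e" for a
    proof -
      have "cmod (of_real (f a) - d a) \<le> cmod (of_real (f a - g a)) + cmod (of_real (g a) - d a)"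
        using norm_triangle_ineq[of "of_real (f a - g a)" "of_real (g a) - d a"] by simp
      then show ?thesis using g(2)[of a] d(2)[of a] by (simp only: norm_of_real)
    qed
    then show ?thesis using d(1) by blast
  qed
  have dens: "\<exists>d\<in>D. \<forall>a. cmod (u a - d a) < e" if u: "continuous_on UNIV u" and e: "e > 0" for u e
  proof -
    obtain d where d: "d \<in> D" "\<And>a. cmod (of_real (Re (u a)) - d a) < e/2"
      using dense_real[of "\<lambda>a. Re (u a)" "e/2"] u e by (auto intro!: continuous_intros)
    obtain d' where d': "d' \<in> D" "\<And>a. cmod (of_real (Im (u a)) - d' a) < e/2"
      using dense_real[of "\<lambda>a. Im (u a)" "e/2"] u e by (auto intro!: continuous_intros)
    \<comment> \<open>The imaginary unit was put into the generators so that approximants of real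
      and imaginary part can be combined within \<open>D\<close>.\<close>
    have i: "(\<lambda>_. \<i>) \<in> D" using FD by (auto simp: F_def)
    have "cmod (u a - (d a + \<i> * d' a)) < e" for a
    proof -
      have eq: "u a - (d a + \<i> * d' a) = (of_real (Re (u a)) - d a) + \<i> * (of_real (Im (u a)) - d' a)"
        by (simp add: complex_eq_iff)
      then have "cmod (u a - (d a + \<i> * d' a)) \<le> cmod (of_real (Re (u a)) - d a) + cmod (of_real (Im (u a)) - d' a)"
        unfolding eq using norm_triangle_ineq[of "of_real (Re (u a)) - d a" "\<i> * (of_real (Im (u a)) - d' a)"] by (simp add: norm_mult)
      then show ?thesis using d(2)[of a] d'(2)[of a] by linarith
    qed
    then show ?thesis by (intro bexI[OF _ add[OF d(1) mult[OF i d'(1)]]] allI)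
  qed
  have one: "(\<lambda>_. 1) \<in> D" "(\<lambda>_. - 1) \<in> D" using FD by (auto simp: F_def)
  show ?thesis unfolding dense_alg_def
    by (intro exI[of _ D] conjI ballI allI impI count add mult cnj_in one const_dense)
      (assumption | rule cont, assumption | rule dens, assumption, assumption)+
qed

lemma dense_algD:
  assumes "dense_alg D"
  shows "countable D" "u \<in> D \<Longrightarrow> continuous_on UNIV u"
    "u \<in> D \<Longrightarrow> v \<in> D \<Longrightarrow> (\<lambda>a. u a + v a) \<in> D"
    "u \<in> D \<Longrightarrow> v \<in> D \<Longrightarrow> (\<lambda>a. u a * v a) \<in> D"
    "u \<in> D \<Longrightarrow> (\<lambda>a. cnj (u a)) \<in> D" "(\<lambda>_. 1) \<in> D" "(\<lambda>_. - 1) \<in> D"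
    "continuous_on UNIV u \<Longrightarrow> e > 0 \<Longrightarrow> \<exists>d\<in>D. \<forall>a. cmod (u a - d a) < e"
    "e > 0 \<Longrightarrow> \<exists>q. (\<lambda>_. q) \<in> D \<and> cmod (c - q) < e"
  using assms unfolding dense_alg_def by simp_all

section \<open>Representations from a dense multiplicative action\<close>

text \<open>The vector \<open>k v j\<close> stands for \<open>v \<otimes> h j\<close> in one fibre.
  The bound is asked for rational \<open>C\<close> only, because in the application each
  \<open>C\<close> costs a null set. Lists encode finite sums, so that adding vectors is appending
  lists.\<close>

locale gns_fiber =
  fixes D :: "('a :: topological_space \<Rightarrow> complex) set" and k :: "('a \<Rightarrow> complex) \<Rightarrow> nat \<Rightarrow> l2"
  assumes cpt: "compact (UNIV :: 'a set)"
    and D: "dense_alg D"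
    and k_add: "\<lbrakk>u \<in> D; v \<in> D\<rbrakk> \<Longrightarrow> k (\<lambda>a. u a + v a) j = k u j + k v j"
    and k_scale: "\<lbrakk>(\<lambda>_. q) \<in> D; u \<in> D\<rbrakk> \<Longrightarrow> k (\<lambda>a. q * u a) j = scaleC q (k u j)"
    and k_adj: "\<lbrakk>u \<in> D; v \<in> D; w \<in> D\<rbrakk> \<Longrightarrow>
      ip2 (k (\<lambda>a. u a * v a) j) (k w i) = ip2 (k v j) (k (\<lambda>a. cnj (u a) * w a) i)"
    and k_bound: "\<lbrakk>u \<in> D; C \<in> \<rat>; \<And>a. cmod (u a) \<le> C; set l \<subseteq> D \<times> UNIV\<rbrakk> \<Longrightarrow>
      norm (\<Sum>(v, j)\<leftarrow>l. k (\<lambda>a. u a * v a) j) \<le> C * norm (\<Sum>(v, j)\<leftarrow>l. k v j)"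
begin

lemmas D_simps = dense_algD[OF D]

text \<open>Lists play the role of the algebraic tensor product and \<open>zz\<close> that of the
  quotient map. Functions act on lists; that the action descends to vectors is a consequence of
  \<open>zz_diff_bound\<close>.\<close>

definition zz :: "(('a \<Rightarrow> complex) \<times> nat) list \<Rightarrow> l2" where
  "zz l = (\<Sum>(v, j)\<leftarrow>l. k v j)"

definition act :: "('a \<Rightarrow> complex) \<Rightarrow> (('a \<Rightarrow> complex) \<times> nat) list \<Rightarrow> (('a \<Rightarrow> complex) \<times> nat) list" where
  "act u l = map (\<lambda>(v, j). ((\<lambda>a. u a * v a), j)) l"

abbreviation "L \<equiv> lists (D \<times> UNIV)"

lemma zz_append: "zz (l @ l') = zz l + zz l'"
  by (simp add: zz_def)

lemma act_append: "act u (l @ l') = act u l @ act u l'"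
  by (simp add: act_def)

lemma act_in: "u \<in> D \<Longrightarrow> l \<in> L \<Longrightarrow> act u l \<in> L"
  by (induction l) (auto simp: act_def D_simps)

lemma act_act: "act u (act v l) = act (\<lambda>a. u a * v a) l"
  by (auto simp: act_def mult.assoc)

lemma act_one: "act (\<lambda>_. 1) l = l"
  by (simp add: act_def case_prod_unfold)

lemma zz_scale: "(\<lambda>_. q) \<in> D \<Longrightarrow> l \<in> L \<Longrightarrow> zz (act (\<lambda>_. q) l) = scaleC q (zz l)"
  by (induction l) (auto simp: zz_def act_def k_scale scaleC.add_right scaleC.zero_right)

lemma zz_add: "u \<in> D \<Longrightarrow> v \<in> D \<Longrightarrow> l \<in> L \<Longrightarrow> zz (act (\<lambda>a. u a + v a) l) = zz (act u l) + zz (act v l)"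
proof (induction l)
  case (Cons p l)
  then obtain w j where p: "p = (w, j)" "w \<in> D" by auto
  have "k (\<lambda>a. (u a + v a) * w a) j = k (\<lambda>a. u a * w a) j + k (\<lambda>a. v a * w a) j"
    using k_add[of "\<lambda>a. u a * w a" "\<lambda>a. v a * w a" j] Cons.prems p D_simps by (simp add: algebra_simps)
  then show ?case using Cons p by (simp add: zz_def act_def algebra_simps)
qed (simp add: zz_def act_def)

lemma zz_adj:
  assumes u: "u \<in> D" and l: "l \<in> L" "l' \<in> L"
  shows "ip2 (zz (act u l)) (zz l') = ip2 (zz l) (zz (act (\<lambda>a. cnj (u a)) l'))"
proof -
  have 1: "ip2 (k (\<lambda>a. u a * v a) j) (zz l') = ip2 (k v j) (zz (act (\<lambda>a. cnj (u a)) l'))" if v: "v \<in> D" for v j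
    using l(2)
  proof (induction l')
    case (Cons p l')
    then show ?case using k_adj[OF u v] by (auto simp: zz_def act_def ip2.add_right)
  qed (simp add: zz_def act_def ip2.zero_right)
  show ?thesis using l(1)
  proof (induction l)
    case (Cons p l)
    then show ?case using 1 by (auto simp: zz_def act_def ip2.add_left)
  qed (simp add: zz_def act_def ip2.zero_left)
qed

lemma zz_bound:
  assumes "u \<in> D" "\<And>a. cmod (u a) \<le> C" "l \<in> L"
  shows "norm (zz (act u l)) \<le> C * norm (zz l)"
proof (rule ccontr)
  assume "\<not> norm (zz (act u l)) \<le> C * norm (zz l)"
  then have lt: "C * norm (zz l) < norm (zz (act u l))" by simp
  have r: "norm (zz (act u l)) \<le> r * norm (zz l)" if "r \<in> \<rat>" "r > C" for r
    using k_bound[OF assms(1) that(1), of l] that(2) assms(2) order_trans[OF assms(2)] assms(3)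
    by (force simp: zz_def act_def case_prod_unfold comp_def)
  show False
  proof (cases "norm (zz l) = 0")
    case True
    obtain r where "r \<in> \<rat>" "C < r" using Rats_dense_in_real[of C "C + 1"] by auto
    from r[OF this] True lt show False by simp
  next
    case False
    then have "C < norm (zz (act u l)) / norm (zz l)" using lt by (simp add: field_simps)
    then obtain q where "q \<in> \<rat>" "C < q" "q < norm (zz (act u l)) / norm (zz l)" using Rats_dense_in_real by blast
    then show False using r[of q] False by (simp add: field_simps)
  qed
qed

text \<open>The difference is \<open>u - v\<close> acting on \<open>l\<close> plus \<open>v\<close>
  acting on the formal difference of the lists. Existence and uniqueness of the limits defining
  \<open>T\<close> both rest on it.\<close>

lemma zz_diff_bound:
  assumes uv: "u \<in> D" "v \<in> D" and l: "l \<in> L" "l' \<in> L"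
    and c: "\<And>a. cmod (u a - v a) \<le> c" and b: "\<And>a. cmod (v a) \<le> b"
  shows "norm (zz (act u l) - zz (act v l')) \<le> c * norm (zz l) + b * norm (zz l - zz l')"
proof -
  note m1 = D_simps(7)
  have mv: "(\<lambda>a. - 1 * v a) \<in> D" using D_simps(4)[OF m1 uv(2)] by simp
  have uvD: "(\<lambda>a. u a + - 1 * v a) \<in> D" using D_simps(3)[OF uv(1) mv] .
  have neg: "zz (act (\<lambda>_. - 1) l) = - zz l" if "l \<in> L" for l
    using zz_scale[OF m1 that] by (simp add: scaleC.minus_left)
  have 1: "zz (act (\<lambda>a. u a + - 1 * v a) l) = zz (act u l) - zz (act v l)"
    using zz_add[OF uv(1) mv l(1)] neg[OF act_in[OF uv(2) l(1)]] by (simp add: act_act)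
  have 2: "zz (act v (l @ act (\<lambda>_. - 1) l')) = zz (act v l) - zz (act v l')"
    using neg[OF act_in[OF uv(2) l(2)]] by (simp add: act_append zz_append act_act mult.commute)
  have "norm (zz (act u l) - zz (act v l')) = norm (zz (act (\<lambda>a. u a + - 1 * v a) l) + zz (act v (l @ act (\<lambda>_. - 1) l')))"
    unfolding 1 2 by simp
  also have "\<dots> \<le> c * norm (zz l) + b * norm (zz (l @ act (\<lambda>_. - 1) l'))"
    by (intro norm_triangle_mono zz_bound uvD uv l) (use b c l act_in[OF m1 l(2)] in auto)
  also have "zz (l @ act (\<lambda>_. - 1) l') = zz l - zz l'" using neg[OF l(2)] by (simp add: zz_append)
  finally show ?thesis .
qed

section \<open>Extension by continuity to all continuous functions and the closed span\<close>

definition uconv :: "(nat \<Rightarrow> 'a \<Rightarrow> complex) \<Rightarrow> ('a \<Rightarrow> complex) \<Rightarrow> bool" where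
  "uconv us u \<longleftrightarrow> (\<forall>m. us m \<in> D) \<and> (\<exists>e. e \<longlonglongrightarrow> 0 \<and> (\<forall>m a. cmod (us m a - u a) \<le> e m))"

definition lconv :: "(nat \<Rightarrow> (('a \<Rightarrow> complex) \<times> nat) list) \<Rightarrow> l2 \<Rightarrow> bool" where
  "lconv ls p \<longleftrightarrow> (\<forall>m. ls m \<in> L) \<and> (\<lambda>m. zz (ls m)) \<longlonglongrightarrow> p"

definition S :: "l2 set" where "S = closure (zz ` L)"

text \<open>Presents points of the closed span by sequences of lists, so that identities proved for
  lists pass to the limit.\<close>

lemma S_lconv: "p \<in> S \<longleftrightarrow> (\<exists>ls. lconv ls p)"
proof
  assume "p \<in> S"
  then obtain y where y: "\<forall>n. y n \<in> zz ` L" "y \<longlonglongrightarrow> p" by (auto simp: S_def closure_sequential)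
  define ls where "ls m = (SOME l. l \<in> L \<and> y m = zz l)" for m
  have ls: "ls m \<in> L \<and> y m = zz (ls m)" for m
  proof -
    have "\<exists>l. l \<in> L \<and> y m = zz l" using y(1) by blast
    from someI_ex[OF this] show ?thesis unfolding ls_def .
  qed
  then have "y = (\<lambda>m. zz (ls m))" by blast
  then have "lconv ls p" using y(2) ls unfolding lconv_def by blast
  then show "\<exists>ls. lconv ls p" by blast
next
  assume "\<exists>ls. lconv ls p"
  then obtain ls where "lconv ls p" ..
  then show "p \<in> S" unfolding S_def closure_sequential lconv_def by (intro exI[of _ "\<lambda>m. zz (ls m)"]) auto
qed

lemma uconv_ex:
  assumes "continuous_on UNIV u"
  shows "\<exists>us. uconv us u"
proof -
  define us where "us m = (SOME d. d \<in> D \<and> (\<forall>a. cmod (u a - d a) < 1 / real (Suc m)))" for m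
  have "us m \<in> D \<and> (\<forall>a. cmod (u a - us m a) < 1 / real (Suc m))" for m
  proof -
    have "\<exists>d. d \<in> D \<and> (\<forall>a. cmod (u a - d a) < 1 / real (Suc m))"
      using D_simps(8)[OF assms, of "1 / real (Suc m)"] by (simp add: Bex_def del: of_nat_Suc)
    from someI_ex[OF this] show ?thesis unfolding us_def .
  qed
  then have "uconv us u" unfolding uconv_def
    by (intro conjI exI[of _ "\<lambda>m. 1 / real (Suc m)"] LIMSEQ_Suc[OF lim_1_over_n])
      (auto simp: norm_minus_commute less_imp_le)
  then show ?thesis by blast
qed

lemma uconv_const: "u \<in> D \<Longrightarrow> uconv (\<lambda>_. u) u"
  by (auto simp: uconv_def intro!: exI[of _ "\<lambda>_. 0"])

text \<open>A scalar is a limit of constants belonging to \<open>D\<close>; scalar multiplication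
  thereby becomes a case of the action.\<close>

lemma uconv_const_fun: "\<exists>qs. uconv (\<lambda>m _. qs m) (\<lambda>_. c) \<and> qs \<longlonglongrightarrow> c"
proof -
  define qs where "qs m = (SOME q. (\<lambda>_. q) \<in> D \<and> cmod (c - q) < 1 / real (Suc m))" for m
  have q: "(\<lambda>_. qs m) \<in> D \<and> cmod (c - qs m) < 1 / real (Suc m)" for m
  proof -
    have "\<exists>q. (\<lambda>_. q) \<in> D \<and> cmod (c - q) < 1 / real (Suc m)"
      using D_simps(9)[of "1 / real (Suc m)" c] by (simp del: of_nat_Suc)
    from someI_ex[OF this] show ?thesis unfolding qs_def .
  qed
  then have "uconv (\<lambda>m _. qs m) (\<lambda>_. c)" unfolding uconv_def
    by (intro conjI exI[of _ "\<lambda>m. 1 / real (Suc m)"] LIMSEQ_Suc[OF lim_1_over_n])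
      (auto simp: norm_minus_commute less_imp_le)
  moreover have "(\<lambda>m. qs m - c) \<longlonglongrightarrow> 0"
    by (rule Lim_null_comparison[OF _ LIMSEQ_Suc[OF lim_1_over_n]])
      (use q in \<open>auto intro!: always_eventually less_imp_le simp: norm_minus_commute\<close>)
  then have "qs \<longlonglongrightarrow> c" by (rule LIM_zero_cancel)
  ultimately show ?thesis by blast
qed

lemma uconv_add:
  assumes "uconv us u" "uconv vs v"
  shows "uconv (\<lambda>m a. us m a + vs m a) (\<lambda>a. u a + v a)"
proof -
  obtain e f where ef: "e \<longlonglongrightarrow> 0" "\<And>m a. cmod (us m a - u a) \<le> e m" "f \<longlonglongrightarrow> 0" "\<And>m a. cmod (vs m a - v a) \<le> f m"
    using assms by (auto simp: uconv_def)
  have "cmod (us m a + vs m a - (u a + v a)) \<le> e m + f m" for m a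
    using norm_triangle_mono[OF ef(2)[of m a] ef(4)[of m a]] by (simp add: algebra_simps)
  moreover have "(\<lambda>m. e m + f m) \<longlonglongrightarrow> 0" using tendsto_add[OF ef(1,3)] by simp
  moreover have "(\<lambda>a. us m a + vs m a) \<in> D" for m using assms(1,2) D_simps(3) by (simp add: uconv_def)
  ultimately show ?thesis unfolding uconv_def by (intro conjI allI exI[of _ "\<lambda>m. e m + f m"]) simp_all
qed

lemma uconv_bound:
  assumes "uconv us u" "\<And>a. cmod (u a) \<le> B"
  shows "\<exists>e. e \<longlonglongrightarrow> 0 \<and> (\<forall>m a. cmod (us m a - u a) \<le> e m) \<and> (\<forall>m a. cmod (us m a) \<le> B + e m)"
proof -
  obtain e where e: "e \<longlonglongrightarrow> 0" "\<And>m a. cmod (us m a - u a) \<le> e m" using assms(1) by (auto simp: uconv_def)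
  have "cmod (us m a) \<le> B + e m" for m a
    using norm_triangle_mono[OF assms(2)[of a] e(2)[of m a]] by simp
  then show ?thesis using e by blast
qed

lemma uconv_mult:
  assumes "uconv us u" "uconv vs v" "continuous_on UNIV u" "continuous_on UNIV v"
  shows "uconv (\<lambda>m a. us m a * vs m a) (\<lambda>a. u a * v a)"
proof -
  obtain B where B: "B > 0" "\<And>a. norm (u a) \<le> B" using compact_UNIV_bound[OF cpt assms(3)] by blast
  obtain B' where B': "B' > 0" "\<And>a. norm (v a) \<le> B'" using compact_UNIV_bound[OF cpt assms(4)] by blast
  obtain e where e: "e \<longlonglongrightarrow> 0" "\<And>m a. cmod (us m a - u a) \<le> e m" "\<And>m a. cmod (us m a) \<le> B + e m"
    using uconv_bound[OF assms(1) B(2)] by blast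
  obtain f where f: "f \<longlonglongrightarrow> 0" "\<And>m a. cmod (vs m a - v a) \<le> f m" using assms(2) by (auto simp: uconv_def)
  have "cmod (us m a * vs m a - u a * v a) \<le> (B + e m) * f m + e m * B'" for m a
  proof -
    have eq: "us m a * vs m a - u a * v a = us m a * (vs m a - v a) + (us m a - u a) * v a" by (simp add: algebra_simps)
    have "0 \<le> e m" using order_trans[OF norm_ge_zero e(2)] .
    then show ?thesis unfolding eq using e(2,3) f(2) B B'
      by (intro norm_triangle_mono) (auto simp: norm_mult intro!: mult_mono)
  qed
  moreover have "(\<lambda>m. (B + e m) * f m + e m * B') \<longlonglongrightarrow> (B + 0) * 0 + 0 * B'"
    by (intro tendsto_intros e(1) f(1))
  moreover have "(\<lambda>a. us m a * vs m a) \<in> D" for m using assms(1,2) D_simps(4) by (simp add: uconv_def)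
  ultimately show ?thesis unfolding uconv_def by (intro conjI allI exI[of _ "\<lambda>m. (B + e m) * f m + e m * B'"]) simp_all
qed

lemma uconv_cnj: "uconv us u \<Longrightarrow> uconv (\<lambda>m a. cnj (us m a)) (\<lambda>a. cnj (u a))"
  unfolding uconv_def using D_simps(5) by (simp flip: complex_cnj_diff)

text \<open>Shows that the limit does not depend on the approximating functions or lists.\<close>

lemma zz_act_diff_tendsto:
  assumes us: "uconv us u" "uconv vs u" and ls: "lconv ls p" "lconv ls' p" and u: "continuous_on UNIV u"
  shows "(\<lambda>m. zz (act (us m) (ls m)) - zz (act (vs m) (ls' m))) \<longlonglongrightarrow> 0"
proof -
  obtain B where B: "B > 0" "\<And>a. norm (u a) \<le> B" using compact_UNIV_bound[OF cpt u] by blast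
  obtain e where e: "e \<longlonglongrightarrow> 0" "\<And>m a. cmod (us m a - u a) \<le> e m" using us(1) by (auto simp: uconv_def)
  obtain f where f: "f \<longlonglongrightarrow> 0" "\<And>m a. cmod (vs m a - u a) \<le> f m" "\<And>m a. cmod (vs m a) \<le> B + f m"
    using uconv_bound[OF us(2) B(2)] by blast
  have l: "ls m \<in> L" "ls' m \<in> L" "us m \<in> D" "vs m \<in> D" for m using ls us by (auto simp: lconv_def uconv_def)
  have z: "(\<lambda>m. zz (ls m)) \<longlonglongrightarrow> p" "(\<lambda>m. zz (ls' m)) \<longlonglongrightarrow> p" using ls by (auto simp: lconv_def)
  have bd: "norm (zz (act (us m) (ls m)) - zz (act (vs m) (ls' m)))
      \<le> (e m + f m) * norm (zz (ls m)) + (B + f m) * norm (zz (ls m) - zz (ls' m))" for m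
  proof (rule zz_diff_bound[OF l(3,4,1,2)])
    show "cmod (us m a - vs m a) \<le> e m + f m" for a
      using norm_triangle_mono[OF e(2)[of m a], of "u a - vs m a" "f m"] f(2)[of m a] by (simp add: norm_minus_commute)
  qed (rule f(3))
  have "(\<lambda>m. (e m + f m) * norm (zz (ls m)) + (B + f m) * norm (zz (ls m) - zz (ls' m)))
      \<longlonglongrightarrow> (0 + 0) * norm p + (B + 0) * norm (p - p)" by (intro tendsto_intros e f z)
  then have lim: "(\<lambda>m. (e m + f m) * norm (zz (ls m)) + (B + f m) * norm (zz (ls m) - zz (ls' m))) \<longlonglongrightarrow> 0"
    by simp
  show ?thesis by (rule Lim_null_comparison[OF always_eventually lim]) (rule allI, rule bd)
qed

lemma zz_act_convergent:
  assumes us: "uconv us u" and ls: "lconv ls p" and u: "continuous_on UNIV u"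
  shows "convergent (\<lambda>m. zz (act (us m) (ls m)))"
proof -
  obtain B where B: "B > 0" "\<And>a. norm (u a) \<le> B" using compact_UNIV_bound[OF cpt u] by blast
  obtain e where e: "e \<longlonglongrightarrow> 0" "\<And>m a. cmod (us m a - u a) \<le> e m" "\<And>m a. cmod (us m a) \<le> B + e m"
    using uconv_bound[OF us(1) B(2)] by blast
  have l: "ls m \<in> L" "us m \<in> D" for m using ls us by (auto simp: lconv_def uconv_def)
  have z: "(\<lambda>m. zz (ls m)) \<longlonglongrightarrow> p" using ls by (auto simp: lconv_def)
  have "Cauchy (\<lambda>m. zz (act (us m) (ls m)))"
  proof (rule metric_CauchyI)
    fix r :: real assume r: "r > 0"
    define Z where "Z = norm p + 1"
    have Z: "Z > 0" by (simp add: Z_def add_nonneg_pos)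
    \<comment> \<open>With these values \<open>(d + d) * Z\<close> and \<open>(B + 1) * d'\<close>
      are each half of \<open>r\<close>.\<close>
    define d where "d = r / (4 * Z)"
    define d' where "d' = r / (2 * (B + 1))"
    have d: "d > 0" "d' > 0" using r Z B by (auto simp: d_def d'_def)
    have "\<forall>\<^sub>F m in sequentially. norm (zz (ls m)) < Z"
      using order_tendstoD(2)[OF tendsto_norm[OF z], of Z] by (simp add: Z_def)
    moreover have "\<forall>\<^sub>F m in sequentially. e m < min d 1" using order_tendstoD(2)[OF e(1), of "min d 1"] d by simp
    ultimately have "\<forall>\<^sub>F m in sequentially. norm (zz (ls m)) < Z \<and> e m < min d 1" by eventually_elim simp
    then obtain N1 where N1: "\<And>m. m \<ge> N1 \<Longrightarrow> norm (zz (ls m)) < Z \<and> e m < min d 1"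
      by (auto simp: eventually_sequentially)
    obtain N2 where N2: "\<And>m n. m \<ge> N2 \<Longrightarrow> n \<ge> N2 \<Longrightarrow> dist (zz (ls m)) (zz (ls n)) < d'"
      using LIMSEQ_imp_Cauchy[OF z] metric_CauchyD d(2) by metis
    have "dist (zz (act (us m) (ls m))) (zz (act (us n) (ls n))) < r" if "m \<ge> max N1 N2" "n \<ge> max N1 N2" for m n
    proof -
      have 1: "norm (zz (ls m)) < Z" "e m < d" "e n < d" "e n < 1" "norm (zz (ls m) - zz (ls n)) < d'"
        using N1[of m] N1[of n] N2[of m n] that by (auto simp: dist_norm)
      have e0: "0 \<le> e m" "0 \<le> e n" using order_trans[OF norm_ge_zero e(2)] by auto
      have "norm (zz (act (us m) (ls m)) - zz (act (us n) (ls n))) \<le> (e m + e n) * norm (zz (ls m)) + (B + e n) * norm (zz (ls m) - zz (ls n))"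
      proof (rule zz_diff_bound[OF l(2,2,1,1)])
        show "cmod (us m a - us n a) \<le> e m + e n" for a
          using norm_triangle_mono[OF e(2)[of m a], of "u a - us n a" "e n"] e(2)[of n a] by (simp add: norm_minus_commute)
      qed (rule e(3))
      also have "\<dots> \<le> (e m + e n) * Z + (B + 1) * norm (zz (ls m) - zz (ls n))"
        using 1 e0 B by (intro add_mono mult_mono) auto
      also have "\<dots> < (d + d) * Z + (B + 1) * d'"
        using 1 B Z by (intro add_strict_mono mult_strict_right_mono mult_strict_left_mono) auto
      also have "\<dots> = r" using Z B by (simp add: d_def d'_def field_simps)
      finally show ?thesis by (simp add: dist_norm)
    qed
    then show "\<exists>M. \<forall>m\<ge>M. \<forall>n\<ge>M. dist (zz (act (us m) (ls m))) (zz (act (us n) (ls n))) < r" by blast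
  qed
  then show ?thesis by (rule Cauchy_convergent)
qed

definition T :: "('a \<Rightarrow> complex) \<Rightarrow> l2 \<Rightarrow> l2" where
  "T u p = lim (\<lambda>m. zz (act ((SOME us. uconv us u) m) ((SOME ls. lconv ls p) m)))"

text \<open>Frees \<open>T\<close> from the sequences chosen in its definition: any pair of
  approximating sequences computes it.\<close>

lemma T_lim:
  assumes us: "uconv us u" and ls: "lconv ls p" and u: "continuous_on UNIV u"
  shows "(\<lambda>m. zz (act (us m) (ls m))) \<longlonglongrightarrow> T u p"
proof -
  have us': "uconv (SOME us. uconv us u) u" and ls': "lconv (SOME ls. lconv ls p) p"
    using someI[of "\<lambda>us. uconv us u", OF us] someI[of "\<lambda>ls. lconv ls p", OF ls] .
  have "(\<lambda>m. zz (act ((SOME us. uconv us u) m) ((SOME ls. lconv ls p) m))) \<longlonglongrightarrow> T u p"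
    unfolding T_def using zz_act_convergent[OF us' ls' u] convergent_LIMSEQ_iff by blast
  from tendsto_add[OF zz_act_diff_tendsto[OF us us' ls ls' u] this] show ?thesis by simp
qed

lemma closed_S: "closed S" by (simp add: S_def)

lemma lconv_act: "uconv us u \<Longrightarrow> lconv ls p \<Longrightarrow> continuous_on UNIV u \<Longrightarrow> lconv (\<lambda>m. act (us m) (ls m)) (T u p)"
  using T_lim act_in unfolding lconv_def uconv_def by blast

lemma lconv_append: "lconv ls p \<Longrightarrow> lconv ls' p' \<Longrightarrow> lconv (\<lambda>m. ls m @ ls' m) (p + p')"
  unfolding lconv_def zz_append by (auto intro: tendsto_add)

lemma lconv_scale:
  assumes "uconv (\<lambda>m _. qs m) (\<lambda>_. c)" "qs \<longlonglongrightarrow> c" "lconv ls p"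
  shows "lconv (\<lambda>m. act (\<lambda>_. qs m) (ls m)) (scaleC c p)"
proof -
  have "zz (act (\<lambda>_. qs m) (ls m)) = scaleC (qs m) (zz (ls m))" for m
    using assms by (intro zz_scale) (auto simp: uconv_def lconv_def)
  moreover have "(\<lambda>m. scaleC (qs m) (zz (ls m))) \<longlonglongrightarrow> scaleC c p"
    using assms by (intro scaleC.tendsto) (auto simp: lconv_def)
  moreover have "act (\<lambda>_. qs m) (ls m) \<in> L" for m
    using assms by (intro act_in) (auto simp: uconv_def lconv_def)
  ultimately show ?thesis by (simp add: lconv_def)
qed

lemma csubspace_S: "csubspace S"
  unfolding csubspace_def
proof (intro conjI ballI allI)
  have "zz [] = 0" by (simp add: zz_def)
  then show "0 \<in> S" unfolding S_def by (intro subsetD[OF closure_subset]) (auto intro!: image_eqI[of _ _ "[]"])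
  fix x assume "x \<in> S"
  then obtain ls where ls: "lconv ls x" using S_lconv by blast
  show "scaleC c x \<in> S" for c using uconv_const_fun[of c] lconv_scale[OF _ _ ls] S_lconv by blast
  fix y assume "y \<in> S"
  then obtain ls' where "lconv ls' y" using S_lconv by blast
  then show "x + y \<in> S" using lconv_append[OF ls] S_lconv by blast
qed

lemma T_in: "continuous_on UNIV u \<Longrightarrow> p \<in> S \<Longrightarrow> T u p \<in> S"
  using lconv_act uconv_ex S_lconv by metis

context
  fixes u v :: "'a \<Rightarrow> complex" and p p' :: l2
  assumes u: "continuous_on UNIV u" and v: "continuous_on UNIV v" and p: "p \<in> S" and p': "p' \<in> S"
begin

lemma T_add: "T u (p + p') = T u p + T u p'"
proof -
  obtain ls ls' us where *: "lconv ls p" "lconv ls' p'" "uconv us u" using uconv_ex[OF u] p p' S_lconv by blast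
  have "(\<lambda>m. zz (act (us m) (ls m)) + zz (act (us m) (ls' m))) \<longlonglongrightarrow> T u p + T u p'"
    by (intro tendsto_add T_lim * u)
  then show ?thesis using T_lim[OF *(3) lconv_append[OF *(1,2)] u] LIMSEQ_unique
    by (simp add: act_append zz_append) blast
qed

text \<open>Both equations hold because a constant acting before or after \<open>us m\<close>, or
  multiplied into it, gives the same list.\<close>

lemma T_scale: "T u (scaleC c p) = scaleC c (T u p)"
  and T_uscale: "T (\<lambda>a. c * u a) p = scaleC c (T u p)"
proof -
  obtain ls us where *: "lconv ls p" "uconv us u" using uconv_ex[OF u] p S_lconv by blast
  obtain qs where q: "uconv (\<lambda>m _. qs m) (\<lambda>_. c)" "qs \<longlonglongrightarrow> c" using uconv_const_fun by blast
  have "lconv (\<lambda>m. act (\<lambda>_. qs m) (act (us m) (ls m))) (scaleC c (T u p))"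
    by (intro lconv_scale q lconv_act * u)
  then have 1: "(\<lambda>m. zz (act (\<lambda>a. qs m * us m a) (ls m))) \<longlonglongrightarrow> scaleC c (T u p)"
    by (simp add: lconv_def act_act)
  have "(\<lambda>m. zz (act (us m) (act (\<lambda>_. qs m) (ls m)))) \<longlonglongrightarrow> T u (scaleC c p)"
    by (intro T_lim lconv_scale * q u)
  then show "T u (scaleC c p) = scaleC c (T u p)" using 1 LIMSEQ_unique by (simp add: act_act mult.commute) blast
  have "(\<lambda>m. zz (act (\<lambda>a. qs m * us m a) (ls m))) \<longlonglongrightarrow> T (\<lambda>a. c * u a) p"
    by (intro T_lim uconv_mult[OF q(1) *(2)] * continuous_intros u)
  then show "T (\<lambda>a. c * u a) p = scaleC c (T u p)" using 1 LIMSEQ_unique by blast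
qed

lemma T_uadd: "T (\<lambda>a. u a + v a) p = T u p + T v p"
proof -
  obtain ls us vs where *: "lconv ls p" "uconv us u" "uconv vs v" using uconv_ex[OF u] uconv_ex[OF v] p S_lconv by blast
  have "(\<lambda>m. zz (act (us m) (ls m)) + zz (act (vs m) (ls m))) \<longlonglongrightarrow> T u p + T v p"
    by (intro tendsto_add T_lim * u v)
  moreover have "zz (act (us m) (ls m)) + zz (act (vs m) (ls m)) = zz (act (\<lambda>a. us m a + vs m a) (ls m))" for m
    using * by (intro zz_add[symmetric]) (auto simp: uconv_def lconv_def)
  moreover have "(\<lambda>m. zz (act (\<lambda>a. us m a + vs m a) (ls m))) \<longlonglongrightarrow> T (\<lambda>a. u a + v a) p"
    by (intro T_lim uconv_add * continuous_intros u v)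
  ultimately show ?thesis using LIMSEQ_unique by simp blast
qed

lemma T_mult: "T (\<lambda>a. u a * v a) p = T u (T v p)"
proof -
  obtain ls us vs where *: "lconv ls p" "uconv us u" "uconv vs v" using uconv_ex[OF u] uconv_ex[OF v] p S_lconv by blast
  have "(\<lambda>m. zz (act (us m) (act (vs m) (ls m)))) \<longlonglongrightarrow> T u (T v p)"
    by (intro T_lim lconv_act * u v)
  moreover have "(\<lambda>m. zz (act (\<lambda>a. us m a * vs m a) (ls m))) \<longlonglongrightarrow> T (\<lambda>a. u a * v a) p"
    by (intro T_lim uconv_mult * continuous_intros u v)
  ultimately show ?thesis using LIMSEQ_unique by (simp add: act_act) blast
qed

lemma T_adj: "ip2 (T u p) p' = ip2 p (T (\<lambda>a. cnj (u a)) p')"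
proof -
  obtain ls ls' us where *: "lconv ls p" "lconv ls' p'" "uconv us u" using uconv_ex[OF u] p p' S_lconv by blast
  have z: "(\<lambda>m. zz (ls m)) \<longlonglongrightarrow> p" "(\<lambda>m. zz (ls' m)) \<longlonglongrightarrow> p'" using * by (auto simp: lconv_def)
  have "(\<lambda>m. ip2 (zz (act (us m) (ls m))) (zz (ls' m))) \<longlonglongrightarrow> ip2 (T u p) p'"
    by (intro ip2.tendsto T_lim * u z)
  moreover have "(\<lambda>m. ip2 (zz (ls m)) (zz (act (\<lambda>a. cnj (us m a)) (ls' m)))) \<longlonglongrightarrow> ip2 p (T (\<lambda>a. cnj (u a)) p')"
    by (intro ip2.tendsto T_lim uconv_cnj * continuous_intros u z)
  moreover have "ip2 (zz (act (us m) (ls m))) (zz (ls' m)) = ip2 (zz (ls m)) (zz (act (\<lambda>a. cnj (us m a)) (ls' m)))" for m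
    using * by (intro zz_adj) (auto simp: uconv_def lconv_def)
  ultimately show ?thesis using LIMSEQ_unique by simp
qed

lemma T_one: "T (\<lambda>_. 1) p = p"
proof -
  obtain ls where *: "lconv ls p" using p S_lconv by blast
  have "(\<lambda>m. zz (act (\<lambda>_. 1) (ls m))) \<longlonglongrightarrow> T (\<lambda>_. 1) p"
    by (intro T_lim uconv_const D_simps * continuous_intros)
  then show ?thesis using * LIMSEQ_unique by (auto simp: act_one lconv_def)
qed

lemma T_bound:
  assumes "\<And>a. cmod (u a) \<le> B"
  shows "norm (T u p) \<le> B * norm p"
proof -
  obtain ls us where *: "lconv ls p" "uconv us u" using uconv_ex[OF u] p S_lconv by blast
  obtain e where e: "e \<longlonglongrightarrow> 0" "\<And>m a. cmod (us m a) \<le> B + e m" using uconv_bound[OF *(2) assms] by blast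
  have "(\<lambda>m. norm (zz (act (us m) (ls m)))) \<longlonglongrightarrow> norm (T u p)" by (intro tendsto_norm T_lim * u)
  moreover have "(\<lambda>m. (B + e m) * norm (zz (ls m))) \<longlonglongrightarrow> (B + 0) * norm p"
    using * by (intro tendsto_intros e) (auto simp: lconv_def)
  moreover have "norm (zz (act (us m) (ls m))) \<le> (B + e m) * norm (zz (ls m))" for m
    using * e by (intro zz_bound) (auto simp: lconv_def uconv_def)
  ultimately show ?thesis using LIMSEQ_le[of _ "norm (T u p)" _ "(B + 0) * norm p"] by auto
qed

end

section \<open>The unital representation on all of l2\<close>

text \<open>\<open>undefined\<close> serves as the fixed point of \<open>A\<close>.\<close>
definition rho :: "('a \<Rightarrow> complex) \<Rightarrow> l2 \<Rightarrow> l2" where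
  "rho u \<xi> = T u (proj S \<xi>) + scaleC (u undefined) (\<xi> - proj S \<xi>)"

lemmas proj_S = proj_in[OF closed_S csubspace_S]
lemmas proj_S_add = proj_add[OF closed_S csubspace_S]
lemmas proj_S_scaleC = proj_scaleC[OF closed_S csubspace_S]

lemma rho_add: "continuous_on UNIV u \<Longrightarrow> rho u (\<xi> + \<eta>) = rho u \<xi> + rho u \<eta>"
  using T_add[of u u "proj S \<xi>" "proj S \<eta>"] proj_S
  by (simp add: rho_def proj_S_add scaleC.diff_right scaleC.add_right)

lemma rho_scale: "continuous_on UNIV u \<Longrightarrow> rho u (scaleC c \<xi>) = scaleC c (rho u \<xi>)"
  using T_scale[of u u "proj S \<xi>" "proj S \<xi>" c] proj_S
  by (simp add: rho_def proj_S_scaleC scaleC.add_right scaleC.diff_right mult.commute)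

lemma rho_uadd: "continuous_on UNIV u \<Longrightarrow> continuous_on UNIV v \<Longrightarrow> rho (\<lambda>a. u a + v a) \<xi> = rho u \<xi> + rho v \<xi>"
  using T_uadd[of u v "proj S \<xi>" "proj S \<xi>"] proj_S
  by (simp add: rho_def scaleC.add_left)

lemma rho_uscale: "continuous_on UNIV u \<Longrightarrow> rho (\<lambda>a. c * u a) \<xi> = scaleC c (rho u \<xi>)"
  using T_uscale[of u u "proj S \<xi>" "proj S \<xi>" c] proj_S
  by (simp add: rho_def scaleC.add_right)

lemma rho_one: "rho (\<lambda>_. 1) \<xi> = \<xi>"
  using T_one[of "\<lambda>_. 1" "\<lambda>_. 1" "proj S \<xi>" "proj S \<xi>"] proj_S by (simp add: rho_def)

text \<open>\<open>rho\<close> is block diagonal for \<open>S\<close> and its orthogonal complement,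
  so products and adjoints may be checked on each block.\<close>

lemma proj_rho: "continuous_on UNIV u \<Longrightarrow> proj S (rho u \<xi>) = T u (proj S \<xi>)"
proof (rule proj_unique[OF closed_S csubspace_S])
  show "continuous_on UNIV u \<Longrightarrow> T u (proj S \<xi>) \<in> S" by (rule T_in[OF _ proj_S])
  show "ip2 (rho u \<xi> - T u (proj S \<xi>)) m = 0" if "m \<in> S" for m
    using ip2_proj_orth[OF closed_S csubspace_S that, of \<xi>] by (simp add: rho_def ip2_scaleC_left)
qed

lemma rho_mult:
  assumes "continuous_on UNIV u" "continuous_on UNIV v"
  shows "rho (\<lambda>a. u a * v a) \<xi> = rho u (rho v \<xi>)"
proof -
  have "rho u (rho v \<xi>) = T u (T v (proj S \<xi>)) + scaleC (u undefined) (scaleC (v undefined) (\<xi> - proj S \<xi>))"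
    unfolding rho_def[of u "rho v \<xi>"] proj_rho[OF assms(2)] by (simp add: rho_def)
  then show ?thesis using T_mult[OF assms proj_S proj_S] by (simp add: rho_def)
qed

lemma rho_adj:
  assumes u: "continuous_on UNIV u"
  shows "ip2 (rho u \<xi>) \<eta> = ip2 \<xi> (rho (\<lambda>a. cnj (u a)) \<eta>)"
proof -
  have cu: "continuous_on UNIV (\<lambda>a. cnj (u a))" using u by (intro continuous_intros)
  note o = ip2_proj_orth[OF closed_S csubspace_S]
  have o': "ip2 m (\<xi> - proj S \<xi>) = 0" if "m \<in> S" for m \<xi>
    using o[OF that, of \<xi>] ip2_cnj[of m "\<xi> - proj S \<xi>"] by simp
  note Tin = T_in[OF u proj_S] T_in[OF cu proj_S]
  have "ip2 (rho u \<xi>) \<eta> = ip2 (rho u \<xi>) (proj S \<eta> + (\<eta> - proj S \<eta>))" by simp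
  also have "\<dots> = ip2 (T u (proj S \<xi>)) (proj S \<eta>) + u undefined * ip2 (\<xi> - proj S \<xi>) (\<eta> - proj S \<eta>)"
    unfolding rho_def ip2.add_left ip2.add_right ip2_scaleC_left
    using o[OF proj_S, of \<xi> \<eta>] o'[OF Tin(1), of \<xi> \<eta>] by simp
  also have "\<dots> = ip2 (proj S \<xi>) (T (\<lambda>a. cnj (u a)) (proj S \<eta>)) + u undefined * ip2 (\<xi> - proj S \<xi>) (\<eta> - proj S \<eta>)"
    using T_adj[OF u u proj_S proj_S] by simp
  also have "\<dots> = ip2 (proj S \<xi> + (\<xi> - proj S \<xi>)) (rho (\<lambda>a. cnj (u a)) \<eta>)"
    unfolding rho_def ip2.add_left ip2.add_right ip2_scaleC_right
    using o[OF Tin(2), of \<xi> \<eta>] o'[OF proj_S, of \<xi> \<eta>] by simp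
  finally show ?thesis by simp
qed

lemma rho_bound:
  assumes u: "continuous_on UNIV u"
  shows "\<exists>C. \<forall>\<xi>. norm (rho u \<xi>) \<le> C * norm \<xi>"
proof -
  obtain B where B: "B > 0" "\<And>a. norm (u a) \<le> B" using compact_UNIV_bound[OF cpt u] by blast
  have "norm (rho u \<xi>) \<le> (2 * B) * norm \<xi>" for \<xi>
  proof -
    have py: "(norm \<xi>)\<^sup>2 = (norm (\<xi> - proj S \<xi>))\<^sup>2 + (norm (proj S \<xi>))\<^sup>2"
      using norm_proj_pythagoras[OF closed_S csubspace_S, of 0 \<xi>] csubspace_S by (simp add: csubspace_def)
    have n: "norm (proj S \<xi>) \<le> norm \<xi>" "norm (\<xi> - proj S \<xi>) \<le> norm \<xi>"
      by (rule power2_le_imp_le; simp add: py)+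
    have "norm (rho u \<xi>) \<le> B * norm (proj S \<xi>) + B * norm (\<xi> - proj S \<xi>)"
      unfolding rho_def using B T_bound[OF u u proj_S proj_S]
      by (intro norm_triangle_mono) (auto simp: norm_scaleC intro!: mult_right_mono)
    also have "\<dots> \<le> B * norm \<xi> + B * norm \<xi>" using n B by (intro add_mono mult_left_mono) auto
    finally show ?thesis by simp
  qed
  then show ?thesis by blast
qed

text \<open>On a generating vector the constant sequence of one-element lists is admissible. Taken
  at \<open>v = 1\<close>, this recovers the compression to \<open>H\<close> in
  \<open>ip2_dil_one\<close>.\<close>

lemma rho_k:
  assumes "continuous_on UNIV u" "uconv us u" "v \<in> D"
  shows "(\<lambda>m. k (\<lambda>a. us m a * v a) j) \<longlonglongrightarrow> rho u (k v j)"
proof -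
  have l: "lconv (\<lambda>_. [(v, j)]) (k v j)" using assms(3) by (simp add: lconv_def zz_def)
  then have "k v j \<in> S" using S_lconv by blast
  then have "proj S (k v j) = k v j" by (rule proj_id[OF closed_S csubspace_S])
  then show ?thesis using T_lim[OF assms(2) l assms(1)] by (simp add: rho_def zz_def act_def scaleC.zero_right)
qed

text \<open>Near-minimizers of the distance to the dense part converge to the projection; they can be
  chosen measurably, unlike the limits defining \<^const>\<open>T\<close>.\<close>
lemma rho_near_minimizer:
  fixes E :: "nat \<Rightarrow> (('a \<Rightarrow> complex) \<times> nat) list"
  assumes u: "continuous_on UNIV u" "uconv us u" and E: "range E = L"
    and N: "\<And>m. (norm (\<xi> - zz (E (N m))))\<^sup>2 < (INF n. (norm (\<xi> - zz (E n)))\<^sup>2) + 1 / real (Suc m)"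
  shows "(\<lambda>m. ip2 (zz (act (us m) (E (N m)))) \<eta> + u undefined * ip2 (\<xi> - zz (E (N m))) \<eta>) \<longlonglongrightarrow> ip2 (rho u \<xi>) \<eta>"
proof -
  let ?d = "(norm (\<xi> - proj S \<xi>))\<^sup>2"
  have EL: "E n \<in> L" for n using E by blast
  have inS: "zz (E n) \<in> S" for n unfolding S_def by (intro subsetD[OF closure_subset] imageI EL)
  \<comment> \<open>By Pythagoras the excess of the squared distance over its minimum is the squared
    distance to the projection.\<close>
  have py: "(norm (\<xi> - zz (E n)))\<^sup>2 = ?d + (norm (proj S \<xi> - zz (E n)))\<^sup>2" for n
    by (rule norm_proj_pythagoras[OF closed_S csubspace_S inS])
  have "(INF n. (norm (\<xi> - zz (E n)))\<^sup>2) \<le> ?d"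
  proof -
    obtain ls where ls: "lconv ls (proj S \<xi>)" using S_lconv proj_S by blast
    have "(INF n. (norm (\<xi> - zz (E n)))\<^sup>2) \<le> (norm (\<xi> - zz (ls m)))\<^sup>2" for m
    proof -
      have "ls m \<in> range E" using ls E by (simp add: lconv_def)
      then obtain n where n: "ls m = E n" by blast
      show ?thesis unfolding n by (rule cINF_lower) (auto intro!: bdd_belowI[of _ 0])
    qed
    moreover have "(\<lambda>m. (norm (\<xi> - zz (ls m)))\<^sup>2) \<longlonglongrightarrow> ?d"
      using ls by (intro tendsto_intros) (auto simp: lconv_def)
    ultimately show ?thesis by (intro LIMSEQ_le_const) auto
  qed
  then have b: "(norm (zz (E (N m)) - proj S \<xi>))\<^sup>2 \<le> 1 / real (Suc m)" for m
    using N[of m] py[of "N m"] by (simp add: norm_minus_commute del: of_nat_Suc)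
  have "(\<lambda>m. (norm (zz (E (N m)) - proj S \<xi>))\<^sup>2) \<longlonglongrightarrow> 0"
    by (rule Lim_null_comparison[OF _ LIMSEQ_Suc[OF lim_1_over_n]]) (use b in \<open>auto intro!: always_eventually\<close>)
  then have "(\<lambda>m. sqrt ((norm (zz (E (N m)) - proj S \<xi>))\<^sup>2)) \<longlonglongrightarrow> sqrt 0" by (rule tendsto_real_sqrt)
  then have "(\<lambda>m. norm (zz (E (N m)) - proj S \<xi>)) \<longlonglongrightarrow> 0" by simp
  then have z: "(\<lambda>m. zz (E (N m))) \<longlonglongrightarrow> proj S \<xi>" using tendsto_norm_zero_iff LIM_zero_iff by blast
  \<comment> \<open>Any sequence of lists tending to the projection computes \<open>T\<close>, in
    particular this one, whose indices can be selected measurably.\<close>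
  then have "lconv (\<lambda>m. E (N m)) (proj S \<xi>)" using EL by (simp add: lconv_def)
  from T_lim[OF u(2) this u(1)] z show ?thesis
    unfolding rho_def ip2.add_left ip2_scaleC_left by (intro tendsto_intros ip2.tendsto)
qed

end

section \<open>The pointwise dilation\<close>

lemma (in hilbert_space) bounded_ops_diff:
  assumes T: "T \<in> bounded_ops H H" and ab: "a \<in> carrier H" "b \<in> carrier H"
  shows "T (a \<ominus> b) = T a \<ominus> T b"
proof -
  note Tin = bounded_opsD(1)[OF T]
  have "a = (a \<ominus> b) \<oplus> b" using ab by (simp add: a_minus_def M.a_assoc M.l_neg)
  then have "T a = T (a \<ominus> b) \<oplus> T b" using bounded_opsD(2)[OF T, of "a \<ominus> b" b] ab by simp
  then show ?thesis using ab Tin by (intro ip_eqI) (auto simp: ip_diff_left ip_add)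
qed

context ucp_map
begin

lemma rep_bounded_op: "continuous_on UNIV u \<Longrightarrow> x \<in> space \<mu> \<Longrightarrow> rep u x \<in> bounded_ops H H"
  using ess_boundedD(1)[OF rep(1)] .

text \<open>Says that multiplication by \<open>u\<close> has norm at most \<open>c\<close> on the
  combinations of the \<open>v i\<close> in the Stinespring form at \<open>x\<close>.\<close>

definition dominated :: "'x \<Rightarrow> real \<Rightarrow> ('a \<Rightarrow> complex) \<Rightarrow> nat \<Rightarrow> (nat \<Rightarrow> 'a \<Rightarrow> complex) \<Rightarrow> bool" where
  "dominated x c u n v \<longleftrightarrow> (\<forall>\<xi>. (\<forall>i<n. \<xi> i \<in> carrier H) \<longrightarrow>
     Re (\<Sum>i<n. \<Sum>j<n. ip H (rep (\<lambda>a. cnj (u a * v i a) * (u a * v j a)) x (\<xi> j)) (\<xi> i)) \<le> c\<^sup>2 * Re (gform x n v \<xi>))"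

text \<open>Choose \<open>s\<close> with \<open>s^2 + |u|^2 = c^2\<close>. Positivity for the
  functions \<open>s * v i\<close> is then exactly the difference of the two sides.\<close>

lemma rep_dominated:
  fixes n :: nat
  assumes v: "\<And>i. i < n \<Longrightarrow> continuous_on UNIV (v i)" and u: "continuous_on UNIV u"
    and c: "\<And>a. cmod (u a) \<le> c"
  shows "AE x in \<mu>. dominated x c u n v"
proof -
  define s where "s a = complex_of_real (sqrt (c\<^sup>2 - (cmod (u a))\<^sup>2))" for a
  define w where "w i = (\<lambda>a. s a * v i a)" for i
  have s: "continuous_on UNIV s" unfolding s_def using u by (intro continuous_intros)
  have w: "continuous_on UNIV (w i)" if "i < n" for i unfolding w_def using s v[OF that] by (intro continuous_intros)
  have su: "cnj (s a) * s a + cnj (u a) * u a = complex_of_real (c\<^sup>2)" for a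
  proof -
    have "(cmod (u a))\<^sup>2 \<le> c\<^sup>2" using c by (intro power_mono) auto
    then have "cnj (s a) * s a = complex_of_real (c\<^sup>2 - (cmod (u a))\<^sup>2)"
      unfolding s_def complex_cnj_complex_of_real of_real_mult[symmetric] by simp
    moreover have "cnj (u a) * u a = complex_of_real ((cmod (u a))\<^sup>2)"
      using complex_norm_square[of "u a"] by (simp add: mult.commute)
    ultimately show ?thesis by simp
  qed
  have lin: "AE x in \<mu>. \<forall>\<xi>\<in>carrier H. complex_of_real (c\<^sup>2) \<odot> rep (\<lambda>a. cnj (v i a) * v j a) x \<xi>
      = rep (\<lambda>a. cnj (w i a) * w j a) x \<xi> \<oplus> rep (\<lambda>a. cnj (u a * v i a) * (u a * v j a)) x \<xi>"
    if ij: "i < n" "j < n" for i j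
  proof -
    have f: "(\<lambda>a. cnj (w i a) * w j a + cnj (u a * v i a) * (u a * v j a)) = (\<lambda>a. complex_of_real (c\<^sup>2) * (cnj (v i a) * v j a))"
    proof
      fix a
      have "cnj (w i a) * w j a + cnj (u a * v i a) * (u a * v j a) = (cnj (s a) * s a + cnj (u a) * u a) * (cnj (v i a) * v j a)"
        by (simp add: w_def algebra_simps)
      then show "cnj (w i a) * w j a + cnj (u a * v i a) * (u a * v j a) = complex_of_real (c\<^sup>2) * (cnj (v i a) * v j a)"
        by (simp only: su)
    qed
    have 1: "continuous_on UNIV (\<lambda>a. cnj (w i a) * w j a)" using w ij by (intro continuous_intros)
    have 2: "continuous_on UNIV (\<lambda>a. cnj (u a * v i a) * (u a * v j a))" using u v ij by (intro continuous_intros)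
    have 3: "continuous_on UNIV (\<lambda>a. cnj (v i a) * v j a)" using v ij by (intro continuous_intros)
    show ?thesis using rep_add[OF 1 2, unfolded f] rep_smult[OF 3, of "complex_of_real (c\<^sup>2)"]
      by eventually_elim simp
  qed
  have "AE x in \<mu>. \<forall>i\<in>{..<n}. \<forall>j\<in>{..<n}. \<forall>\<xi>\<in>carrier H. complex_of_real (c\<^sup>2) \<odot> rep (\<lambda>a. cnj (v i a) * v j a) x \<xi>
      = rep (\<lambda>a. cnj (w i a) * w j a) x \<xi> \<oplus> rep (\<lambda>a. cnj (u a * v i a) * (u a * v j a)) x \<xi>"
    by (rule AE_finite_allI[OF finite_lessThan], rule AE_finite_allI[OF finite_lessThan], rule lin) auto
  moreover have "AE x in \<mu>. cp_at x n w" by (rule rep_positive) (rule w)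
  ultimately show ?thesis using AE_space
  proof eventually_elim
    case (elim x)
    show ?case unfolding dominated_def
    proof (intro allI impI)
      fix \<xi> :: "nat \<Rightarrow> 'h" assume xi: "\<forall>i<n. \<xi> i \<in> carrier H"
      have eq: "ip H (rep (\<lambda>a. cnj (w i a) * w j a) x (\<xi> j)) (\<xi> i)
          = of_real (c\<^sup>2) * ip H (rep (\<lambda>a. cnj (v i a) * v j a) x (\<xi> j)) (\<xi> i)
            - ip H (rep (\<lambda>a. cnj (u a * v i a) * (u a * v j a)) x (\<xi> j)) (\<xi> i)" if ij: "i < n" "j < n" for i j
      proof -
        have 1: "continuous_on UNIV (\<lambda>a. cnj (w i a) * w j a)" using w ij by (intro continuous_intros)
        have 2: "continuous_on UNIV (\<lambda>a. cnj (u a * v i a) * (u a * v j a))" using u v ij by (intro continuous_intros)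
        have 3: "continuous_on UNIV (\<lambda>a. cnj (v i a) * v j a)" using v ij by (intro continuous_intros)
        have x: "\<xi> i \<in> carrier H" "\<xi> j \<in> carrier H" using xi ij by auto
        note r = rep_in[OF 1 elim(3) x(2)] rep_in[OF 2 elim(3) x(2)] rep_in[OF 3 elim(3) x(2)]
        have "ip H (complex_of_real (c\<^sup>2) \<odot> rep (\<lambda>a. cnj (v i a) * v j a) x (\<xi> j)) (\<xi> i)
          = ip H (rep (\<lambda>a. cnj (w i a) * w j a) x (\<xi> j) \<oplus> rep (\<lambda>a. cnj (u a * v i a) * (u a * v j a)) x (\<xi> j)) (\<xi> i)"
          using elim(1) ij x by simp
        then show ?thesis unfolding ip_smult[OF r(3) x(1)] ip_add[OF r(1,2) x(1)] by simp
      qed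
      have "0 \<le> Re (gform x n w \<xi>)"
        using elim(2) xi unfolding cp_at_def by blast
      also have "(gform x n w \<xi>)
        = of_real (c\<^sup>2) * (gform x n v \<xi>)
          - (\<Sum>i<n. \<Sum>j<n. ip H (rep (\<lambda>a. cnj (u a * v i a) * (u a * v j a)) x (\<xi> j)) (\<xi> i))"
        by (simp only: sum_distrib_left sum_subtractf[symmetric]) (intro sum.cong refl, use eq in auto)
      finally show "Re (\<Sum>i<n. \<Sum>j<n. ip H (rep (\<lambda>a. cnj (u a * v i a) * (u a * v j a)) x (\<xi> j)) (\<xi> i))
         \<le> c\<^sup>2 * Re (gform x n v \<xi>)"
        by simp
    qed
  qed
qed

text \<open>Kadison--Schwarz, from positivity on \<open>w \<otimes> \<xi> - 1 \<otimes> \<phi>\<^sub>x(w) \<xi>\<close>.\<close>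
lemma rep_contraction:
  assumes w: "continuous_on UNIV w" and c: "\<And>a. cmod (w a) \<le> c"
  shows "AE x in \<mu>. \<forall>\<xi>\<in>carrier H. ip_norm H (rep w x \<xi>) \<le> c * ip_norm H \<xi>"
proof -
  have c0: "0 \<le> c" using order_trans[OF norm_ge_zero c] .
  have c1: "continuous_on UNIV (\<lambda>a::'a. 1 :: complex)" by (intro continuous_intros)
  have "AE x in \<mu>. cp_at x 2 (\<lambda>i. if i = 0 then w else (\<lambda>_. 1))" by (rule rep_positive) (use w c1 in auto)
  \<comment> \<open>With the single function one this bounds the diagonal value of the image of
    \<open>|w|^2\<close> at \<open>\<xi>\<close> by \<open>c^2\<close> times the squared norm of
    \<open>\<xi>\<close>.\<close>
  moreover have "AE x in \<mu>. dominated x c w 1 (\<lambda>_ _. 1)" by (rule rep_dominated) (rule c1 w c)+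
  ultimately show ?thesis using rep_one AE_space
  proof eventually_elim
    case (elim x)
    show ?case
    proof
      fix \<xi> assume xi: "\<xi> \<in> carrier H"
      define \<zeta> where "\<zeta> = rep w x \<xi>"
      have z: "\<zeta> \<in> carrier H" unfolding \<zeta>_def by (rule rep_in[OF w elim(4) xi])
      define mz where "mz = (-1) \<odot> \<zeta>"
      have mz: "mz \<in> carrier H" using z by (simp add: mz_def)
      \<comment> \<open>Of the four terms, the first is at most
        \<open>(c * ip_norm H \<xi>)^2\<close>, the two cross terms each equal minus the squared
        norm of \<open>\<zeta>\<close>, and the last equals plus it.\<close>
      have "0 \<le> Re (gform x 2 (\<lambda>i. if i = 0 then w else (\<lambda>_. 1)) (\<lambda>i. if i = 0 then \<xi> else mz))"
        by (rule elim(1)[unfolded cp_at_def, THEN conjunct2, rule_format]) (use xi mz in simp)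
      then have "0 \<le> Re (ip H (rep (\<lambda>a. cnj (w a) * w a) x \<xi>) \<xi>) + Re (ip H (rep (\<lambda>a. cnj (w a)) x mz) \<xi>)
          + Re (ip H (rep w x \<xi>) mz) + Re (ip H (rep (\<lambda>a. 1) x mz) mz)"
        by (simp add: numeral_2_eq_2)
      moreover have "ip H (rep (\<lambda>a. cnj (w a)) x mz) \<xi> = cnj (ip H (rep w x \<xi>) mz)"
        using elim(1)[unfolded cp_at_def, THEN conjunct1, rule_format, of 0 1 mz \<xi>] xi mz by simp
      moreover have "ip H (rep w x \<xi>) mz = - of_real ((ip_norm H \<zeta>)\<^sup>2)"
        unfolding mz_def \<zeta>_def[symmetric] using z by (simp add: ip_smult_right ip_self)
      moreover have "ip H (rep (\<lambda>a. 1) x mz) mz = of_real ((ip_norm H \<zeta>)\<^sup>2)"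
        using elim(3) mz z unfolding mz_def by (simp add: ip_smult ip_smult_right) (simp add: ip_self)
      moreover have "Re (ip H (rep (\<lambda>a. cnj (w a) * w a) x \<xi>) \<xi>) \<le> (c * ip_norm H \<xi>)\<^sup>2"
        using elim(2)[unfolded dominated_def, rule_format, of "\<lambda>_. \<xi>"] elim(3) xi
        by (simp add: ip_self power_mult_distrib)
      ultimately have "(ip_norm H \<zeta>)\<^sup>2 \<le> (c * ip_norm H \<xi>)\<^sup>2" by simp
      then show "ip_norm H (rep w x \<xi>) \<le> c * ip_norm H \<xi>"
        unfolding \<zeta>_def by (rule power2_le_imp_le) (use c0 xi in simp)
    qed
  qed
qed

end

section \<open>Good base points and the Gram kernel of the orthogonal parts\<close>

locale dilation = ucp_map H \<mu> \<phi> for H :: "('h, 'm) inner_prod_space_scheme" (structure)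
    and \<mu> :: "'x measure" and \<phi> :: "('a :: topological_space \<Rightarrow> complex) \<Rightarrow> ('x \<Rightarrow> 'h \<Rightarrow> 'h) set" +
  fixes D :: "('a \<Rightarrow> complex) set" and h :: "nat \<Rightarrow> 'h"
  assumes cpt: "compact (UNIV :: 'a set)"
    and D: "dense_alg D"
    and h_in: "\<And>n. h n \<in> carrier H"
    and h_dense: "\<And>\<xi> e. \<xi> \<in> carrier H \<Longrightarrow> e > 0 \<Longrightarrow> \<exists>n. ip_norm H (h n \<ominus> \<xi>) < e"
begin

lemmas D_simps = dense_algD[OF D]

text \<open>Each clause ranges over a countable set, apart from the vectors of \<open>H\<close>,
  over which the almost-everywhere statements are already uniform. This is why scalars come from
  constants in \<open>D\<close>, bounds are rational and families are lists.\<close>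

definition good :: "'x \<Rightarrow> bool" where
  "good x \<longleftrightarrow> x \<in> space \<mu> \<and>
    (\<forall>u\<in>D. \<forall>v\<in>D. \<forall>\<xi>\<in>carrier H. rep (\<lambda>a. u a + v a) x \<xi> = rep u x \<xi> \<oplus> rep v x \<xi>) \<and>
    (\<forall>q\<in>{q. (\<lambda>_. q) \<in> D}. \<forall>u\<in>D. \<forall>\<xi>\<in>carrier H. rep (\<lambda>a. q * u a) x \<xi> = q \<odot> rep u x \<xi>) \<and>
    (\<forall>\<xi>\<in>carrier H. rep (\<lambda>a. 1) x \<xi> = \<xi>) \<and>
    (\<forall>vs\<in>lists D. cp_at x (length vs) ((!) vs)) \<and>
    (\<forall>u\<in>D. \<forall>c\<in>\<rat>. \<forall>vs\<in>lists D. (\<forall>a. cmod (u a) \<le> c) \<longrightarrow> dominated x c u (length vs) ((!) vs))"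

lemma AE_good: "AE x in \<mu>. good x"
proof -
  have q: "countable {q. (\<lambda>_::'a. q) \<in> D}"
  proof -
    have "inj_on (\<lambda>q. (\<lambda>_::'a. q)) {q :: complex. (\<lambda>_. q) \<in> D}" by (auto simp: inj_on_def fun_eq_iff)
    moreover have "countable ((\<lambda>q. (\<lambda>_::'a. q)) ` {q :: complex. (\<lambda>_. q) \<in> D})"
      by (rule countable_subset[OF _ D_simps(1)]) auto
    ultimately show ?thesis using countable_image_inj_on by blast
  qed
  have l: "countable (lists D)" using D_simps(1) by (rule countable_lists)
  have in_lists: "vs ! i \<in> D" if "vs \<in> lists D" "i < length vs" for vs i using that by (auto simp: in_lists_conv_set)
  have dom: "AE x in \<mu>. (\<forall>a. cmod (u a) \<le> c) \<longrightarrow> dominated x c u (length vs) ((!) vs)"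
    if "u \<in> D" "vs \<in> lists D" for u c vs
  proof (cases "\<forall>a. cmod (u a) \<le> c")
    case True
    then have "AE x in \<mu>. dominated x c u (length vs) ((!) vs)"
      using that by (intro rep_dominated D_simps in_lists) auto
    then show ?thesis by eventually_elim blast
  next
    case False
    then have "(\<forall>a. cmod (u a) \<le> c) = False" by blast
    then show ?thesis by (simp only: simp_thms eventually_True)
  qed
  show ?thesis
    unfolding good_def
    by (intro AE_conjI AE_space rep_one;
        simp only: AE_ball_countable[OF D_simps(1)] AE_ball_countable[OF q] AE_ball_countable[OF l] AE_ball_countable[OF countable_rat])
       (intro ballI rep_add rep_smult rep_positive dom D_simps in_lists; assumption)+
qed

text \<open>The Cholesky factorisation takes kernels indexed by natural numbers. The enumeration
  does not depend on \<open>x\<close>, as measurability in \<open>x\<close> requires.\<close>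

definition dn :: "nat \<Rightarrow> ('a \<Rightarrow> complex) \<times> nat" where
  "dn = from_nat_into (D \<times> UNIV)"

definition code :: "('a \<Rightarrow> complex) \<Rightarrow> nat \<Rightarrow> nat" where
  "code v j = (SOME n. dn n = (v, j))"

lemma dn: "dn n \<in> D \<times> UNIV"
  unfolding dn_def using D_simps(6) by (intro from_nat_into) auto

lemma dn_code: "v \<in> D \<Longrightarrow> dn (code v j) = (v, j)"
proof -
  assume "v \<in> D"
  then have "(v, j) \<in> D \<times> UNIV" by simp
  moreover have "countable (D \<times> (UNIV :: nat set))" using D_simps(1) by simp
  ultimately have "\<exists>n. dn n = (v, j)" unfolding dn_def using from_nat_into_surj by metis
  from someI_ex[OF this] show "dn (code v j) = (v, j)" unfolding code_def .
qed

text \<open>The Gram matrix of the components of \<open>v \<otimes> h j\<close> orthogonal to \<open>1 \<otimes> H\<close>.\<close>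
definition gram :: "'x \<Rightarrow> nat \<Rightarrow> nat \<Rightarrow> complex" where
  "gram x n m = (case dn n of (v, j) \<Rightarrow> case dn m of (w, i) \<Rightarrow>
     ip H (rep (\<lambda>a. cnj (w a) * v a) x (h j)) (h i) - ip H (rep v x (h j)) (rep w x (h i)))"

context
  fixes x assumes x: "good x"
begin

lemma good_space: "x \<in> space \<mu>" using x by (simp add: good_def)

lemma good_in: "u \<in> D \<Longrightarrow> \<xi> \<in> carrier H \<Longrightarrow> rep u x \<xi> \<in> carrier H"
  using rep_in[OF D_simps(2) good_space] .

lemma good_op: "u \<in> D \<Longrightarrow> rep u x \<in> bounded_ops H H"
  using rep_bounded_op[OF D_simps(2) good_space] .

lemma good_add: "u \<in> D \<Longrightarrow> v \<in> D \<Longrightarrow> \<xi> \<in> carrier H \<Longrightarrow> rep (\<lambda>a. u a + v a) x \<xi> = rep u x \<xi> \<oplus> rep v x \<xi>"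
  and good_scale: "(\<lambda>_. q) \<in> D \<Longrightarrow> u \<in> D \<Longrightarrow> \<xi> \<in> carrier H \<Longrightarrow> rep (\<lambda>a. q * u a) x \<xi> = q \<odot> rep u x \<xi>"
  and good_one: "\<xi> \<in> carrier H \<Longrightarrow> rep (\<lambda>a. 1) x \<xi> = \<xi>"
  using x by (simp_all add: good_def)

lemma good_cp: "vs \<in> lists D \<Longrightarrow> cp_at x (length vs) ((!) vs)"
  and good_dominated: "u \<in> D \<Longrightarrow> c \<in> \<rat> \<Longrightarrow> vs \<in> lists D \<Longrightarrow> (\<And>a. cmod (u a) \<le> c) \<Longrightarrow> dominated x c u (length vs) ((!) vs)"
  using x by (simp_all add: good_def)

lemma good_herm:
  assumes "v \<in> D" "w \<in> D" "\<xi> \<in> carrier H" "\<eta> \<in> carrier H"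
  shows "ip H (rep (\<lambda>a. cnj (v a) * w a) x \<xi>) \<eta> = cnj (ip H (rep (\<lambda>a. cnj (w a) * v a) x \<eta>) \<xi>)"
  using good_cp[of "[v, w]", unfolded cp_at_def, THEN conjunct1, rule_format, of 0 1 \<xi> \<eta>] assms by simp

lemma good_psd:
  assumes "\<And>i. i < n \<Longrightarrow> v i \<in> D" "\<And>i. i < n \<Longrightarrow> \<xi> i \<in> carrier H"
  shows "0 \<le> Re (gform x n v \<xi>)"
proof -
  have m: "map v [0..<n] \<in> lists D" using assms by auto
  from good_cp[OF m, unfolded cp_at_def, THEN conjunct2, rule_format, of \<xi>] show ?thesis using assms by auto
qed

lemma good_bound:
  assumes "\<And>i. i < n \<Longrightarrow> v i \<in> D" "\<And>i. i < n \<Longrightarrow> \<xi> i \<in> carrier H" "u \<in> D" "c \<in> \<rat>" "\<And>a. cmod (u a) \<le> c"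
  shows "Re (\<Sum>i<n. \<Sum>j<n. ip H (rep (\<lambda>a. cnj (u a * v i a) * (u a * v j a)) x (\<xi> j)) (\<xi> i)) \<le> c\<^sup>2 * Re (gform x n v \<xi>)"
proof -
  have m: "map v [0..<n] \<in> lists D" using assms by auto
  from good_dominated[OF assms(3,4) m assms(5), unfolded dominated_def, rule_format, of \<xi>] show ?thesis using assms by auto
qed

text \<open>Positivity of the full Gram form, tested on \<open>\<Sum>\<^sub>n c n v\<^sub>n \<otimes> h\<^sub>n - 1 \<otimes> s\<close> where \<open>s\<close>
  is the compression of the first sum to \<open>H\<close>.\<close>
lemma psd_gram: "psd_kernel (gram x)"
  unfolding psd_kernel_def
proof (intro conjI allI)
  show "gram x m n = cnj (gram x n m)" for n m
  proof -
    obtain v j w i where *: "dn n = (v, j)" "dn m = (w, i)" by (cases "dn n", cases "dn m") blast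
    then have D: "v \<in> D" "w \<in> D" using dn[of n] dn[of m] by auto
    show ?thesis
      using good_herm[OF D(1,2) h_in h_in, of i j] ip_cnj[OF good_in[OF D(1) h_in[of j]] good_in[OF D(2) h_in[of i]]]
      by (simp add: gram_def *)
  qed
  show "0 \<le> Re (\<Sum>n<N. \<Sum>m<N. c n * cnj (c m) * gram x n m)" for N c
  proof -
    define v where "v n = fst (dn n)" for n
    define g where "g n = h (snd (dn n))" for n
    have v: "v n \<in> D" for n using dn[of n] by (auto simp: v_def mem_Times_iff)
    have g: "g n \<in> carrier H" for n by (simp add: g_def h_in)
    have rg: "rep (v n) x (g n) \<in> carrier H" for n by (rule good_in[OF v g])
    obtain s where s: "s \<in> carrier H" "\<And>z. z \<in> carrier H \<Longrightarrow> ip H s z = (\<Sum>n<N. c n * ip H (rep (v n) x (g n)) z)"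
      using ex_lincomb[of N "\<lambda>n. rep (v n) x (g n)" c] rg by blast
    \<comment> \<open>Index \<open>N\<close> carries minus \<open>1 \<otimes> s\<close>. All
      coefficients are moved into the vectors of \<open>H\<close>, since \<open>D\<close> contains
      only countably many constants while \<open>c\<close> is arbitrary.\<close>
    define v' where "v' i = (if i < N then v i else (\<lambda>_. 1))" for i
    define \<xi> where "\<xi> i = (if i < N then c i \<odot> g i else (-1) \<odot> s)" for i
    have xi: "\<xi> i \<in> carrier H" for i using g s by (simp add: \<xi>_def)
    have v': "v' i \<in> D" for i using v D_simps(6) by (simp add: v'_def)
    define A where "A = (\<Sum>i<N. \<Sum>j<N. ip H (rep (\<lambda>a. cnj (v i a) * v j a) x (\<xi> j)) (\<xi> i))"
    \<comment> \<open>The two mixed sums each give minus the squared norm of \<open>s\<close> and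
      the corner gives it once with a plus sign, so the extended form is
      \<open>A - ip H s s\<close>.\<close>
    have three: "(\<Sum>j<N. ip H (rep (v j) x (\<xi> j)) (\<xi> N)) = - ip H s s"
    proof -
      have "ip H (rep (v j) x (\<xi> j)) (\<xi> N) = - (c j * ip H (rep (v j) x (g j)) s)" if "j < N" for j
        using that bounded_opsD(3)[OF good_op[OF v] g, of j "c j" j] rg s(1)
        by (simp add: \<xi>_def ip_smult_right ip_smult)
      then show ?thesis using s(2)[OF s(1)] by (simp add: sum_negf)
    qed
    have two: "(\<Sum>i<N. ip H (rep (\<lambda>a. cnj (v i a)) x (\<xi> N)) (\<xi> i)) = - ip H s s"
    proof -
      have "ip H (rep (\<lambda>a. cnj (v i a)) x (\<xi> N)) (\<xi> i) = cnj (ip H (rep (v i) x (\<xi> i)) (\<xi> N))" for i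
        using good_herm[OF v D_simps(6) xi xi, of i N i] by simp
      then have "(\<Sum>i<N. ip H (rep (\<lambda>a. cnj (v i a)) x (\<xi> N)) (\<xi> i)) = cnj (\<Sum>j<N. ip H (rep (v j) x (\<xi> j)) (\<xi> N))"
        by simp
      then show ?thesis unfolding three using ip_self[OF s(1)] by simp
    qed
    have four: "ip H (rep (\<lambda>a. 1) x (\<xi> N)) (\<xi> N) = ip H s s"
      using good_one s(1) by (simp add: \<xi>_def ip_smult ip_smult_right)
    have "0 \<le> Re (\<Sum>i<Suc N. \<Sum>j<Suc N. ip H (rep (\<lambda>a. cnj (v' i a) * v' j a) x (\<xi> j)) (\<xi> i))"
      by (rule good_psd) (rule v', rule xi)
    also have "(\<Sum>i<Suc N. \<Sum>j<Suc N. ip H (rep (\<lambda>a. cnj (v' i a) * v' j a) x (\<xi> j)) (\<xi> i))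
        = A + (\<Sum>i<N. ip H (rep (\<lambda>a. cnj (v i a)) x (\<xi> N)) (\<xi> i)) + (\<Sum>j<N. ip H (rep (v j) x (\<xi> j)) (\<xi> N))
          + ip H (rep (\<lambda>a. 1) x (\<xi> N)) (\<xi> N)"
      by (simp add: A_def v'_def sum.distrib)
    finally have "0 \<le> Re (A - ip H s s)" unfolding two three four by simp
    also have "A - ip H s s = (\<Sum>n<N. \<Sum>m<N. c n * cnj (c m) * gram x n m)"
    proof -
      have "A = (\<Sum>i<N. \<Sum>j<N. c j * cnj (c i) * ip H (rep (\<lambda>a. cnj (v i a) * v j a) x (g j)) (g i))"
        unfolding A_def
      proof (intro sum.cong refl)
        fix i j assume ij: "i \<in> {..<N}" "j \<in> {..<N}"
        have d: "(\<lambda>a. cnj (v i a) * v j a) \<in> D" using v D_simps by simp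
        show "ip H (rep (\<lambda>a. cnj (v i a) * v j a) x (\<xi> j)) (\<xi> i) = c j * cnj (c i) * ip H (rep (\<lambda>a. cnj (v i a) * v j a) x (g j)) (g i)"
          using ij bounded_opsD(3)[OF good_op[OF d] g, of "c j" j] good_in[OF d g, of j] g
          by (simp add: \<xi>_def ip_smult ip_smult_right)
      qed
      also have "\<dots> = (\<Sum>n<N. \<Sum>m<N. c n * cnj (c m) * ip H (rep (\<lambda>a. cnj (v m a) * v n a) x (g n)) (g m))"
        by (rule sum.swap)
      finally have 1: "A = \<dots>" .
      have "ip H s s = (\<Sum>n<N. \<Sum>m<N. c n * cnj (c m) * ip H (rep (v n) x (g n)) (rep (v m) x (g m)))"
      proof -
        have "ip H z s = (\<Sum>m<N. cnj (c m) * ip H z (rep (v m) x (g m)))" if z: "z \<in> carrier H" for z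
          unfolding ip_cnj[OF s(1) z] s(2)[OF z] using ip_cnj[OF rg z] by simp
        then show ?thesis using s(2)[OF s(1)] rg by (simp add: sum_distrib_left mult.assoc)
      qed
      then show ?thesis unfolding 1
        by (simp add: sum_subtractf[symmetric] gram_def v_def g_def case_prod_unfold algebra_simps)
    qed
    finally show ?thesis .
  qed
qed

end

end

section \<open>Fibre vectors in l2 and the measurable family of representations\<close>

lemma strict_mono_even: "strict_mono (\<lambda>n::nat. 2 * n)" and strict_mono_odd: "strict_mono (\<lambda>n::nat. 2 * n + 1)"
  by (auto simp: strict_mono_def)

lemma even_odd_disjoint: "range (\<lambda>n::nat. 2 * n) \<inter> range (\<lambda>n::nat. 2 * n + 1) = {}"
  by auto presburger

lemma measurable_ip2:
  assumes "\<And>i. (\<lambda>x. coord (f x) i) \<in> borel_measurable M" "\<And>i. (\<lambda>x. coord (g x) i) \<in> borel_measurable M"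
  shows "(\<lambda>x. ip2 (f x) (g x)) \<in> borel_measurable M"
proof -
  have "(\<lambda>x. cnj (coord (g x) i)) \<in> borel_measurable M" for i
    using borel_measurable_continuous_onI[of cnj] continuous_on_cnj[OF continuous_on_id]
    by (intro measurable_compose[OF assms(2)]) auto
  then show ?thesis unfolding ip2_def by (intro borel_measurable_suminf borel_measurable_times assms(1))
qed

lemma measurable_norm_l2:
  assumes "\<And>i. (\<lambda>x. coord (f x) i) \<in> borel_measurable M"
  shows "(\<lambda>x. (norm (f x))\<^sup>2) \<in> borel_measurable M"
proof -
  have "(\<lambda>x. (norm (f x))\<^sup>2) = (\<lambda>x. Re (ip2 (f x) (f x)))" by (simp add: ip2_self)
  then show ?thesis using measurable_ip2[OF assms assms] by simp
qed

context dilation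
begin

text \<open>The set of good points need not itself be measurable; removing a null set that covers
  its complement gives a measurable set of full measure.\<close>

definition good_set :: "'x set" where
  "good_set = space \<mu> - (SOME N. N \<in> null_sets \<mu> \<and> {x \<in> space \<mu>. \<not> good x} \<subseteq> N)"

lemma good_set: "good_set \<in> sets \<mu>" "AE x in \<mu>. x \<in> good_set" "x \<in> good_set \<Longrightarrow> good x"
proof -
  define N where "N = (SOME N. N \<in> null_sets \<mu> \<and> {x \<in> space \<mu>. \<not> good x} \<subseteq> N)"
  have "\<exists>N. N \<in> null_sets \<mu> \<and> {x \<in> space \<mu>. \<not> good x} \<subseteq> N"
    using AE_good by (auto simp: eventually_ae_filter)
  from someI_ex[OF this] have N: "N \<in> null_sets \<mu>" "{x \<in> space \<mu>. \<not> good x} \<subseteq> N" unfolding N_def[symmetric] by auto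
  have G: "good_set = space \<mu> - N" by (simp add: good_set_def N_def)
  show "good_set \<in> sets \<mu>" using N(1) by (auto simp: G)
  show "AE x in \<mu>. x \<in> good_set" using AE_not_in[OF N(1)] AE_space by eventually_elim (simp add: G)
  show "x \<in> good_set \<Longrightarrow> good x" using N(2) by (auto simp: G)
qed

text \<open>The even part is the compression to \<open>H\<close>, the odd part a Cholesky row. The
  value zero off \<open>good_set\<close> keeps coordinates measurable and still satisfies the axioms
  of \<open>gns_fiber\<close>.\<close>

definition kx :: "'x \<Rightarrow> ('a \<Rightarrow> complex) \<Rightarrow> nat \<Rightarrow> l2" where
  "kx x v j = (if x \<in> good_set then emb (\<lambda>n. 2 * n) (l2emb H (rep v x (h j)))
     + emb (\<lambda>n. 2 * n + 1) (Abs_l2 (chol (gram x) (code v j))) else 0)"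

text \<open>Even and odd parts are orthogonal, and \<open>gram\<close> subtracts precisely the inner
  product of the even parts, so the sum restores the full Stinespring form.\<close>

lemma ip2_kx:
  assumes x: "x \<in> good_set" and vw: "v \<in> D" "w \<in> D"
  shows "ip2 (kx x v j) (kx x w i) = ip H (rep (\<lambda>a. cnj (w a) * v a) x (h j)) (h i)"
proof -
  note g = good_set(3)[OF x]
  have d: "ip2 (emb (\<lambda>n. 2 * n) a) (emb (\<lambda>n. 2 * n + 1) b) = 0" "ip2 (emb (\<lambda>n. 2 * n + 1) b) (emb (\<lambda>n. 2 * n) a) = 0" for a b
    using ip2_emb_disjoint[OF strict_mono_even strict_mono_odd even_odd_disjoint]
      ip2_emb_disjoint[OF strict_mono_odd strict_mono_even] even_odd_disjoint by (simp_all add: Int_commute)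
  have "ip2 (kx x v j) (kx x w i) = ip H (rep v x (h j)) (rep w x (h i)) + gram x (code v j) (code w i)"
    using x by (simp add: kx_def ip2.add_left ip2.add_right d[simplified] ip2_emb[OF strict_mono_even] ip2_emb[OF strict_mono_odd, simplified]
      ip2_l2emb good_in[OF g] vw h_in ip2_chol[OF psd_gram[OF g]])
  then show ?thesis using vw by (simp add: gram_def dn_code)
qed

text \<open>By unitality the diagonal Gram entry at the function one vanishes, so the odd part is
  zero. The right-hand side is free of \<open>x\<close>, which yields a constant isometry.\<close>

lemma kx_one:
  assumes x: "x \<in> good_set"
  shows "kx x (\<lambda>_. 1) j = emb (\<lambda>n. 2 * n) (l2emb H (h j))"
proof -
  note g = good_set(3)[OF x]
  let ?b = "Abs_l2 (chol (gram x) (code (\<lambda>_. 1) j))"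
  have "ip2 ?b ?b = 0"
    unfolding ip2_chol[OF psd_gram[OF g]] using good_one[OF g h_in] D_simps(6) by (simp add: gram_def dn_code)
  then have "?b = 0" by (simp add: ip2_self)
  then show ?thesis using x good_one[OF g h_in] emb_zero[OF strict_mono_odd] by (simp add: kx_def)
qed

text \<open>The inner products of the \<open>kx\<close> are known, so linear relations follow by
  showing that the defect is orthogonal to every \<open>kx\<close>, and hence to itself; the norm
  bound is \<open>good_bound\<close> rewritten.\<close>

lemma gns:
  assumes x: "x \<in> good_set"
  shows "gns_fiber D (kx x)"
proof
  note g = good_set(3)[OF x]
  show "compact (UNIV :: 'a set)" by (rule cpt)
  show "dense_alg D" by (rule D)
  show "kx x (\<lambda>a. u a + v a) j = kx x u j + kx x v j" if uv: "u \<in> D" "v \<in> D" for u v j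
  proof -
    let ?d = "kx x (\<lambda>a. u a + v a) j - kx x u j - kx x v j"
    have uvD: "(\<lambda>a. u a + v a) \<in> D" using uv D_simps by simp
    have o: "ip2 ?d (kx x w i) = 0" if w: "w \<in> D" for w i
    proof -
      have p: "(\<lambda>a. cnj (w a) * u a) \<in> D" "(\<lambda>a. cnj (w a) * v a) \<in> D" using w uv D_simps by simp_all
      have "rep (\<lambda>a. cnj (w a) * u a + cnj (w a) * v a) x (h j) = rep (\<lambda>a. cnj (w a) * u a) x (h j) \<oplus> rep (\<lambda>a. cnj (w a) * v a) x (h j)"
        by (rule good_add[OF g p h_in])
      then show ?thesis unfolding ip2.diff_left
        using uv uvD w x p by (simp add: ip2_kx distrib_left ip_add h_in good_in[OF g])
    qed
    have "ip2 ?d ?d = 0" unfolding ip2.diff_right using o uv uvD by simp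
    then show ?thesis by (simp add: ip2_self diff_diff_eq)
  qed
  show "kx x (\<lambda>a. q * u a) j = scaleC q (kx x u j)" if q: "(\<lambda>_. q) \<in> D" and u: "u \<in> D" for q u j
  proof -
    let ?d = "kx x (\<lambda>a. q * u a) j - scaleC q (kx x u j)"
    have quD: "(\<lambda>a. q * u a) \<in> D" using D_simps(4)[OF q u] by simp
    have o: "ip2 ?d (kx x w i) = 0" if w: "w \<in> D" for w i
    proof -
      have p: "(\<lambda>a. cnj (w a) * u a) \<in> D" using w u D_simps by simp
      have "rep (\<lambda>a. q * (cnj (w a) * u a)) x (h j) = q \<odot> rep (\<lambda>a. cnj (w a) * u a) x (h j)"
        by (rule good_scale[OF g q p h_in])
      then show ?thesis unfolding ip2.diff_left ip2_scaleC_left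
        using u quD w x p by (simp add: ip2_kx ip_smult h_in good_in[OF g] mult.left_commute)
    qed
    have "ip2 ?d ?d = 0" unfolding ip2.diff_right ip2_scaleC_right using o u quD by simp
    then show ?thesis by (simp add: ip2_self)
  qed
  show "ip2 (kx x (\<lambda>a. u a * v a) j) (kx x w i) = ip2 (kx x v j) (kx x (\<lambda>a. cnj (u a) * w a) i)"
    if "u \<in> D" "v \<in> D" "w \<in> D" for u v w i j
    using that x D_simps by (simp add: ip2_kx mult.assoc mult.left_commute)
  show "norm (\<Sum>(v, j)\<leftarrow>l. kx x (\<lambda>a. u a * v a) j) \<le> C * norm (\<Sum>(v, j)\<leftarrow>l. kx x v j)"
    if u: "u \<in> D" "C \<in> \<rat>" "\<And>a. cmod (u a) \<le> C" and l: "set l \<subseteq> D \<times> UNIV" for u C l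
  proof -
    define n where "n = length l"
    define v where "v i = fst (l ! i)" for i
    define g' where "g' i = h (snd (l ! i))" for i
    have C: "0 \<le> C" using order_trans[OF norm_ge_zero u(3)] .
    have v: "v i \<in> D" if "i < n" for i
    proof -
      have "l ! i \<in> D \<times> UNIV" using l that nth_mem unfolding n_def by blast
      then show ?thesis by (auto simp: v_def mem_Times_iff)
    qed
    have g': "g' i \<in> carrier H" for i by (simp add: g'_def h_in)
    \<comment> \<open>One expansion for a general map \<open>f\<close> on \<open>D\<close>, used
      with multiplication by \<open>u\<close> and with the identity for the two sides of the
      bound.\<close>
    have nrm: "(norm (\<Sum>(v, j)\<leftarrow>l. kx x (f v) j))\<^sup>2
        = Re (\<Sum>i<n. \<Sum>j<n. ip H (rep (\<lambda>a. cnj (f (v i) a) * f (v j) a) x (g' j)) (g' i))"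
      if f: "\<And>v. v \<in> D \<Longrightarrow> f v \<in> D" for f
    proof -
      have s: "(\<Sum>(v, j)\<leftarrow>l. kx x (f v) j) = (\<Sum>i<n. kx x (f (v i)) (snd (l ! i)))"
        unfolding sum_list_sum_nth by (simp add: n_def v_def case_prod_unfold atLeast0LessThan)
      have "(norm (\<Sum>(v, j)\<leftarrow>l. kx x (f v) j))\<^sup>2 = Re (ip2 (\<Sum>i<n. kx x (f (v i)) (snd (l ! i))) (\<Sum>i<n. kx x (f (v i)) (snd (l ! i))))"
        unfolding s by (simp add: ip2_self)
      also have "ip2 (\<Sum>i<n. kx x (f (v i)) (snd (l ! i))) (\<Sum>i<n. kx x (f (v i)) (snd (l ! i)))
          = (\<Sum>i<n. \<Sum>j<n. ip2 (kx x (f (v j)) (snd (l ! j))) (kx x (f (v i)) (snd (l ! i))))"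
        unfolding ip2.sum_left ip2.sum_right ..
      also have "\<dots> = (\<Sum>i<n. \<Sum>j<n. ip H (rep (\<lambda>a. cnj (f (v i) a) * f (v j) a) x (g' j)) (g' i))"
        using x f v by (intro sum.cong refl) (simp add: ip2_kx g'_def)
      finally show ?thesis .
    qed
    have uf: "(\<lambda>a. u a * v a) \<in> D" if "v \<in> D" for v using that u(1) D_simps by simp
    have "(norm (\<Sum>(v, j)\<leftarrow>l. kx x (\<lambda>a. u a * v a) j))\<^sup>2 \<le> C\<^sup>2 * (norm (\<Sum>(v, j)\<leftarrow>l. kx x v j))\<^sup>2"
    proof -
      have 1: "(norm (\<Sum>(v, j)\<leftarrow>l. kx x (\<lambda>a. u a * v a) j))\<^sup>2
          = Re (\<Sum>i<n. \<Sum>j<n. ip H (rep (\<lambda>a. cnj (u a * v i a) * (u a * v j a)) x (g' j)) (g' i))"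
        by (rule nrm[of "\<lambda>v a. u a * v a", OF uf])
      have 2: "(norm (\<Sum>(v, j)\<leftarrow>l. kx x v j))\<^sup>2 = Re (\<Sum>i<n. \<Sum>j<n. ip H (rep (\<lambda>a. cnj (v i a) * v j a) x (g' j)) (g' i))"
        by (rule nrm[of "\<lambda>v. v"])
      show ?thesis unfolding 1 2 by (rule good_bound[OF g]) (rule v, assumption, rule g', rule u(1), rule u(2), rule u(3))
    qed
    then have "(norm (\<Sum>(v, j)\<leftarrow>l. kx x (\<lambda>a. u a * v a) j))\<^sup>2 \<le> (C * norm (\<Sum>(v, j)\<leftarrow>l. kx x v j))\<^sup>2" unfolding power_mult_distrib .
    then show ?thesis by (rule power2_le_imp_le) (use C in simp)
  qed
qed

text \<open>A unital representation is required at every point, so evaluation at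
  \<open>undefined\<close> fills the exceptional set.\<close>

definition dil :: "'x \<Rightarrow> ('a \<Rightarrow> complex) \<Rightarrow> l2 \<Rightarrow> l2" where
  "dil x u p = (if x \<in> good_set then gns_fiber.rho D (kx x) u p else scaleC (u undefined) p)"

lemma measurable_rep: "u \<in> D \<Longrightarrow> \<xi> \<in> carrier H \<Longrightarrow> \<eta> \<in> carrier H \<Longrightarrow>
    (\<lambda>x. ip H (rep u x \<xi>) \<eta>) \<in> borel_measurable (completion \<mu>)"
  using ess_boundedD(2)[OF rep(1)[OF D_simps(2)]] .

lemma measurable_gram: "(\<lambda>x. gram x n m) \<in> borel_measurable (completion \<mu>)"
proof -
  obtain v j w i where *: "dn n = (v, j)" "dn m = (w, i)" by (cases "dn n", cases "dn m") blast
  then have vw: "v \<in> D" "w \<in> D" using dn[of n] dn[of m] by auto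
  \<comment> \<open>Both vectors vary with \<open>x\<close>, so weak measurability does not apply
    directly; their coordinates in l2 are weak pairings with fixed frame vectors.\<close>
  have 1: "(\<lambda>x. ip H (rep v x (h j)) (rep w x (h i))) \<in> borel_measurable (completion \<mu>)"
  proof (rule measurable_completion_cong)
    show "ip H (rep v x (h j)) (rep w x (h i)) = ip2 (l2emb H (rep v x (h j))) (l2emb H (rep w x (h i)))"
      if "x \<in> space \<mu>" for x
      using that vw rep_in[OF D_simps(2)] h_in by (simp add: ip2_l2emb)
    have "(\<lambda>x. coord (l2emb H (rep u x (h j))) i) \<in> borel_measurable (completion \<mu>)" if "u \<in> D" for u i j
      by (rule measurable_completion_cong[OF _ measurable_rep[OF that h_in[of j] frame(1)[of i]]])
         (rule coord_l2emb, rule rep_in[OF D_simps(2)[OF that] _ h_in])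
    then show "(\<lambda>x. ip2 (l2emb H (rep v x (h j))) (l2emb H (rep w x (h i)))) \<in> borel_measurable (completion \<mu>)"
      using vw by (intro measurable_ip2)
  qed
  have "(\<lambda>a. cnj (w a) * v a) \<in> D" using vw D_simps by simp
  then show ?thesis unfolding gram_def * prod.case
    by (intro borel_measurable_diff measurable_rep 1 h_in)
qed

lemma good_set_completion: "good_set \<inter> space (completion \<mu>) \<in> sets (completion \<mu>)"
  using good_set(1) sets.sets_into_space[OF good_set(1)] by (simp add: Int_absorb2 sets_completionI_sets)

lemma measurable_kx:
  assumes v: "v \<in> D"
  shows "(\<lambda>x. coord (kx x v j) i) \<in> borel_measurable (completion \<mu>)"
proof -
  let ?e = "\<lambda>n::nat. 2 * n" and ?o = "\<lambda>n::nat. 2 * n + 1"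
  define f where "f x = (if i \<in> range ?e then ip H (rep v x (h j)) (frame (inv_into UNIV ?e i)) else 0)
      + (if i \<in> range ?o then chol (gram x) (code v j) (inv_into UNIV ?o i) else 0)" for x
  have f: "f \<in> borel_measurable (completion \<mu>)"
    unfolding f_def using measurable_rep[OF v h_in frame(1)] measurable_chol[OF measurable_gram]
    by (intro borel_measurable_add) (simp_all split: if_split)
  have "coord (kx x v j) i = (if x \<in> good_set then f x else 0)" for x
  proof (cases "x \<in> good_set")
    case True
    note g = good_set(3)[OF True]
    show ?thesis using True
      unfolding kx_def f_def
      by (simp only: if_True plus_l2.rep_eq coord_emb[OF strict_mono_even] coord_emb[OF strict_mono_odd]
          coord_chol[OF psd_gram[OF g]] coord_l2emb[OF good_in[OF g v h_in]])
  qed (simp add: kx_def coord_simps)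
  then show ?thesis using measurable_If_set[OF f, of "\<lambda>_. 0" good_set] good_set_completion by simp
qed

text \<open>Covers the exceptional points in \<open>gns_all\<close>, and gives access to the facts
  of \<open>gns_fiber\<close> about \<open>D\<close> and lists alone.\<close>

lemma zero_fiber: "gns_fiber D (\<lambda>_ _. 0)"
  by unfold_locales (auto simp: cpt D scaleC.zero_right ip2.zero_left case_prod_unfold sum_list_0)

lemma gns_all: "gns_fiber D (kx x)"
proof (cases "x \<in> good_set")
  case False
  then have "kx x = (\<lambda>_ _. 0)" by (simp add: kx_def fun_eq_iff)
  then show ?thesis using zero_fiber by simp
qed (rule gns)

lemma measurable_zz:
  assumes "l \<in> lists (D \<times> UNIV)"
  shows "(\<lambda>x. coord (gns_fiber.zz (kx x) l) i) \<in> borel_measurable (completion \<mu>)"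
proof -
  show ?thesis using assms unfolding gns_fiber.zz_def[OF gns_all]
  proof (induction l)
    case (Cons p l)
    then show ?case by (cases p) (auto simp: coord_simps intro!: borel_measurable_add measurable_kx)
  qed (simp add: coord_simps)
qed

lemma act_in_lists: "u \<in> D \<Longrightarrow> l \<in> lists (D \<times> UNIV) \<Longrightarrow> gns_fiber.act u l \<in> lists (D \<times> UNIV)"
  by (rule gns_fiber.act_in[OF zero_fiber])

text \<open>The projection onto the moving span is reached through near-minimisers from a fixed
  enumeration of lists. Their indices are measurable functions of \<open>x\<close> with countably
  many values, so each approximant is measurable and so is the limit.\<close>

lemma measurable_dil:
  assumes u: "continuous_on UNIV u"
  shows "(\<lambda>x. ip2 (dil x u \<xi>) \<eta>) \<in> borel_measurable (completion \<mu>)"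
proof -
  interpret Z: gns_fiber D "\<lambda>_ _. 0" by (rule zero_fiber)
  \<comment> \<open>Approximation of \<open>u\<close> concerns \<open>D\<close> only, so the same
    sequence serves every fibre; the zero fibre is used just to state it.\<close>
  obtain us where us: "gns_fiber.uconv D us u" using Z.uconv_ex[OF u] by blast
  then have usD: "us m \<in> D" for m by (simp add: Z.uconv_def)
  define E :: "nat \<Rightarrow> (('a \<Rightarrow> complex) \<times> nat) list" where "E = from_nat_into (lists (D \<times> UNIV))"
  have rE: "range E = lists (D \<times> UNIV)" unfolding E_def using D_simps(1) by (intro range_from_nat_into) auto
  then have E: "E n \<in> lists (D \<times> UNIV)" for n by blast
  let ?zz = "\<lambda>x. gns_fiber.zz (kx x)"
  define dst where "dst n x = (norm (\<xi> - ?zz x (E n)))\<^sup>2" for n x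
  have dz: "(\<lambda>x. coord (\<xi> - ?zz x (E n)) i) \<in> borel_measurable (completion \<mu>)" for n i
    unfolding minus_l2.rep_eq by (intro borel_measurable_diff measurable_zz E) simp
  have dst: "dst n \<in> borel_measurable (completion \<mu>)" for n
    unfolding dst_def by (rule measurable_norm_l2[OF dz])
  have inf: "(\<lambda>x. INF n. dst n x) \<in> borel_measurable (completion \<mu>)"
    by (rule borel_measurable_cINF_real) (auto intro: dst)
  \<comment> \<open>Taking the least admissible index makes the selection explicit, and hence
    measurable.\<close>
  define N where "N m x = (LEAST n. dst n x < (INF n. dst n x) + 1 / real (Suc m))" for m x
  have N: "dst (N m x) x < (INF n. dst n x) + 1 / real (Suc m)" for m x
  proof -
    have "(INF n. dst n x) < (INF n. dst n x) + 1 / real (Suc m)" by simp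
    then obtain n where "dst n x < (INF n. dst n x) + 1 / real (Suc m)"
      using cInf_lessD[of "range (\<lambda>n. dst n x)"] by blast
    then show ?thesis unfolding N_def by (rule LeastI)
  qed
  have Nm: "N m \<in> measurable (completion \<mu>) (count_space UNIV)" for m
    unfolding N_def using dst inf by (intro measurable_Least borel_measurable_pred_less) simp_all
  define f where "f m x = ip2 (?zz x (gns_fiber.act (us m) (E (N m x)))) \<eta> + u undefined * ip2 (\<xi> - ?zz x (E (N m x))) \<eta>" for m x
  have f: "f m \<in> borel_measurable (completion \<mu>)" for m
    unfolding f_def
    by (rule measurable_compose_countable[OF _ Nm, of "\<lambda>n x. ip2 (?zz x (gns_fiber.act (us m) (E n))) \<eta> + u undefined * ip2 (\<xi> - ?zz x (E n)) \<eta>"])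
       (intro borel_measurable_add borel_measurable_times measurable_ip2 measurable_zz act_in_lists usD E dz, simp_all)
  show ?thesis
  proof (rule borel_measurable_LIMSEQ_metric)
    show "(\<lambda>x. if x \<in> good_set then f m x else u undefined * ip2 \<xi> \<eta>) \<in> borel_measurable (completion \<mu>)" for m
      using f good_set_completion by (intro measurable_If_set) simp_all
    show "(\<lambda>m. if x \<in> good_set then f m x else u undefined * ip2 \<xi> \<eta>) \<longlonglongrightarrow> ip2 (dil x u \<xi>) \<eta>" for x
    proof (cases "x \<in> good_set")
      case True
      then show ?thesis
        using gns_fiber.rho_near_minimizer[OF gns_all u us rE, of \<xi> x "\<lambda>m. N m x" \<eta>] N[of _ x]
        by (simp add: dil_def f_def dst_def)
    qed (simp add: dil_def ip2_scaleC_left)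
  qed
qed

text \<open>On the dense sequence both sides are limits along \<open>us\<close>, by
  \<open>rho_k\<close> at the function one and by \<open>lim\<close>; both sides are continuous in
  the two vectors, which gives the general case.\<close>

lemma ip2_dil_one:
  assumes x: "x \<in> good_set" and u: "continuous_on UNIV u" and us: "gns_fiber.uconv D us u"
    and lim: "\<And>\<xi> \<eta>. \<xi> \<in> carrier H \<Longrightarrow> \<eta> \<in> carrier H \<Longrightarrow>
      (\<lambda>m. ip H (rep (us m) x \<xi>) \<eta>) \<longlonglongrightarrow> ip H (rep u x \<xi>) \<eta>"
    and ab: "a \<in> carrier H" "b \<in> carrier H"
  shows "ip2 (dil x u (emb (\<lambda>n. 2 * n) (l2emb H a))) (emb (\<lambda>n. 2 * n) (l2emb H b)) = ip H (rep u x a) b"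
proof -
  interpret F: gns_fiber D "kx x" by (rule gns_all)
  let ?W = "\<lambda>a. emb (\<lambda>n. 2 * n) (l2emb H a)"
  note g = good_set(3)[OF x]
  have usD: "us m \<in> D" for m using us by (simp add: F.uconv_def)
  have hh: "ip2 (F.rho u (?W (h j))) (?W (h i)) = ip H (rep u x (h j)) (h i)" for i j
  proof -
    \<comment> \<open>The factor one is kept to match \<open>rho_k\<close>; multiplying by it gives
      back \<open>us m\<close>.\<close>
    have "(\<lambda>m. ip2 (kx x (\<lambda>a. us m a * 1) j) (kx x (\<lambda>_. 1) i)) \<longlonglongrightarrow> ip2 (F.rho u (kx x (\<lambda>_. 1) j)) (kx x (\<lambda>_. 1) i)"
      by (intro ip2.tendsto F.rho_k u us D_simps tendsto_const)
    moreover have "ip2 (kx x (\<lambda>a. us m a * 1) j) (kx x (\<lambda>_. 1) i) = ip H (rep (us m) x (h j)) (h i)" for m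
      using ip2_kx[OF x usD D_simps(6), of m j i] by simp
    ultimately show ?thesis using lim[OF h_in h_in, of j i] LIMSEQ_unique by (simp add: kx_one[OF x])
  qed
  define s where "s \<xi> k = (SOME n. ip_norm H (h n \<ominus> \<xi>) < 1 / real (Suc k))" for \<xi> k
  have s: "ip_norm H (h (s \<xi> k) \<ominus> \<xi>) < 1 / real (Suc k)" if "\<xi> \<in> carrier H" for \<xi> k
    unfolding s_def by (rule someI_ex[OF h_dense[OF that]]) simp
  have sl: "(\<lambda>k. ip_norm H (h (s \<xi> k) \<ominus> \<xi>)) \<longlonglongrightarrow> 0" if "\<xi> \<in> carrier H" for \<xi>
    by (rule Lim_null_comparison[OF _ LIMSEQ_Suc[OF lim_1_over_n]])
       (use s[OF that] h_in that in \<open>auto intro!: always_eventually less_imp_le\<close>)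
  have Wn: "norm (?W a - ?W b) = ip_norm H (a \<ominus> b)" if "a \<in> carrier H" "b \<in> carrier H" for a b
    unfolding norm_eq_sqrt_inner inner_l2_def ip_norm_def
    using that by (simp add: ip2.diff_left ip2.diff_right ip2_emb[OF strict_mono_even] ip2_l2emb ip_diff_left ip_diff_right)
  have Wl: "(\<lambda>k. ?W (h (s \<xi> k))) \<longlonglongrightarrow> ?W \<xi>" if "\<xi> \<in> carrier H" for \<xi>
  proof -
    have "(\<lambda>k. norm (?W (h (s \<xi> k)) - ?W \<xi>)) \<longlonglongrightarrow> 0" using sl[OF that] that h_in by (simp add: Wn)
    then show ?thesis using tendsto_norm_zero_iff LIM_zero_iff by blast
  qed
  obtain C where C: "\<And>\<xi>. norm (F.rho u \<xi>) \<le> C * norm \<xi>" using F.rho_bound[OF u] by blast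
  have bl: "bounded_linear (F.rho u)"
    by (rule bounded_linear_intro[of _ C]) (use C in \<open>auto simp: F.rho_add[OF u] scaleR_scaleC F.rho_scale[OF u] mult.commute\<close>)
  have 1: "(\<lambda>k. ip2 (F.rho u (?W (h (s a k)))) (?W (h (s b k)))) \<longlonglongrightarrow> ip2 (F.rho u (?W a)) (?W b)"
    by (rule ip2.tendsto[OF bounded_linear.tendsto[OF bl Wl[OF ab(1)]] Wl[OF ab(2)]])
  have T: "rep u x \<in> bounded_ops H H" using rep_bounded_op[OF u good_space[OF g]] .
  then obtain B where B: "\<forall>\<xi>\<in>carrier H. ip_norm H (rep u x \<xi>) \<le> B * ip_norm H \<xi>" using bounded_opsD(5) by blast
  have "(\<lambda>k. ip_norm H (rep u x (h (s a k)) \<ominus> rep u x a)) \<longlonglongrightarrow> 0"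
  proof (rule Lim_null_comparison)
    show "\<forall>\<^sub>F k in sequentially. norm (ip_norm H (rep u x (h (s a k)) \<ominus> rep u x a)) \<le> B * ip_norm H (h (s a k) \<ominus> a)"
      using B bounded_ops_diff[OF T h_in ab(1), symmetric] bounded_opsD(1)[OF T] h_in ab
      by (intro always_eventually allI) simp
    show "(\<lambda>k. B * ip_norm H (h (s a k) \<ominus> a)) \<longlonglongrightarrow> 0" using tendsto_mult_right_zero[OF sl[OF ab(1)]] .
  qed
  then have 2: "(\<lambda>k. ip H (rep u x (h (s a k))) (h (s b k))) \<longlonglongrightarrow> ip H (rep u x a) b"
    by (intro ip_tendsto bounded_opsD(1)[OF T] h_in ab sl)
  show ?thesis using 1 2 LIMSEQ_unique x unfolding hh by (simp add: dil_def)
qed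

text \<open>For each \<open>m\<close> the contraction estimate applies to \<open>us m - u\<close>,
  and countably many null sets are discarded. The exceptional set depends on \<open>u\<close>, as
  the theorem allows, while \<open>dil\<close> does not change.\<close>

lemma AE_dil:
  assumes u: "continuous_on UNIV u"
  shows "AE x in \<mu>. \<forall>a\<in>carrier H. \<forall>b\<in>carrier H.
    ip2 (dil x u (emb (\<lambda>n. 2 * n) (l2emb H a))) (emb (\<lambda>n. 2 * n) (l2emb H b)) = ip H (rep u x a) b"
proof -
  interpret Z: gns_fiber D "\<lambda>_ _. 0" by (rule zero_fiber)
  obtain us where us: "gns_fiber.uconv D us u" using Z.uconv_ex[OF u] by blast
  then have usD: "us m \<in> D" for m by (simp add: Z.uconv_def)
  obtain e where e: "e \<longlonglongrightarrow> 0" "\<And>m a. cmod (us m a - u a) \<le> e m" using us by (auto simp: Z.uconv_def)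
  have mu: "continuous_on UNIV (\<lambda>a. - 1 * u a)" using u by (intro continuous_intros)
  have d: "continuous_on UNIV (\<lambda>a. us m a + - 1 * u a)" for m using u D_simps(2)[OF usD] by (intro continuous_intros)
  \<comment> \<open>Since \<open>u\<close> lies outside \<open>D\<close> in general, additivity for
    these differences is not part of \<open>good\<close> and is imposed almost everywhere
    here.\<close>
  have "AE x in \<mu>. \<forall>m. (\<forall>\<xi>\<in>carrier H. ip_norm H (rep (\<lambda>a. us m a + - 1 * u a) x \<xi>) \<le> e m * ip_norm H \<xi>)
      \<and> (\<forall>\<xi>\<in>carrier H. rep (\<lambda>a. us m a + - 1 * u a) x \<xi> = rep (us m) x \<xi> \<oplus> rep (\<lambda>a. - 1 * u a) x \<xi>)"
    unfolding AE_all_countable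
  proof
    fix m
    show "AE x in \<mu>. (\<forall>\<xi>\<in>carrier H. ip_norm H (rep (\<lambda>a. us m a + - 1 * u a) x \<xi>) \<le> e m * ip_norm H \<xi>)
      \<and> (\<forall>\<xi>\<in>carrier H. rep (\<lambda>a. us m a + - 1 * u a) x \<xi> = rep (us m) x \<xi> \<oplus> rep (\<lambda>a. - 1 * u a) x \<xi>)"
      by (intro AE_conjI rep_contraction rep_add d mu D_simps(2)[OF usD]) (use e(2) in simp)
  qed
  then show ?thesis using rep_smult[OF u, of "- 1"] good_set(2)
  proof eventually_elim
    case (elim x)
    have sp: "x \<in> space \<mu>" using good_space[OF good_set(3)[OF elim(3)]] .
    have "(\<lambda>m. ip H (rep (us m) x \<xi>) \<eta>) \<longlonglongrightarrow> ip H (rep u x \<xi>) \<eta>"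
      if xe: "\<xi> \<in> carrier H" "\<eta> \<in> carrier H" for \<xi> \<eta>
    proof -
      have r: "rep u x \<xi> \<in> carrier H" "rep (us m) x \<xi> \<in> carrier H" "rep (\<lambda>a. us m a + - 1 * u a) x \<xi> \<in> carrier H" for m
        using rep_in[OF u sp xe(1)] rep_in[OF D_simps(2)[OF usD] sp xe(1)] rep_in[OF d sp xe(1)] by auto
      have eq: "ip H (rep (us m) x \<xi>) \<eta> - ip H (rep u x \<xi>) \<eta> = ip H (rep (\<lambda>a. us m a + - 1 * u a) x \<xi>) \<eta>" for m
      proof -
        have "rep (\<lambda>a. us m a + - 1 * u a) x \<xi> = rep (us m) x \<xi> \<oplus> (- 1) \<odot> rep u x \<xi>"
          using elim(1,2) xe by simp
        then show ?thesis using r xe by (simp only:) (simp add: ip_add ip_smult)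
      qed
      have bd: "cmod (ip H (rep (\<lambda>a. us m a + - 1 * u a) x \<xi>) \<eta>) \<le> e m * (ip_norm H \<xi> * ip_norm H \<eta>)" for m
      proof -
        have "cmod (ip H (rep (\<lambda>a. us m a + - 1 * u a) x \<xi>) \<eta>) \<le> ip_norm H (rep (\<lambda>a. us m a + - 1 * u a) x \<xi>) * ip_norm H \<eta>"
          by (rule cauchy_schwarz[OF r(3) xe(2)])
        also have "\<dots> \<le> (e m * ip_norm H \<xi>) * ip_norm H \<eta>" using elim(1) xe by (intro mult_right_mono ip_norm_nonneg) blast+
        finally show ?thesis by (simp add: mult.assoc)
      qed
      have lim: "(\<lambda>m. e m * (ip_norm H \<xi> * ip_norm H \<eta>)) \<longlonglongrightarrow> 0" using tendsto_mult_left_zero[OF e(1)] .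
      have "(\<lambda>m. ip H (rep (us m) x \<xi>) \<eta> - ip H (rep u x \<xi>) \<eta>) \<longlonglongrightarrow> 0"
        unfolding eq by (rule Lim_null_comparison[OF always_eventually lim]) (rule allI, rule bd)
      then show ?thesis by (rule LIM_zero_cancel)
    qed
    then show ?case using ip2_dil_one[OF elim(3) u us] by blast
  qed
qed

end

section \<open>Transfer to the carrier-based setting and assembly\<close>

text \<open>Reduces the homomorphism conditions to statements about operators on the type
  \<open>l2\<close>, so that good and exceptional points can be treated alike.\<close>

lemma unital_star_hom_l2:
  fixes R :: "('a :: topological_space \<Rightarrow> complex) \<Rightarrow> l2 \<Rightarrow> l2"
  assumes add: "\<And>u p q. continuous_on UNIV u \<Longrightarrow> R u (p + q) = R u p + R u q"
    and scale: "\<And>u c p. continuous_on UNIV u \<Longrightarrow> R u (scaleC c p) = scaleC c (R u p)"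
    and uadd: "\<And>u v p. continuous_on UNIV u \<Longrightarrow> continuous_on UNIV v \<Longrightarrow> R (\<lambda>a. u a + v a) p = R u p + R v p"
    and uscale: "\<And>u c p. continuous_on UNIV u \<Longrightarrow> R (\<lambda>a. c * u a) p = scaleC c (R u p)"
    and umult: "\<And>u v p. continuous_on UNIV u \<Longrightarrow> continuous_on UNIV v \<Longrightarrow> R (\<lambda>a. u a * v a) p = R u (R v p)"
    and one: "\<And>p. R (\<lambda>_. 1) p = p"
    and adj: "\<And>u p q. continuous_on UNIV u \<Longrightarrow> ip2 (R u p) q = ip2 p (R (\<lambda>a. cnj (u a)) q)"
    and bound: "\<And>u. continuous_on UNIV u \<Longrightarrow> \<exists>C. \<forall>p. norm (R u p) \<le> C * norm p"
  shows "(\<lambda>u. \<lambda>\<xi>\<in>range coord. coord (R u (Abs_l2 \<xi>))) \<in> unital_star_hom continuous_fun_alg (bounded_op_alg l2_space)"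
    (is "?\<pi> \<in> _")
proof -
  interpret K: separable_hilbert_space l2_space by (rule separable_hilbert_space_l2)
  have op: "?\<pi> u \<in> bounded_ops l2_space l2_space" if u: "continuous_on UNIV u" for u
  proof -
    obtain C where "\<forall>p. norm (R u p) \<le> C * norm p" using bound[OF u] by blast
    then show ?thesis
      by (intro bounded_opsI[where C = C]) (auto simp: coord_inverse coord_inject add[OF u] scale[OF u])
  qed
  have "?\<pi> \<in> ring_hom continuous_fun_alg (bounded_op_alg l2_space)"
  proof (rule ring_hom_memI)
    show "?\<pi> u \<in> carrier (bounded_op_alg l2_space)" if "u \<in> carrier continuous_fun_alg" for u
      using that op by (simp add: continuous_fun_alg_simps)
    show "?\<pi> (u \<otimes>\<^bsub>continuous_fun_alg\<^esub> v) = ?\<pi> u \<otimes>\<^bsub>bounded_op_alg l2_space\<^esub> ?\<pi> v"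
      if "u \<in> carrier continuous_fun_alg" "v \<in> carrier continuous_fun_alg" for u v
      using that by (auto simp: continuous_fun_alg_simps compose_def coord_inverse umult intro!: restrict_ext)
    show "?\<pi> (u \<oplus>\<^bsub>continuous_fun_alg\<^esub> v) = ?\<pi> u \<oplus>\<^bsub>bounded_op_alg l2_space\<^esub> ?\<pi> v"
      if "u \<in> carrier continuous_fun_alg" "v \<in> carrier continuous_fun_alg" for u v
      using that by (auto simp: continuous_fun_alg_simps coord_inverse uadd intro!: restrict_ext)
    show "?\<pi> \<one>\<^bsub>continuous_fun_alg\<^esub> = \<one>\<^bsub>bounded_op_alg l2_space\<^esub>"
      by (auto simp: continuous_fun_alg_simps coord_inverse one intro!: restrict_ext)
  qed
  moreover have "?\<pi> (c \<odot>\<^bsub>continuous_fun_alg\<^esub> u) = c \<odot>\<^bsub>bounded_op_alg l2_space\<^esub> ?\<pi> u"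
    if "u \<in> carrier continuous_fun_alg" for c u
    using that by (auto simp: continuous_fun_alg_simps coord_inverse uscale intro!: restrict_ext)
  moreover have "?\<pi> (star continuous_fun_alg u) = star (bounded_op_alg l2_space) (?\<pi> u)"
    if "u \<in> carrier continuous_fun_alg" for u
  proof -
    have u: "continuous_on UNIV u" using that by (simp add: continuous_fun_alg_simps)
    have "adjoint_op l2_space l2_space (?\<pi> u) \<eta> = ?\<pi> (\<lambda>a. cnj (u a)) \<eta>" if e: "\<eta> \<in> carrier l2_space" for \<eta>
      by (rule K.adjoint_op_eqI) (use e in \<open>auto simp: coord_inverse adj[OF u]\<close>)
    then show ?thesis
      by (intro extensionalityI[of _ "carrier l2_space"]) (auto simp: continuous_fun_alg_simps adjoint_op_def)
  qed
  ultimately show ?thesis by (simp add: unital_star_hom_def)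
qed

context dilation
begin

lemma dil_star_hom:
  "(\<lambda>u. \<lambda>\<xi>\<in>range coord. coord (dil x u (Abs_l2 \<xi>))) \<in> unital_star_hom continuous_fun_alg (bounded_op_alg l2_space)"
proof (cases "x \<in> good_set")
  case True
  interpret F: gns_fiber D "kx x" by (rule gns_all)
  have "dil x = F.rho" using True by (simp add: dil_def fun_eq_iff)
  then show ?thesis
    by (intro unital_star_hom_l2)
       (simp_all add: F.rho_add F.rho_scale F.rho_uadd F.rho_uscale F.rho_mult F.rho_one F.rho_adj F.rho_bound)
next
  case False
  then have "dil x = (\<lambda>u. scaleC (u undefined))" by (simp add: dil_def fun_eq_iff)
  then show ?thesis
    by (intro unital_star_hom_l2)
       (auto simp: scaleC.add_right scaleC.add_left mult.commute ip2_scaleC_left ip2_scaleC_right norm_scaleC)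
qed

end

theorem theorem4p6:
  fixes \<mu> :: "'x :: {second_countable_topology, t2_space} measure"
    and H :: "'h inner_prod_space"
    and \<phi> :: "('a :: {second_countable_topology, t2_space} \<Rightarrow> complex) \<Rightarrow> ('x \<Rightarrow> 'h \<Rightarrow> 'h) set"
  assumes "compact (UNIV :: 'x set)"
    and "prob_space \<mu>" and "sets \<mu> = sets borel"
    and "compact (UNIV :: 'a set)"
    and "separable_hilbert_space H"
    and "unital_completely_positive continuous_fun_alg (Linf_alg \<mu> H) \<phi>"
  shows "\<exists>(K :: (nat \<Rightarrow> complex) inner_prod_space) V \<pi>.
           separable_hilbert_space K \<and> V \<in> isometries H K \<and> measurable_rep_family \<mu> K \<pi> \<and>
           (\<forall>u\<in>carrier continuous_fun_alg. \<forall>F\<in>\<phi> u.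
              AE x in \<mu>. F x = compose (carrier H) (adjoint_op H K V) (compose (carrier H) (\<pi> x u) V))"
proof -
  interpret separable_hilbert_space H by (rule assms(5))
  obtain D :: "('a \<Rightarrow> complex) set" where D: "dense_alg D" using ex_dense_alg[OF assms(4)] by blast
  obtain h :: "nat \<Rightarrow> 'h" where h: "\<And>n. h n \<in> carrier H"
    "\<And>\<xi> e. \<xi> \<in> carrier H \<Longrightarrow> e > 0 \<Longrightarrow> \<exists>n. ip_norm H (h n \<ominus>\<^bsub>H\<^esub> \<xi>) < e" by (rule dense_seq) blast
  interpret dilation H \<mu> \<phi> D h
    by (intro dilation.intro ucp_map.intro ucp_map_axioms.intro dilation_axioms.intro assms D h)
  \<comment> \<open>By \<open>kx_one\<close>, this is where every good fibre places
    \<open>1 \<otimes> \<xi>\<close> when \<open>\<xi>\<close> belongs to the dense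
    sequence.\<close>
  define W where "W \<xi> = emb (\<lambda>n. 2 * n) (l2emb H \<xi>)" for \<xi>
  define V where "V = (\<lambda>\<xi>\<in>carrier H. coord (W \<xi>))"
  define \<pi> where "\<pi> x u = (\<lambda>\<xi>\<in>range coord. coord (dil x u (Abs_l2 \<xi>)))" for x u
  have W: "norm (W \<xi>) = ip_norm H \<xi>" if "\<xi> \<in> carrier H" for \<xi>
    using that by (simp add: W_def norm_eq_sqrt_inner inner_l2_def ip2_emb[OF strict_mono_even] ip2_l2emb ip_norm_def)
  have V: "V \<in> isometries H l2_space"
    unfolding isometries_def
  proof (intro CollectI conjI ballI)
    show "V \<in> bounded_ops H l2_space"
      by (rule bounded_opsI[where C = 1])
        (auto simp: V_def W[unfolded W_def] W_def l2emb_add l2emb_smult emb_add[OF strict_mono_even] emb_scaleC[OF strict_mono_even])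
  qed (simp add: V_def W)
  have \<pi>: "measurable_rep_family \<mu> l2_space \<pi>"
    unfolding measurable_rep_family_def
  proof (intro conjI ballI)
    show "\<pi> x \<in> unital_star_hom continuous_fun_alg (bounded_op_alg l2_space)" for x
      using dil_star_hom[of x] unfolding \<pi>_def .
    fix u :: "'a \<Rightarrow> complex" and \<xi> \<eta>
    assume "u \<in> carrier continuous_fun_alg" "\<xi> \<in> carrier l2_space" "\<eta> \<in> carrier l2_space"
    then show "(\<lambda>x. ip l2_space (\<pi> x u \<xi>) \<eta>) \<in> borel_measurable (completion \<mu>)"
      using measurable_dil by (auto simp: continuous_fun_alg_simps \<pi>_def coord_inverse)
  qed
  have "AE x in \<mu>. F x = compose (carrier H) (adjoint_op H l2_space V) (compose (carrier H) (\<pi> x u) V)"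
    if "u \<in> carrier continuous_fun_alg" "F \<in> \<phi> u" for u F
  proof -
    have u: "continuous_on UNIV u" using that by (simp add: continuous_fun_alg_simps)
    show ?thesis using rep_eq_AE[OF u that(2)] AE_dil[OF u] AE_space
    proof eventually_elim
      case (elim x)
      have T: "rep u x \<in> bounded_ops H H" by (rule rep_bounded_op[OF u elim(3)])
      \<comment> \<open>The adjoint of \<open>V\<close> is never computed:
        \<open>adjoint_op_eqI\<close> identifies its value by testing against the vectors
        \<open>V \<zeta>\<close>, which is what \<open>AE_dil\<close> provides.\<close>
      have "adjoint_op H l2_space V (\<pi> x u (V \<xi>)) = rep u x \<xi>" if xi: "\<xi> \<in> carrier H" for \<xi>
      proof (rule adjoint_op_eqI)
        show "rep u x \<xi> \<in> carrier H" by (rule bounded_opsD(1)[OF T xi])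
        show "\<pi> x u (V \<xi>) \<in> carrier l2_space" using xi by (simp add: \<pi>_def V_def)
        show "ip l2_space (V \<zeta>) (\<pi> x u (V \<xi>)) = ip H \<zeta> (rep u x \<xi>)" if z: "\<zeta> \<in> carrier H" for \<zeta>
        proof -
          have "ip l2_space (V \<zeta>) (\<pi> x u (V \<xi>)) = ip2 (W \<zeta>) (dil x u (W \<xi>))"
            using xi z by (simp add: \<pi>_def V_def coord_inverse)
          also have "\<dots> = cnj (ip H (rep u x \<xi>) \<zeta>)"
            using elim(2) xi z ip2_cnj[of "W \<zeta>" "dil x u (W \<xi>)"] by (simp add: W_def)
          also have "\<dots> = ip H \<zeta> (rep u x \<xi>)" by (rule ip_cnj[symmetric]) (use bounded_opsD(1)[OF T xi] z in auto)
          finally show ?thesis .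
        qed
      qed
      then show ?case unfolding elim(1)
        by (intro extensionalityI[OF bounded_opsD(4)[OF T] compose_extensional]) (simp add: compose_eq)
    qed
  qed
  then show ?thesis using separable_hilbert_space_l2 V \<pi> by blast
qed

end
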